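(* Let $\Gamma=(V,E)$ be a finite simplicial graph with a vertex-labelling by non-trivial finitely generated groups $G_v$ ($v\in V$), and let $G_\Gamma$ be the corresponding graph product. Decompose $\Gamma$ as a join $\Gamma_1*\Gamma_2$, where $\Gamma_1$ is the full subgraph generated by the vertices which are adjacent to all other vertices of $\Gamma$ (and $\Gamma_2$ is the full subgraph generated by the remaining vertices). Then $G_\Gamma$ is $2$-ended, i.e. $e(G_\Gamma)=2$, if and only if at least one of the following holds: (i) the graph $\Gamma$ is complete, exactly one vertex group is $2$-ended, and all other vertex groups are finite; or (ii) the subgraph $\Gamma_1$ is complete with finite vertex groups, and $\Gamma_2=(\{\mathbb{Z}_2,\mathbb{Z}_2\},\emptyset)$, i.e. $\Gamma_2$ consists of exactly two vertices, not joined by an edge, each with vertex group isomorphic to $\mathbb{Z}_2$.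
   Context: A simplicial graph $\Gamma=(V,E)$ consists of a set $V$ of vertices and a set $E$ of 2-element subsets of $V$ (edges). A subgraph $\Gamma'=(V',E')$ is full (or induced) if $E'$ contains all edges $\{v,w\}\in E$ with $v,w\in V'$. A graph is complete if every two distinct vertices are joined by an edge (the empty graph counts as complete). The join $\Gamma_1*\Gamma_2$ is obtained from the disjoint union of $\Gamma_1$ and $\Gamma_2$ by adding all edges between a vertex of $\Gamma_1$ and a vertex of $\Gamma_2$; either of the two graphs may be empty. $\mathbb{Z}_2$ denotes the cyclic group of order $2$. Graph product: given a finite simplicial graph $\Gamma=(V,E)$ and a non-trivial finitely generated group $G_v$ for each $v\in V$, the graph product $G_\Gamma$ is the quotient of the free product $\ast_{v\in V}G_v$ by the normal closure of all commutators $[g,h]$ with $g\in G_u$, $h\in G_w$, $\{u,w\}\in E$. Number of ends: for a finitely generated group $G$ with finite generating set $S$, $e(G):=\sup\{\#\pi_0^u(\mathrm{Cay}(G,S)-C)\mid C\subseteq \mathrm{Cay}(G,S)\text{ finite subgraph}\}$, where $\mathrm{Cay}(G,S)$ is the Cayley graph of $G$ with respect to $S$ and $\#\pi_0^u(\mathrm{Cay}(G,S)-C)$ is the number of unbounded connected components of $\mathrm{Cay}(G,S)-C$. This does not depend on $S$. A group $G$ is $2$-ended if $e(G)=2$. *)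

theory Defs
  imports "HOL-Algebra.Elementary_Groups" "HOL-Library.Extended_Nat"
begin

record 'v sgraph =
  verts :: "'v set"
  edges :: "'v set set"

definition simplicial_graph :: "'v sgraph \<Rightarrow> bool" where
  "simplicial_graph \<Gamma> \<longleftrightarrow> (\<forall>e\<in>edges \<Gamma>. e \<subseteq> verts \<Gamma> \<and> card e = 2)"

definition finite_graph :: "'v sgraph \<Rightarrow> bool" where
  "finite_graph \<Gamma> \<longleftrightarrow> finite (verts \<Gamma>) \<and> finite (edges \<Gamma>)"

definition subgraph :: "'v sgraph \<Rightarrow> 'v sgraph \<Rightarrow> bool" where
  "subgraph C \<Gamma> \<longleftrightarrow> simplicial_graph C \<and> verts C \<subseteq> verts \<Gamma> \<and> edges C \<subseteq> edges \<Gamma>"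

definition full_subgraph :: "'v sgraph \<Rightarrow> 'v set \<Rightarrow> 'v sgraph" where
  "full_subgraph \<Gamma> W = \<lparr>verts = verts \<Gamma> \<inter> W, edges = {e \<in> edges \<Gamma>. e \<subseteq> W}\<rparr>"

definition complete_graph :: "'v sgraph \<Rightarrow> bool" where
  "complete_graph \<Gamma> \<longleftrightarrow> (\<forall>u\<in>verts \<Gamma>. \<forall>w\<in>verts \<Gamma>. u \<noteq> w \<longrightarrow> {u, w} \<in> edges \<Gamma>)"

text \<open>Only meaningful for graphs with disjoint vertex sets.\<close>

definition graph_join :: "'v sgraph \<Rightarrow> 'v sgraph \<Rightarrow> 'v sgraph" where
  "graph_join \<Gamma>\<^sub>1 \<Gamma>\<^sub>2 =
     \<lparr>verts = verts \<Gamma>\<^sub>1 \<union> verts \<Gamma>\<^sub>2,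
      edges = edges \<Gamma>\<^sub>1 \<union> edges \<Gamma>\<^sub>2 \<union> {{u, w} | u w. u \<in> verts \<Gamma>\<^sub>1 \<and> w \<in> verts \<Gamma>\<^sub>2}\<rparr>"

definition cone_vertices :: "'v sgraph \<Rightarrow> 'v set" where
  "cone_vertices \<Gamma> = {v \<in> verts \<Gamma>. \<forall>w\<in>verts \<Gamma>. w \<noteq> v \<longrightarrow> {v, w} \<in> edges \<Gamma>}"

lemma join_decomposition:
  assumes "simplicial_graph \<Gamma>"
  shows "\<Gamma> = graph_join (full_subgraph \<Gamma> (cone_vertices \<Gamma>))
                         (full_subgraph \<Gamma> (verts \<Gamma> - cone_vertices \<Gamma>))"
    (is "\<Gamma> = graph_join ?\<Gamma>1 ?\<Gamma>2")
proof (rule sgraph.equality)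
  show "verts \<Gamma> = verts (graph_join ?\<Gamma>1 ?\<Gamma>2)"
    by (auto simp: graph_join_def full_subgraph_def cone_vertices_def)
  show "edges \<Gamma> = edges (graph_join ?\<Gamma>1 ?\<Gamma>2)"
  proof (intro subset_antisym subsetI)
    fix e assume e: "e \<in> edges \<Gamma>"
    with assms obtain u w where uw: "e = {u, w}" "u \<in> verts \<Gamma>" "w \<in> verts \<Gamma>"
      unfolding simplicial_graph_def by (metis card_2_iff insert_subset)
    consider "u \<in> cone_vertices \<Gamma>" "w \<in> cone_vertices \<Gamma>"
      | "u \<notin> cone_vertices \<Gamma>" "w \<notin> cone_vertices \<Gamma>"
      | "u \<in> cone_vertices \<Gamma>" "w \<notin> cone_vertices \<Gamma>"
      | "u \<notin> cone_vertices \<Gamma>" "w \<in> cone_vertices \<Gamma>" by blast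
    then show "e \<in> edges (graph_join ?\<Gamma>1 ?\<Gamma>2)"
      using e uw by cases (auto simp: graph_join_def full_subgraph_def)
  next
    fix e assume "e \<in> edges (graph_join ?\<Gamma>1 ?\<Gamma>2)"
    then show "e \<in> edges \<Gamma>"
      by (auto simp: graph_join_def full_subgraph_def cone_vertices_def) metis
  qed
qed simp

definition adj :: "'v sgraph \<Rightarrow> 'v rel" where
  "adj \<Gamma> = {(x, y). x \<in> verts \<Gamma> \<and> y \<in> verts \<Gamma> \<and> {x, y} \<in> edges \<Gamma>}"

definition graph_components :: "'v sgraph \<Rightarrow> 'v set set" where
  "graph_components \<Gamma> = verts \<Gamma> // ((adj \<Gamma>)\<^sup>* \<inter> verts \<Gamma> \<times> verts \<Gamma>)"

text \<open>Bounded with respect to the path metric of \<open>\<Gamma>\<close>.\<close>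

definition bounded_in :: "'v sgraph \<Rightarrow> 'v set \<Rightarrow> bool" where
  "bounded_in \<Gamma> X \<longleftrightarrow> (\<exists>n. \<forall>x\<in>X. \<forall>y\<in>X. \<exists>k\<le>n. (x, y) \<in> adj \<Gamma> ^^ k)"

text \<open>
  The complement of a subgraph. Topologically, the complement of \<open>C\<close> may also contain open or
  half-open edges with endpoints in \<open>C\<close>. A half-open edge belongs to the component of its
  remaining endpoint, and an open edge both of whose endpoints are removed is a bounded component.
  So omitting them does not affect the number of unbounded components.
\<close>

definition graph_minus :: "'v sgraph \<Rightarrow> 'v sgraph \<Rightarrow> 'v sgraph" where
  "graph_minus \<Gamma> C =
     \<lparr>verts = verts \<Gamma> - verts C, edges = {e \<in> edges \<Gamma>. e \<inter> verts C = {}}\<rparr>"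

text \<open>Loops (arising from the unit) and multiple edges are discarded.\<close>

definition cayley_graph :: "('a, 'b) monoid_scheme \<Rightarrow> 'a set \<Rightarrow> 'a sgraph" where
  "cayley_graph G S =
     \<lparr>verts = carrier G,
      edges = {{g, g \<otimes>\<^bsub>G\<^esub> s} | g s. g \<in> carrier G \<and> s \<in> S \<and> g \<otimes>\<^bsub>G\<^esub> s \<noteq> g}\<rparr>"

definition set_size :: "'a set \<Rightarrow> enat" where
  "set_size A = (if finite A then enat (card A) else \<infinity>)"

definition ends_wrt :: "('a, 'b) monoid_scheme \<Rightarrow> 'a set \<Rightarrow> enat" where
  "ends_wrt G S =
     (SUP C \<in> {C. subgraph C (cayley_graph G S) \<and> finite_graph C}.
        set_size {X \<in> graph_components (graph_minus (cayley_graph G S) C).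
                    \<not> bounded_in (cayley_graph G S) X})"

definition finite_generating_set :: "('a, 'b) monoid_scheme \<Rightarrow> 'a set \<Rightarrow> bool" where
  "finite_generating_set G S \<longleftrightarrow> finite S \<and> S \<subseteq> carrier G \<and> generate G S = carrier G"

definition finitely_generated :: "('a, 'b) monoid_scheme \<Rightarrow> bool" where
  "finitely_generated G \<longleftrightarrow> (\<exists>S. finite_generating_set G S)"

text \<open>
  Only meaningful for finitely generated groups. \<open>ends_wrt G S\<close> does not depend on the finite
  generating set \<open>S\<close>, so an arbitrary one is chosen.
\<close>

definition number_of_ends :: "('a, 'b) monoid_scheme \<Rightarrow> enat" where
  "number_of_ends G = ends_wrt G (SOME S. finite_generating_set G S)"

definition two_ended :: "('a, 'b) monoid_scheme \<Rightarrow> bool" where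
  "two_ended G \<longleftrightarrow> number_of_ends G = 2"

text \<open>
  The free product of the groups \<open>G i\<close> for \<open>i \<in> I\<close> consists of the words in letters
  \<open>(i, g)\<close> with \<open>g \<in> carrier (G i)\<close>, modulo the smallest congruence for concatenation that
  identifies \<open>(i, \<one>)\<close> with the empty word and \<open>(i, g) (i, h)\<close> with \<open>(i, g \<otimes> h)\<close>.
\<close>

definition fp_words :: "'i set \<Rightarrow> ('i \<Rightarrow> ('a, 'b) monoid_scheme) \<Rightarrow> ('i \<times> 'a) list set" where
  "fp_words I G = {xs. \<forall>(i, g) \<in> set xs. i \<in> I \<and> g \<in> carrier (G i)}"

inductive_set fp_rel :: "'i set \<Rightarrow> ('i \<Rightarrow> ('a, 'b) monoid_scheme) \<Rightarrow> ('i \<times> 'a) list rel"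
  for I G where
  fp_refl: "xs \<in> fp_words I G \<Longrightarrow> (xs, xs) \<in> fp_rel I G"
| fp_sym: "(xs, ys) \<in> fp_rel I G \<Longrightarrow> (ys, xs) \<in> fp_rel I G"
| fp_trans: "(xs, ys) \<in> fp_rel I G \<Longrightarrow> (ys, zs) \<in> fp_rel I G \<Longrightarrow> (xs, zs) \<in> fp_rel I G"
| fp_append: "(xs, xs') \<in> fp_rel I G \<Longrightarrow> (ys, ys') \<in> fp_rel I G \<Longrightarrow>
    (xs @ ys, xs' @ ys') \<in> fp_rel I G"
| fp_one: "i \<in> I \<Longrightarrow> ([(i, \<one>\<^bsub>G i\<^esub>)], []) \<in> fp_rel I G"
| fp_mult: "i \<in> I \<Longrightarrow> g \<in> carrier (G i) \<Longrightarrow> h \<in> carrier (G i) \<Longrightarrow>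
    ([(i, g), (i, h)], [(i, g \<otimes>\<^bsub>G i\<^esub> h)]) \<in> fp_rel I G"

definition free_product ::
    "'i set \<Rightarrow> ('i \<Rightarrow> ('a, 'b) monoid_scheme) \<Rightarrow> ('i \<times> 'a) list set monoid" where
  "free_product I G =
     \<lparr>carrier = fp_words I G // fp_rel I G,
      monoid.mult = (\<lambda>A B. \<Union>xs\<in>A. \<Union>ys\<in>B. fp_rel I G `` {xs @ ys}),
      one = fp_rel I G `` {[]}\<rparr>"

definition fp_incl ::
    "'i set \<Rightarrow> ('i \<Rightarrow> ('a, 'b) monoid_scheme) \<Rightarrow> 'i \<Rightarrow> 'a \<Rightarrow> ('i \<times> 'a) list set" where
  "fp_incl I G i g = fp_rel I G `` {[(i, g)]}"

definition commutator :: "('a, 'b) monoid_scheme \<Rightarrow> 'a \<Rightarrow> 'a \<Rightarrow> 'a" where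
  "commutator G x y = x \<otimes>\<^bsub>G\<^esub> y \<otimes>\<^bsub>G\<^esub> inv\<^bsub>G\<^esub> x \<otimes>\<^bsub>G\<^esub> inv\<^bsub>G\<^esub> y"

definition normal_closure :: "('a, 'b) monoid_scheme \<Rightarrow> 'a set \<Rightarrow> 'a set" where
  "normal_closure G A = \<Inter> {N. N \<lhd> G \<and> A \<subseteq> N}"

definition graph_product_relators ::
    "'v sgraph \<Rightarrow> ('v \<Rightarrow> ('a, 'b) monoid_scheme) \<Rightarrow> ('v \<times> 'a) list set set" where
  "graph_product_relators \<Gamma> G =
     {commutator (free_product (verts \<Gamma>) G) (fp_incl (verts \<Gamma>) G u g) (fp_incl (verts \<Gamma>) G w h)
       | u w g h. {u, w} \<in> edges \<Gamma> \<and> g \<in> carrier (G u) \<and> h \<in> carrier (G w)}"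

definition graph_product ::
    "'v sgraph \<Rightarrow> ('v \<Rightarrow> ('a, 'b) monoid_scheme) \<Rightarrow> ('v \<times> 'a) list set set monoid" where
  "graph_product \<Gamma> G =
     free_product (verts \<Gamma>) G Mod
     normal_closure (free_product (verts \<Gamma>) G) (graph_product_relators \<Gamma> G)"

context
  fixes I :: "'i set" and G :: "'i \<Rightarrow> ('a, 'b) monoid_scheme"
  assumes grp: "\<And>i. i \<in> I \<Longrightarrow> group (G i)"
begin

lemma fp_rel_words: "(xs, ys) \<in> fp_rel I G \<Longrightarrow> xs \<in> fp_words I G \<and> ys \<in> fp_words I G"
proof (induction rule: fp_rel.induct)
  case (fp_one i)
  then show ?case using grp by (auto simp: fp_words_def intro: monoid.one_closed group.is_monoid)
next
  case (fp_mult i g h)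
  then show ?case using grp by (auto simp: fp_words_def intro: monoid.m_closed group.is_monoid)
qed (auto simp: fp_words_def)

lemma equiv_fp_rel: "equiv (fp_words I G) (fp_rel I G)"
proof (rule equivI)
  show "fp_rel I G \<subseteq> fp_words I G \<times> fp_words I G" using fp_rel_words by auto
  show "refl_on (fp_words I G) (fp_rel I G)" by (rule refl_onI) (rule fp_refl)
  show "sym (fp_rel I G)" by (rule symI) (rule fp_sym)
  show "trans (fp_rel I G)" by (rule transI) (rule fp_trans)
qed

lemma free_product_mult:
  assumes "xs \<in> fp_words I G" "ys \<in> fp_words I G"
  shows "fp_rel I G `` {xs} \<otimes>\<^bsub>free_product I G\<^esub> fp_rel I G `` {ys} = fp_rel I G `` {xs @ ys}"
proof -
  have "fp_rel I G `` {xs' @ ys'} = fp_rel I G `` {xs @ ys}"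
    if "xs' \<in> fp_rel I G `` {xs}" "ys' \<in> fp_rel I G `` {ys}" for xs' ys'
    using that by (intro equiv_class_eq[OF equiv_fp_rel] fp_append) (blast intro: fp_sym)+
  moreover have "xs \<in> fp_rel I G `` {xs}" "ys \<in> fp_rel I G `` {ys}"
    using assms by (blast intro: fp_refl)+
  ultimately show ?thesis
    unfolding free_product_def monoid.simps by blast
qed

lemma fp_rel_left_inverse:
  "xs \<in> fp_words I G \<Longrightarrow> \<exists>ys\<in>fp_words I G. (ys @ xs, []) \<in> fp_rel I G"
proof (induction xs)
  case Nil
  then show ?case by (auto intro!: bexI[of _ "[]"] fp_refl)
next
  case (Cons x xs)
  obtain i g where x: "x = (i, g)" by fastforce
  with Cons.prems have ig: "i \<in> I" "g \<in> carrier (G i)" and xs: "xs \<in> fp_words I G"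
    by (auto simp: fp_words_def)
  obtain ys where ys: "ys \<in> fp_words I G" "(ys @ xs, []) \<in> fp_rel I G"
    using Cons.IH[OF xs] by blast
  interpret group "G i" using grp ig by simp
  let ?z = "(i, inv\<^bsub>G i\<^esub> g)"
  have "([?z, (i, g)], [(i, \<one>\<^bsub>G i\<^esub>)]) \<in> fp_rel I G"
    using fp_mult[where i = i and g = "inv\<^bsub>G i\<^esub> g" and h = g and I = I and G = G] ig by simp
  then have zx: "([?z, (i, g)], []) \<in> fp_rel I G"
    using fp_one[where i = i and I = I and G = G] ig by (metis fp_trans)
  have "(ys @ [?z, (i, g)] @ xs, ys @ [] @ xs) \<in> fp_rel I G"
    using ys xs zx by (intro fp_append fp_refl) auto
  then have "((ys @ [?z]) @ x # xs, []) \<in> fp_rel I G"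
    using ys(2) x by (auto intro: fp_trans)
  moreover have "ys @ [?z] \<in> fp_words I G"
    using ys(1) ig by (auto simp: fp_words_def)
  ultimately show ?case by blast
qed

lemma group_free_product: "group (free_product I G)"
proof (rule groupI)
  let ?F = "free_product I G" and ?R = "fp_rel I G" and ?W = "fp_words I G"
  have carr: "carrier ?F = ?W // ?R" and one: "\<one>\<^bsub>?F\<^esub> = ?R `` {[]}"
    by (auto simp: free_product_def)
  have app: "xs @ ys \<in> ?W" if "xs \<in> ?W" "ys \<in> ?W" for xs ys
    using that by (auto simp: fp_words_def)
  have nil: "[] \<in> ?W" by (simp add: fp_words_def)
  show "\<one>\<^bsub>?F\<^esub> \<in> carrier ?F" unfolding carr one by (rule quotientI) (rule nil)
  fix x assume "x \<in> carrier ?F"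
  then obtain xs where xs: "xs \<in> ?W" "x = ?R `` {xs}" by (auto simp: carr quotient_def)
  show "\<one>\<^bsub>?F\<^esub> \<otimes>\<^bsub>?F\<^esub> x = x" 
    unfolding xs(2) one free_product_mult[OF nil xs(1)] by simp
  show "\<exists>y\<in>carrier ?F. y \<otimes>\<^bsub>?F\<^esub> x = \<one>\<^bsub>?F\<^esub>"
  proof -
    obtain ys where ys: "ys \<in> ?W" "(ys @ xs, []) \<in> ?R" using fp_rel_left_inverse xs by blast
    have "?R `` {ys} \<otimes>\<^bsub>?F\<^esub> x = \<one>\<^bsub>?F\<^esub>"
      unfolding xs(2) one free_product_mult[OF ys(1) xs(1)]
      by (intro equiv_class_eq[OF equiv_fp_rel] ys(2))
    moreover have "?R `` {ys} \<in> carrier ?F" unfolding carr by (rule quotientI) (rule ys)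
    ultimately show ?thesis by blast
  qed
  fix y assume "y \<in> carrier ?F"
  then obtain ys where ys: "ys \<in> ?W" "y = ?R `` {ys}" by (auto simp: carr quotient_def)
  show "x \<otimes>\<^bsub>?F\<^esub> y \<in> carrier ?F"
    unfolding carr xs(2) ys(2) free_product_mult[OF xs(1) ys(1)]
    by (intro quotientI app xs(1) ys(1))
  fix z assume "z \<in> carrier ?F"
  then obtain zs where zs: "zs \<in> ?W" "z = ?R `` {zs}" by (auto simp: carr quotient_def)
  show "x \<otimes>\<^bsub>?F\<^esub> y \<otimes>\<^bsub>?F\<^esub> z = x \<otimes>\<^bsub>?F\<^esub> (y \<otimes>\<^bsub>?F\<^esub> z)"
    unfolding xs(2) ys(2) zs(2) by (simp only: free_product_mult app xs(1) ys(1) zs(1) append_assoc)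
qed

lemma fp_incl_closed: "i \<in> I \<Longrightarrow> g \<in> carrier (G i) \<Longrightarrow> fp_incl I G i g \<in> carrier (free_product I G)"
  unfolding fp_incl_def free_product_def by (simp add: quotientI fp_words_def)

end

lemma normal_normal_closure:
  assumes "group G" "A \<subseteq> carrier G"
  shows "normal_closure G A \<lhd> G"
proof -
  interpret group G by fact
  have "carrier G \<lhd> G"
    unfolding normal_inv_iff using subgroup_self by simp
  then have "subgroup (\<Inter> {N. N \<lhd> G \<and> A \<subseteq> N}) G"
    using assms(2) by (intro subgroups_Inter) (auto dest: normal_imp_subgroup)
  then show ?thesis
    unfolding normal_closure_def normal_inv_iff by blast
qed

lemma group_graph_product:
  assumes "simplicial_graph \<Gamma>" "\<And>v. v \<in> verts \<Gamma> \<Longrightarrow> group (G v)"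
  shows "group (graph_product \<Gamma> G)"
proof -
  interpret F: group "free_product (verts \<Gamma>) G" by (rule group_free_product) (rule assms(2))
  have "commutator (free_product (verts \<Gamma>) G)
          (fp_incl (verts \<Gamma>) G u g) (fp_incl (verts \<Gamma>) G w h) \<in> carrier (free_product (verts \<Gamma>) G)"
    if e: "{u, w} \<in> edges \<Gamma>" and g: "g \<in> carrier (G u)" and h: "h \<in> carrier (G w)" for u w g h
  proof -
    have "u \<in> verts \<Gamma>" "w \<in> verts \<Gamma>"
      using assms(1) e unfolding simplicial_graph_def by blast+
    then have "fp_incl (verts \<Gamma>) G u g \<in> carrier (free_product (verts \<Gamma>) G)"
      "fp_incl (verts \<Gamma>) G w h \<in> carrier (free_product (verts \<Gamma>) G)"
      using g h fp_incl_closed[of "verts \<Gamma>" G] assms(2) by auto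
    then show ?thesis by (simp add: commutator_def)
  qed
  then have "graph_product_relators \<Gamma> G \<subseteq> carrier (free_product (verts \<Gamma>) G)"
    unfolding graph_product_relators_def by blast
  then show ?thesis
    unfolding graph_product_def
    by (rule normal.factorgroup_is_group[OF normal_normal_closure[OF F.group_axioms]])
qed

end

theory Submission
  imports Defs
begin

text \<open>
  For a finitely generated group, having at least \<open>n\<close> ends means that there are \<open>n\<close> disjoint infinite
  subsets that every right translation changes only by finitely many elements. This is independent
  of the generators and passes along homomorphisms with finite kernel.

  If a group is two-ended and \<open>N\<close> is an infinite subgroup, then some \<open>t \<in> N\<close> moves an almost invariant
  set \<open>A\<close> properly into itself, and the translates of the finite set \<open>A - tA\<close> under powers of \<open>t\<close> cover
  the group. So infinite subgroups have finite index. For complete \<open>\<Gamma>\<close> this forces all vertex groups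
  but one to be finite. For non-adjacent \<open>a\<close> and \<open>b\<close>, let the graph product act on the alternating words
  in \<open>G a\<close> and \<open>G b\<close>, the other vertex groups acting trivially. If \<open>G a\<close> had distinct non-trivial elements
  \<open>x\<close> and \<open>x'\<close>, then \<open>xy\<close> and \<open>x'y\<close> would have no common powers. A vertex \<open>c\<close> with infinite vertex group,
  or not adjacent to all other vertices, would give an infinite subgroup in the kernel of the action,
  which misses all non-trivial powers of \<open>xy\<close>. Conversely, in case (ii) the graph product acts on the
  integers as the infinite dihedral group with finite kernel.
\<close>

section \<open>Almost invariant sets\<close>

text \<open>Translations act on the right because edges of the Cayley graph join \<open>x\<close>
  and \<open>x \<otimes> s\<close>; left multiplications are then graph automorphisms and preserve
  almost invariance. The structure theory of groups with several ends is bypassed: with fewer than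
  three ends, an almost invariant set \<open>A\<close> that is infinite with infinite complement is,
  up to complement and finite sets, the only one of its kind, so each left translate agrees with
  \<open>A\<close> or with its complement up to a finite set. The obstacle is to turn agreement up
  to a finite set into honest inclusion. This needs a group element that moves the coboundary of
  \<open>A\<close> away from itself, and an infinite subgroup always contains one. Normal forms in
  graph products are bypassed as well: elements are shown to be non-trivial only through
  homomorphisms out of the graph product, namely projections to vertex groups and actions on
  alternating words or on the integers.\<close>

definition almost_invariant :: "('a, 'b) monoid_scheme \<Rightarrow> 'a set \<Rightarrow> bool" where
  "almost_invariant G A \<longleftrightarrow>
     A \<subseteq> carrier G \<and> (\<forall>g\<in>carrier G. finite {x \<in> A. x \<otimes>\<^bsub>G\<^esub> g \<notin> A})"

text \<open>Exactly disjoint sets are asked for, rather than sets independent modulo finite ones, so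
  that upper bounds reduce to pigeonhole arguments. Lower bounds by natural numbers avoid the
  supremum in \<open>ends_wrt\<close>.\<close>

definition ends_at_least :: "('a, 'b) monoid_scheme \<Rightarrow> nat \<Rightarrow> bool" where
  "ends_at_least G n \<longleftrightarrow>
     (\<exists>\<A>. finite \<A> \<and> card \<A> = n \<and> pairwise disjnt \<A> \<and>
        (\<forall>A\<in>\<A>. infinite A \<and> almost_invariant G A))"

context group
begin

lemma almost_invariant_subset: "almost_invariant G A \<Longrightarrow> A \<subseteq> carrier G"
  by (simp add: almost_invariant_def)

lemma almost_invariantD:
  "almost_invariant G A \<Longrightarrow> g \<in> carrier G \<Longrightarrow> finite {x \<in> A. x \<otimes> g \<notin> A}"
  by (simp add: almost_invariant_def)

lemma finite_right_translate_vimage: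
  assumes "finite B" "g \<in> carrier G" "\<And>x. x \<in> A \<Longrightarrow> x \<in> carrier G \<and> x \<otimes> g \<in> B"
  shows "finite A"
proof (rule finite_subset[OF _ finite_imageI[OF assms(1), of "\<lambda>y. y \<otimes> inv g"]])
  show "A \<subseteq> (\<lambda>y. y \<otimes> inv g) ` B"
  proof
    fix x assume "x \<in> A"
    then have "x = (x \<otimes> g) \<otimes> inv g" "x \<otimes> g \<in> B"
      using assms by (auto simp: m_assoc)
    then show "x \<in> (\<lambda>y. y \<otimes> inv g) ` B" by blast
  qed
qed

text \<open>Entering \<open>A\<close> along \<open>g\<close> is leaving \<open>A\<close> along
  \<open>inv g\<close>. This is why the definition, which ranges over all group elements, asks only
  about leaving.\<close>

lemma almost_invariant_enter:
  assumes "almost_invariant G A" "g \<in> carrier G"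
  shows "finite {x \<in> carrier G - A. x \<otimes> g \<in> A}"
proof (rule finite_right_translate_vimage[of "{x \<in> A. x \<otimes> inv g \<notin> A}" g])
  show "finite {x \<in> A. x \<otimes> inv g \<notin> A}" using assms almost_invariantD by simp
qed (use assms in \<open>auto simp: m_assoc\<close>)

lemma almost_invariant_Compl:
  assumes "almost_invariant G A"
  shows "almost_invariant G (carrier G - A)"
  unfolding almost_invariant_def
proof (intro conjI ballI)
  fix g assume "g \<in> carrier G"
  then have "{x \<in> carrier G - A. x \<otimes> g \<notin> carrier G - A} = {x \<in> carrier G - A. x \<otimes> g \<in> A}"
    by auto
  then show "finite {x \<in> carrier G - A. x \<otimes> g \<notin> carrier G - A}"
    using almost_invariant_enter[OF assms \<open>g \<in> carrier G\<close>] by simp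
qed auto

lemma almost_invariant_Int:
  assumes "almost_invariant G A" "almost_invariant G B"
  shows "almost_invariant G (A \<inter> B)"
  unfolding almost_invariant_def
proof (intro conjI ballI)
  fix g assume "g \<in> carrier G"
  then show "finite {x \<in> A \<inter> B. x \<otimes> g \<notin> A \<inter> B}"
    by (intro finite_subset[OF _ finite_UnI[OF almost_invariantD[OF assms(1), of g]
          almost_invariantD[OF assms(2), of g]]]) auto
qed (use assms almost_invariant_subset in auto)

text \<open>A preimage rather than an image, so that it commutes with differences and complements by
  mere unfolding.\<close>

definition left_translate :: "'a \<Rightarrow> 'a set \<Rightarrow> 'a set" where
  "left_translate g A = {x \<in> carrier G. inv g \<otimes> x \<in> A}"

lemma left_translate_eq:
  assumes "g \<in> carrier G" "A \<subseteq> carrier G"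
  shows "left_translate g A = (\<otimes>) g ` A"
proof (intro subset_antisym subsetI)
  fix x assume "x \<in> left_translate g A"
  then have "x = g \<otimes> (inv g \<otimes> x)" "inv g \<otimes> x \<in> A"
    using assms by (auto simp: left_translate_def m_assoc[symmetric])
  then show "x \<in> (\<otimes>) g ` A" by blast
next
  fix x assume "x \<in> (\<otimes>) g ` A"
  then show "x \<in> left_translate g A"
    using assms by (auto simp: left_translate_def m_assoc[symmetric] subset_iff)
qed

lemma finite_left_translate_iff:
  assumes "g \<in> carrier G" "A \<subseteq> carrier G"
  shows "finite (left_translate g A) \<longleftrightarrow> finite A"
  unfolding left_translate_eq[OF assms]
proof (rule finite_image_iff, rule inj_onI)
  fix x y assume "x \<in> A" "y \<in> A" "g \<otimes> x = g \<otimes> y"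
  then show "x = y" using assms(1) subsetD[OF assms(2)] by simp
qed

lemma left_translate_mult:
  assumes "g \<in> carrier G" "h \<in> carrier G"
  shows "left_translate g (left_translate h A) = left_translate (g \<otimes> h) A"
  using assms by (auto simp: left_translate_def inv_mult_group m_assoc)

lemma left_translate_Diff:
  "g \<in> carrier G \<Longrightarrow>
    left_translate g (A - B) = left_translate g A - left_translate g B"
  by (auto simp: left_translate_def)

lemma left_translate_Compl:
  "g \<in> carrier G \<Longrightarrow>
    left_translate g (carrier G - A) = carrier G - left_translate g A"
  by (auto simp: left_translate_def)

text \<open>Left and right multiplications commute, so the defect set of the translate is the
  translate of the defect set.\<close>

lemma almost_invariant_left_translate:
  assumes "almost_invariant G A" "g \<in> carrier G"
  shows "almost_invariant G (left_translate g A)"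
  unfolding almost_invariant_def
proof (intro conjI ballI)
  fix h assume h: "h \<in> carrier G"
  have "{x \<in> left_translate g A. x \<otimes> h \<notin> left_translate g A}
      = left_translate g {x \<in> A. x \<otimes> h \<notin> A}"
    using h assms(2) by (auto simp: left_translate_def m_assoc)
  then show "finite {x \<in> left_translate g A. x \<otimes> h \<notin> left_translate g A}"
    using finite_left_translate_iff[OF assms(2), of "{x \<in> A. x \<otimes> h \<notin> A}"]
      almost_invariantD[OF assms(1) h] almost_invariant_subset[OF assms(1)] by auto
qed (auto simp: left_translate_def)

text \<open>Leaving and entering both have to be assumed here, since \<open>S\<close> need not be
  closed under inverses; the \<open>inv\<close> case turns one into the other.\<close>

lemma almost_invariant_generate:
  assumes "A \<subseteq> carrier G" and "S \<subseteq> carrier G" and "generate G S = carrier G"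
    and leave: "\<And>s. s \<in> S \<Longrightarrow> finite {x \<in> A. x \<otimes> s \<notin> A}"
    and enter: "\<And>s. s \<in> S \<Longrightarrow> finite {x \<in> carrier G - A. x \<otimes> s \<in> A}"
  shows "almost_invariant G A"
proof -
  have "finite {x \<in> A. x \<otimes> g \<notin> A}" if "g \<in> generate G S" for g
    using that
  proof induction
    case one
    have "{x \<in> A. x \<otimes> \<one> \<notin> A} = {}" using assms(1) by auto
    then show ?case by (simp only: finite.emptyI)
  next
    case (incl h)
    then show ?case by (rule leave)
  next
    case (inv h)
    with assms(2) have h: "h \<in> carrier G" by auto
    show ?case
      by (rule finite_right_translate_vimage[OF enter[OF inv], of "inv h"])
        (use h assms(1) in \<open>auto simp: m_assoc\<close>)
  next
    case (eng h1 h2)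
    then have h: "h1 \<in> carrier G" "h2 \<in> carrier G" using assms(3) by auto
    \<comment> \<open>A path via \<open>x \<otimes> h1\<close> that ends outside \<open>A\<close>
      leaves \<open>A\<close> on its first or on its second leg. The second kind is pulled back
      along \<open>h1\<close>.\<close>
    have "finite {x \<in> A. x \<otimes> h1 \<in> A \<and> x \<otimes> h1 \<otimes> h2 \<notin> A}"
      by (rule finite_right_translate_vimage[OF eng.IH(2) h(1)]) (use assms(1) in auto)
    then have "finite ({x \<in> A. x \<otimes> h1 \<notin> A} \<union> {x \<in> A. x \<otimes> h1 \<in> A \<and> x \<otimes> h1 \<otimes> h2 \<notin> A})"
      using eng.IH(1) by simp
    moreover have "x \<otimes> (h1 \<otimes> h2) = x \<otimes> h1 \<otimes> h2" if "x \<in> A" for x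
      using h subsetD[OF assms(1) that] by (simp add: m_assoc)
    moreover have "{x \<in> A. x \<otimes> (h1 \<otimes> h2) \<notin> A}
        \<subseteq> {x \<in> A. x \<otimes> h1 \<notin> A} \<union> {x \<in> A. x \<otimes> h1 \<in> A \<and> x \<otimes> h1 \<otimes> h2 \<notin> A}"
      using calculation by auto
    ultimately show ?case by (meson finite_subset)
  qed
  then show ?thesis using assms(1,3) by (simp add: almost_invariant_def)
qed

text \<open>Connectedness of the Cayley graph in algebraic form: a set with empty coboundary is
  trivial.\<close>

lemma invariant_set_trivial:
  assumes "A \<subseteq> carrier G" and "S \<subseteq> carrier G" and "generate G S = carrier G"
    and step: "\<And>x s. x \<in> carrier G \<Longrightarrow> s \<in> S \<Longrightarrow> x \<otimes> s \<in> A \<longleftrightarrow> x \<in> A"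
  shows "A = {} \<or> A = carrier G"
proof -
  have *: "x \<otimes> g \<in> A \<longleftrightarrow> x \<in> A" if "g \<in> generate G S" "x \<in> carrier G" for g x
    using that
  proof (induction arbitrary: x)
    case (inv h)
    then show ?case using step[of "x \<otimes> inv h" h] assms(2) by (auto simp: m_assoc)
  next
    case (eng h1 h2)
    then show ?case using assms(3) by (auto simp: m_assoc[symmetric])
  qed (auto simp: step)
  have "A = carrier G" if "a \<in> A" for a
  proof
    show "carrier G \<subseteq> A"
    proof
      fix x assume x: "x \<in> carrier G"
      have a: "a \<in> carrier G" using that assms(1) by auto
      have "a \<otimes> (inv a \<otimes> x) \<in> A" using *[of "inv a \<otimes> x" a] x a that assms(3) by auto
      then show "x \<in> A" using x a by (simp add: m_assoc[symmetric])
    qed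
  qed (rule assms(1))
  then show ?thesis by blast
qed

end

section \<open>Ends of Cayley graphs and almost invariant sets\<close>

locale finitely_generated_group = group +
  fixes S
  assumes fin_gen: "finite_generating_set G S"
begin

abbreviation Cay :: "'a sgraph" where "Cay \<equiv> cayley_graph G S"

lemma gens: "finite S" "S \<subseteq> carrier G" "generate G S = carrier G"
  using fin_gen by (auto simp: finite_generating_set_def)

lemma adj_Cay:
  "(x, y) \<in> adj Cay \<longleftrightarrow> x \<in> carrier G \<and> y \<in> carrier G \<and> x \<noteq> y \<and> (\<exists>s\<in>S. y = x \<otimes> s \<or> x = y \<otimes> s)"
  unfolding adj_def cayley_graph_def using gens(2) by (auto simp: doubleton_eq_iff) (metis+)

lemma sym_adj_star: "sym ((adj H)\<^sup>*)"
  by (rule sym_rtrancl) (auto simp: sym_def adj_def insert_commute)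

lemma connected_Cay:
  assumes "x \<in> carrier G" "y \<in> carrier G"
  shows "(x, y) \<in> (adj Cay)\<^sup>*"
proof -
  define A where "A = {z \<in> carrier G. (x, z) \<in> (adj Cay)\<^sup>*}"
  have "A = {} \<or> A = carrier G"
  proof (rule invariant_set_trivial[OF _ gens(2,3)])
    fix z s assume zs: "z \<in> carrier G" "s \<in> S"
    then have s: "s \<in> carrier G" using gens by auto
    have "(z, z \<otimes> s) \<in> (adj Cay)\<^sup>*"
      using zs s by (cases "z \<otimes> s = z") (auto simp: adj_Cay intro!: r_into_rtrancl)
    then show "z \<otimes> s \<in> A \<longleftrightarrow> z \<in> A"
      using zs s symD[OF sym_adj_star, of z "z \<otimes> s"] unfolding A_def by (auto intro: rtrancl_trans)
  qed (auto simp: A_def)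
  moreover have "x \<in> A" using assms by (simp add: A_def)
  ultimately show ?thesis using assms by (auto simp: A_def)
qed

text \<open>The Cayley graph is locally finite and connected. Hence its balls are finite, and finite
  sets have finite diameter.\<close>

lemma bounded_in_Cay_iff:
  assumes "X \<subseteq> carrier G"
  shows "bounded_in Cay X \<longleftrightarrow> finite X"
proof
  assume "bounded_in Cay X"
  then obtain n where n: "\<And>x y. x \<in> X \<Longrightarrow> y \<in> X \<Longrightarrow> \<exists>k\<le>n. (x, y) \<in> adj Cay ^^ k"
    unfolding bounded_in_def by blast
  have nbrs: "finite {z. (y, z) \<in> adj Cay}" for y
  proof (cases "y \<in> carrier G")
    case True
    have "{z. (y, z) \<in> adj Cay} \<subseteq> (\<lambda>s. y \<otimes> s) ` S \<union> (\<lambda>s. y \<otimes> inv s) ` S"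
    proof
      fix z assume "z \<in> {z. (y, z) \<in> adj Cay}"
      then obtain s where s: "s \<in> S" "z \<in> carrier G" "z = y \<otimes> s \<or> y = z \<otimes> s"
        by (auto simp: adj_Cay)
      then have "z = y \<otimes> s \<or> z = y \<otimes> inv s" using gens(2) by (auto simp: m_assoc)
      with s(1) show "z \<in> (\<lambda>s. y \<otimes> s) ` S \<union> (\<lambda>s. y \<otimes> inv s) ` S" by auto
    qed
    then show ?thesis using gens(1) finite_subset by blast
  qed (auto simp: adj_Cay)
  have fin: "finite {y. (x, y) \<in> adj Cay ^^ k}" for x k
  proof (induction k)
    case (Suc k)
    have "{y. (x, y) \<in> adj Cay ^^ Suc k} = (\<Union>z\<in>{y. (x, y) \<in> adj Cay ^^ k}. {y. (z, y) \<in> adj Cay})"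
      by auto
    then show ?case using Suc nbrs by simp
  qed simp
  show "finite X"
  proof (cases "X = {}")
    case False
    then obtain x where "x \<in> X" by blast
    then have "X \<subseteq> (\<Union>k\<in>{..n}. {y. (x, y) \<in> adj Cay ^^ k})" using n by blast
    then show ?thesis using fin by (meson finite_UN finite_atMost finite_subset)
  qed simp
next
  assume fin: "finite X"
  have "\<exists>k. (x, y) \<in> adj Cay ^^ k" if "x \<in> X" "y \<in> X" for x y
    using connected_Cay assms that by (auto simp: subset_iff dest: rtrancl_imp_relpow)
  then obtain d where d: "\<And>x y. x \<in> X \<Longrightarrow> y \<in> X \<Longrightarrow> (x, y) \<in> adj Cay ^^ d x y" by metis
  define n where "n = Max ((\<lambda>(x, y). d x y) ` (X \<times> X))"
  have "d x y \<le> n" if "x \<in> X" "y \<in> X" for x y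
    unfolding n_def using fin that by (intro Max_ge) auto
  then show "bounded_in Cay X" unfolding bounded_in_def using d by blast
qed

lemma equiv_adj_star:
  "equiv (verts H) ((adj H)\<^sup>* \<inter> verts H \<times> verts H)"
  by (rule equivI)
    (auto simp: refl_on_def sym_def trans_def dest: symD[OF sym_adj_star])

lemma verts_graph_minus: "verts (graph_minus Cay C) = carrier G - verts C"
  by (simp add: graph_minus_def cayley_graph_def)

lemma adj_graph_minus:
  "(x, y) \<in> adj (graph_minus Cay C) \<longleftrightarrow> (x, y) \<in> adj Cay \<and> x \<notin> verts C \<and> y \<notin> verts C"
  by (auto simp: adj_def graph_minus_def cayley_graph_def)

lemma component_subset:
  assumes "X \<in> graph_components (graph_minus Cay C)"
  shows "X \<subseteq> carrier G - verts C"
  using in_quotient_imp_subset[OF equiv_adj_star, of X "graph_minus Cay C"] assms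
  by (simp add: graph_components_def verts_graph_minus)

lemma component_step:
  assumes X: "X \<in> graph_components (graph_minus Cay C)" and x: "x \<in> X"
    and xy: "(x, y) \<in> adj Cay" "y \<notin> verts C"
  shows "y \<in> X"
proof -
  let ?H = "graph_minus Cay C"
  have x': "x \<in> carrier G - verts C" using component_subset[OF X] x by auto
  then have "(x, y) \<in> (adj ?H)\<^sup>* \<inter> verts ?H \<times> verts ?H"
    using xy by (intro IntI r_into_rtrancl) (auto simp: adj_graph_minus verts_graph_minus adj_Cay)
  then show ?thesis
    using X x in_quotient_imp_closed[OF equiv_adj_star] unfolding graph_components_def by metis
qed

lemma component_right_mult:
  assumes X: "X \<in> graph_components (graph_minus Cay C)" and "x \<in> carrier G" "s \<in> S"
    and "x \<notin> verts C" "x \<otimes> s \<notin> verts C"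
  shows "x \<otimes> s \<in> X \<longleftrightarrow> x \<in> X"
proof (cases "x \<otimes> s = x")
  case False
  have "x \<otimes> s \<in> carrier G" using assms(2,3) gens(2) by auto
  then have "(x, x \<otimes> s) \<in> adj Cay" "(x \<otimes> s, x) \<in> adj Cay" using assms False by (auto simp: adj_Cay)
  then show ?thesis using component_step[OF X] assms by blast
qed simp

text \<open>An edge between \<open>X\<close> and its complement must have an end in
  \<open>C\<close>, so there are only finitely many for each generator.\<close>

lemma almost_invariant_component:
  assumes fin: "finite (verts C)" and X: "X \<in> graph_components (graph_minus Cay C)"
  shows "almost_invariant G X"
proof (rule almost_invariant_generate[OF _ gens(2,3)])
  have sub: "X \<subseteq> carrier G - verts C" by (rule component_subset[OF X])
  show "X \<subseteq> carrier G" using sub by auto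
  fix s assume s: "s \<in> S"
  show "finite {x \<in> X. x \<otimes> s \<notin> X}"
    by (rule finite_right_translate_vimage[OF fin, of s])
      (use s gens(2) sub component_right_mult[OF X _ s] in auto)
  show "finite {x \<in> carrier G - X. x \<otimes> s \<in> X}"
    by (rule finite_subset[OF _ fin]) (use s gens(2) sub component_right_mult[OF X _ s] in auto)
qed

lemma disjoint_components:
  "pairwise disjnt (graph_components H)"
  using quotient_disj[OF equiv_adj_star[of H]]
  by (auto simp: pairwise_def disjnt_def graph_components_def)

text \<open>Unless it is the whole group, a component has a crossing edge, whose other end can only
  lie in \<open>C\<close>. So it contains one of the finitely many neighbours \<open>B\<close> of
  \<open>C\<close>, and any of its points determines it.\<close>

lemma finite_components:
  assumes fin: "finite (verts C)"
  shows "finite (graph_components (graph_minus Cay C))"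
proof -
  let ?H = "graph_minus Cay C"
  define B where "B = (\<Union>s\<in>S. (\<lambda>c. c \<otimes> s) ` verts C \<union> (\<lambda>c. c \<otimes> inv s) ` verts C)"
  define R where "R = (adj ?H)\<^sup>* \<inter> verts ?H \<times> verts ?H"
  have R: "equiv (verts ?H) R" unfolding R_def by (rule equiv_adj_star)
  have comps: "graph_components ?H = verts ?H // R" unfolding R_def graph_components_def ..
  have "X \<in> insert (carrier G) ((\<lambda>x. R `` {x}) ` B)" if X: "X \<in> graph_components ?H" for X
  proof (cases "X = carrier G")
    case False
    have sub: "X \<subseteq> carrier G - verts C" by (rule component_subset[OF X])
    have "X \<noteq> {}" using X in_quotient_imp_non_empty[OF R] by (simp add: comps)
    then obtain x s where xs: "x \<in> carrier G" "s \<in> S" "(x \<otimes> s \<in> X) \<noteq> (x \<in> X)"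
      using invariant_set_trivial[OF _ gens(2,3), of X] False sub by blast
    then have s: "s \<in> carrier G" using gens(2) by auto
    have "X \<inter> B \<noteq> {}"
    proof (cases "x \<in> X")
      case True
      then have "x \<otimes> s \<in> verts C" using component_right_mult[OF X] xs sub by blast
      moreover have "x = (x \<otimes> s) \<otimes> inv s" using xs s by (simp add: m_assoc)
      ultimately show ?thesis using True xs(2) unfolding B_def by blast
    next
      case False
      then have "x \<in> verts C" "x \<otimes> s \<in> X" using component_right_mult[OF X] xs sub by blast+
      then show ?thesis using xs(2) unfolding B_def by blast
    qed
    then obtain b where b: "b \<in> X" "b \<in> B" by blast
    obtain a where "X = R `` {a}" using X unfolding comps quotient_def by blast
    then have "X = R `` {b}" using b(1) equiv_class_eq[OF R, of a b] by blast
    then have "X \<in> (\<lambda>x. R `` {x}) ` B" using b(2) by (rule image_eqI)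
    then show ?thesis by (rule insertI2)
  qed simp
  then have "graph_components ?H \<subseteq> insert (carrier G) ((\<lambda>x. R `` {x}) ` B)" by (rule subsetI)
  moreover have "finite B" using fin gens(1) unfolding B_def by blast
  ultimately show ?thesis by (rule_tac finite_subset) auto
qed

text \<open>Once the boundary points of the \<open>n\<close> sets are removed, no edge leaves any of
  them. What remains of each set is then covered by components inside it; there are finitely many,
  so one is infinite. Conversely, unbounded components are almost invariant themselves.\<close>

lemma ends_at_least_iff_components:
  "ends_at_least G n \<longleftrightarrow>
    (\<exists>C. subgraph C Cay \<and> finite_graph C \<and>
       enat n \<le> set_size {X \<in> graph_components (graph_minus Cay C). \<not> bounded_in Cay X})"
proof
  assume "ends_at_least G n"
  then obtain \<A> where \<A>: "finite \<A>" "card \<A> = n" "pairwise disjnt \<A>"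
    and inf: "\<And>A. A \<in> \<A> \<Longrightarrow> infinite A" and ai: "\<And>A. A \<in> \<A> \<Longrightarrow> almost_invariant G A"
    unfolding ends_at_least_def by blast
  \<comment> \<open>The part with \<open>inv s\<close> is there because an edge at \<open>x\<close>
    may also have the form \<open>x = y \<otimes> s\<close>.\<close>
  define K where "K = (\<Union>A\<in>\<A>. \<Union>s\<in>S. {x \<in> A. x \<otimes> s \<notin> A} \<union> {x \<in> A. x \<otimes> inv s \<notin> A})"
  define C where "C = \<lparr>verts = K, edges = {}\<rparr>"
  have ainv: "finite {x \<in> A. x \<otimes> s \<notin> A}" "finite {x \<in> A. x \<otimes> inv s \<notin> A}"
    if "A \<in> \<A>" "s \<in> S" for A s
    using almost_invariantD[OF ai[OF that(1)]] gens(2) that(2) by auto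
  have "finite K" unfolding K_def using \<A>(1) gens(1) ainv by blast
  have KG: "K \<subseteq> carrier G" unfolding K_def using ai almost_invariant_subset by blast
  have C: "verts C = K" "finite (verts C)" using \<open>finite K\<close> by (auto simp: C_def)
  have C2: "subgraph C Cay" "finite_graph C"
    using KG \<open>finite K\<close> by (auto simp: C_def subgraph_def simplicial_graph_def cayley_graph_def finite_graph_def)
  let ?H = "graph_minus Cay C"
  have "\<exists>X\<in>graph_components ?H. infinite X \<and> X \<subseteq> A" if A: "A \<in> \<A>" for A
  proof (rule ccontr)
    assume contra: "\<not> ?thesis"
    have AG: "A \<subseteq> carrier G" using ai[OF A] by (rule almost_invariant_subset)
    have closed: "y \<in> A" if x: "x \<in> A" and xy: "(x, y) \<in> adj ?H" for x y
    proof -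
      obtain s where s: "s \<in> S" "x \<in> carrier G" "y \<in> carrier G" "x \<notin> K" "y = x \<otimes> s \<or> x = y \<otimes> s"
        using xy by (auto simp: adj_graph_minus adj_Cay C)
      then have "y = x \<otimes> s \<or> y = x \<otimes> inv s" using gens(2) by (auto simp: m_assoc)
      moreover have "x \<otimes> s \<in> A" "x \<otimes> inv s \<in> A" using s x A by (auto simp: K_def)
      ultimately show ?thesis by auto
    qed
    have closed': "y \<in> A" if "(x, y) \<in> (adj ?H)\<^sup>*" "x \<in> A" for x y
      using that by induction (auto intro: closed)
    have "A - K \<subseteq> \<Union> {X \<in> graph_components ?H. finite X}"
    proof
      fix x assume x: "x \<in> A - K"
      let ?X = "((adj ?H)\<^sup>* \<inter> verts ?H \<times> verts ?H) `` {x}"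
      have xv: "x \<in> verts ?H" using x AG by (auto simp: verts_graph_minus C)
      have X: "?X \<in> graph_components ?H" "x \<in> ?X" "?X \<subseteq> A"
        unfolding graph_components_def using xv x closed' by (auto intro: quotientI)
      with contra have "finite ?X" by blast
      with X show "x \<in> \<Union> {X \<in> graph_components ?H. finite X}" by blast
    qed
    moreover have "finite (\<Union> {X \<in> graph_components ?H. finite X})"
      using finite_components[OF C(2)] by auto
    ultimately have "finite (A - K)" by (rule finite_subset)
    then show False using inf[OF A] \<open>finite K\<close> by simp
  qed
  then obtain f where f: "\<And>A. A \<in> \<A> \<Longrightarrow> f A \<in> graph_components ?H"
    "\<And>A. A \<in> \<A> \<Longrightarrow> infinite (f A)" "\<And>A. A \<in> \<A> \<Longrightarrow> f A \<subseteq> A" by metis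
  let ?U = "{X \<in> graph_components ?H. \<not> bounded_in Cay X}"
  have "f ` \<A> \<subseteq> ?U"
  proof
    fix X assume "X \<in> f ` \<A>"
    then show "X \<in> ?U"
      using f component_subset[of X C] bounded_in_Cay_iff[of X] by blast
  qed
  moreover have "inj_on f \<A>"
  proof
    fix A B assume AB: "A \<in> \<A>" "B \<in> \<A>" "f A = f B"
    then have "f A \<subseteq> A \<inter> B" using f by blast
    then have "\<not> disjnt A B" using f(2)[OF AB(1)] by (metis disjnt_def finite.emptyI finite_subset)
    then show "A = B" using \<A>(3) AB by (auto simp: pairwise_def)
  qed
  moreover have "finite ?U" using finite_components[OF C(2)] by simp
  ultimately have "enat n \<le> set_size ?U"
    using \<A> by (simp add: set_size_def) (metis card_inj_on_le)
  with C2 show "\<exists>C. subgraph C Cay \<and> finite_graph C \<and>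
       enat n \<le> set_size {X \<in> graph_components (graph_minus Cay C). \<not> bounded_in Cay X}" by blast
next
  assume "\<exists>C. subgraph C Cay \<and> finite_graph C \<and>
       enat n \<le> set_size {X \<in> graph_components (graph_minus Cay C). \<not> bounded_in Cay X}"
  then obtain C where C: "finite (verts C)"
    and n: "enat n \<le> set_size {X \<in> graph_components (graph_minus Cay C). \<not> bounded_in Cay X}"
    by (auto simp: finite_graph_def)
  let ?U = "{X \<in> graph_components (graph_minus Cay C). \<not> bounded_in Cay X}"
  have "finite ?U" using finite_components[OF C] by simp
  then have "n \<le> card ?U" using n by (simp add: set_size_def)
  then obtain \<A> where \<A>: "\<A> \<subseteq> ?U" "card \<A> = n" "finite \<A>"
    by (rule obtain_subset_with_card_n)
  have "infinite A \<and> almost_invariant G A" if "A \<in> \<A>" for A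
  proof
    have A: "A \<in> graph_components (graph_minus Cay C)" "\<not> bounded_in Cay A" using that \<A>(1) by auto
    then show "infinite A" using bounded_in_Cay_iff component_subset[OF A(1)] by (metis Diff_subset subset_trans)
    show "almost_invariant G A" by (rule almost_invariant_component[OF C A(1)])
  qed
  moreover have "pairwise disjnt \<A>"
    by (rule pairwise_mono[OF disjoint_components]) (use \<A>(1) in auto)
  ultimately show "ends_at_least G n" unfolding ends_at_least_def using \<A> by blast
qed

text \<open>Being at least \<open>Suc n\<close> means exceeding \<open>n\<close>, and a supremum
  exceeds \<open>n\<close> only if some member of the family does. So finite lower bounds are
  witnessed by a single \<open>C\<close>.\<close>

lemma ends_wrt_ge_iff: "enat (Suc n) \<le> ends_wrt G S \<longleftrightarrow> ends_at_least G (Suc n)"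
  unfolding ends_at_least_iff_components ends_wrt_def Suc_ile_eq less_SUP_iff by auto

end

text \<open>The right-hand side mentions no generators, which settles the arbitrary choice in
  \<open>number_of_ends\<close> once and for all.\<close>

lemma two_ended_iff:
  assumes "group G" "finitely_generated G"
  shows "two_ended G \<longleftrightarrow> ends_at_least G 2 \<and> \<not> ends_at_least G 3"
proof -
  define S where "S = (SOME S. finite_generating_set G S)"
  have "finite_generating_set G S"
    using assms(2) unfolding finitely_generated_def S_def by (rule someI_ex)
  then interpret finitely_generated_group G S
    using assms(1) by (simp add: finitely_generated_group_def finitely_generated_group_axioms_def)
  have "number_of_ends G = 2 \<longleftrightarrow> enat 2 \<le> number_of_ends G \<and> \<not> enat 3 \<le> number_of_ends G"
    by (cases "number_of_ends G") (auto simp: numeral_eq_enat)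
  then show ?thesis
    using ends_wrt_ge_iff[of 1] ends_wrt_ge_iff[of 2]
    by (simp add: two_ended_def number_of_ends_def S_def[symmetric] numeral_2_eq_2 numeral_3_eq_3)
qed

section \<open>Two-ended groups\<close>

context group_hom
begin

lemma finite_vimage_of_finite_kernel:
  assumes "finite (kernel G H h)" "finite B"
  shows "finite {x \<in> carrier G. h x \<in> B}"
proof -
  have "finite {x \<in> carrier G. h x = b}" for b
  proof (cases "\<exists>a\<in>carrier G. h a = b")
    case True
    then obtain a where a: "a \<in> carrier G" "h a = b" by blast
    have "{x \<in> carrier G. h x = b} \<subseteq> (\<lambda>k. k \<otimes> a) ` kernel G H h"
    proof
      fix x assume "x \<in> {x \<in> carrier G. h x = b}"
      then have x: "x \<in> carrier G" "h x = b" by auto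
      moreover have "b \<in> carrier H" using a by auto
      ultimately have "x \<otimes> inv a \<in> kernel G H h" using a by (simp add: kernel_def)
      moreover have "x = (x \<otimes> inv a) \<otimes> a" using x a by (simp add: G.m_assoc)
      ultimately show "x \<in> (\<lambda>k. k \<otimes> a) ` kernel G H h" by blast
    qed
    then show ?thesis using assms(1) finite_subset by blast
  next
    case False
    then have "{x \<in> carrier G. h x = b} = {}" by blast
    then show ?thesis by (simp only: finite.emptyI)
  qed
  moreover have "{x \<in> carrier G. h x \<in> B} = (\<Union>b\<in>B. {x \<in> carrier G. h x = b})" by blast
  ultimately show ?thesis using assms(2) by simp
qed

text \<open>Preimages stay disjoint, are infinite by surjectivity, and have finite defect sets
  because the fibres, being cosets of the kernel, are finite.\<close>

lemma ends_at_least_vimage: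
  assumes ker: "finite (kernel G H h)" and surj: "h ` carrier G = carrier H"
    and "ends_at_least H n"
  shows "ends_at_least G n"
proof -
  obtain \<B> where \<B>: "finite \<B>" "card \<B> = n" "pairwise disjnt \<B>"
    and inf: "\<And>B. B \<in> \<B> \<Longrightarrow> infinite B" and ai: "\<And>B. B \<in> \<B> \<Longrightarrow> almost_invariant H B"
    using assms(3) unfolding ends_at_least_def by blast
  define f where "f B = {x \<in> carrier G. h x \<in> B}" for B
  have img: "h ` f B = B" if "B \<in> \<B>" for B
    using H.almost_invariant_subset[OF ai[OF that]] surj unfolding f_def by auto
  have infinite: "infinite (f B)" if "B \<in> \<B>" for B
    using inf[OF that] finite_imageI[of "f B" h] unfolding img[OF that] by blast
  have "almost_invariant G (f B)" if B: "B \<in> \<B>" for B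
    unfolding almost_invariant_def
  proof (intro conjI ballI)
    show "f B \<subseteq> carrier G" by (auto simp: f_def)
    fix g assume g: "g \<in> carrier G"
    then have "finite {y \<in> B. y \<otimes>\<^bsub>H\<^esub> h g \<notin> B}" by (intro H.almost_invariantD ai B) simp
    then have "finite {x \<in> carrier G. h x \<in> {y \<in> B. y \<otimes>\<^bsub>H\<^esub> h g \<notin> B}}"
      by (rule finite_vimage_of_finite_kernel[OF ker])
    moreover have "{x \<in> f B. x \<otimes> g \<notin> f B} = {x \<in> carrier G. h x \<in> {y \<in> B. y \<otimes>\<^bsub>H\<^esub> h g \<notin> B}}"
      using g by (auto simp: f_def)
    ultimately show "finite {x \<in> f B. x \<otimes> g \<notin> f B}" by simp
  qed
  moreover have "inj_on f \<B>" using img by (metis inj_onI)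
  moreover have "pairwise disjnt (f ` \<B>)"
    using \<B>(3) by (auto simp: pairwise_def disjnt_def f_def) 
  ultimately show ?thesis
    unfolding ends_at_least_def using \<B> infinite
    by (intro exI[of _ "f ` \<B>"]) (auto simp: card_image)
qed

text \<open>Images of disjoint sets may overlap. So \<open>A\<close> is first shrunk to
  \<open>c A\<close>, the largest union of cosets of the kernel inside it; as the kernel is finite,
  this loses only finitely many points.\<close>

lemma ends_at_least_image:
  assumes ker: "finite (kernel G H h)" and surj: "h ` carrier G = carrier H"
    and "ends_at_least G n"
  shows "ends_at_least H n"
proof -
  let ?K = "kernel G H h"
  obtain \<A> where \<A>: "finite \<A>" "card \<A> = n" "pairwise disjnt \<A>"
    and inf: "\<And>A. A \<in> \<A> \<Longrightarrow> infinite A" and ai: "\<And>A. A \<in> \<A> \<Longrightarrow> almost_invariant G A"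
    using assms(3) unfolding ends_at_least_def by blast
  define c where "c A = {x \<in> carrier G. \<forall>k\<in>?K. x \<otimes> k \<in> A}" for A
  have KG: "?K \<subseteq> carrier G" "\<one> \<in> ?K" by (auto simp: kernel_def)
  have cA: "c A \<subseteq> A" for A unfolding c_def using KG(2) by force
  have saturated: "x \<in> A" if "y \<in> c A" "x \<in> carrier G" "h x = h y" for x y A
  proof -
    have y: "y \<in> carrier G" using that(1) by (simp add: c_def)
    then have "inv y \<otimes> x \<in> ?K" using that by (simp add: kernel_def)
    then have "y \<otimes> (inv y \<otimes> x) \<in> A" using that(1) by (auto simp: c_def)
    then show ?thesis using y that(2) by (simp add: G.m_assoc[symmetric])
  qed
  have inf_c: "infinite (c A)" if A: "A \<in> \<A>" for A
  proof
    assume "finite (c A)"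
    moreover have "finite (\<Union>k\<in>?K. {x \<in> A. x \<otimes> k \<notin> A})"
      using ker KG G.almost_invariantD[OF ai[OF A]] by blast
    moreover have "A \<subseteq> c A \<union> (\<Union>k\<in>?K. {x \<in> A. x \<otimes> k \<notin> A})"
      using G.almost_invariant_subset[OF ai[OF A]] by (auto simp: c_def)
    ultimately show False using inf[OF A] by (meson finite_UnI finite_subset)
  qed
  have inf_h: "infinite (h ` c A)" if A: "A \<in> \<A>" for A
  proof
    assume "finite (h ` c A)"
    then have "finite {x \<in> carrier G. h x \<in> h ` c A}" by (rule finite_vimage_of_finite_kernel[OF ker])
    moreover have "c A \<subseteq> {x \<in> carrier G. h x \<in> h ` c A}" by (auto simp: c_def)
    ultimately show False using inf_c[OF A] finite_subset by blast
  qed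
  have ai_h: "almost_invariant H (h ` c A)" if A: "A \<in> \<A>" for A
    unfolding almost_invariant_def
  proof (intro conjI ballI)
    show "h ` c A \<subseteq> carrier H" by (auto simp: c_def)
    fix g' assume "g' \<in> carrier H"
    then obtain g where g: "g \<in> carrier G" "g' = h g" using surj by blast
    \<comment> \<open>If \<open>h x\<close> leaves the image along \<open>h g\<close>, then
      \<open>x \<otimes> g\<close> is not in \<open>c A\<close>, so some \<open>k\<close> in the
      kernel moves it out of \<open>A\<close>. The finitely many defect sets for
      \<open>g \<otimes> k\<close> thus account for every such \<open>x\<close>.\<close>
    have "{y \<in> h ` c A. y \<otimes>\<^bsub>H\<^esub> g' \<notin> h ` c A} \<subseteq> h ` (\<Union>k\<in>?K. {x \<in> A. x \<otimes> (g \<otimes> k) \<notin> A})"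
    proof
      fix y assume "y \<in> {y \<in> h ` c A. y \<otimes>\<^bsub>H\<^esub> g' \<notin> h ` c A}"
      then obtain x where x: "x \<in> c A" "y = h x" "h x \<otimes>\<^bsub>H\<^esub> g' \<notin> h ` c A" by blast
      have xG: "x \<in> carrier G" using x(1) by (simp add: c_def)
      then have "x \<otimes> g \<notin> c A" using x(3) g by (metis hom_mult imageI)
      then obtain k where k: "k \<in> ?K" "x \<otimes> g \<otimes> k \<notin> A" using xG g by (auto simp: c_def)
      then have "x \<otimes> (g \<otimes> k) \<notin> A" using xG g KG by (metis G.m_assoc subsetD)
      then show "y \<in> h ` (\<Union>k\<in>?K. {x \<in> A. x \<otimes> (g \<otimes> k) \<notin> A})" using x k cA by blast
    qed
    moreover have "finite (\<Union>k\<in>?K. {x \<in> A. x \<otimes> (g \<otimes> k) \<notin> A})"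
      by (intro finite_UN_I[OF ker] G.almost_invariantD[OF ai[OF A]]) (use g KG in auto)
    ultimately show "finite {y \<in> h ` c A. y \<otimes>\<^bsub>H\<^esub> g' \<notin> h ` c A}"
      by (meson finite_imageI finite_subset)
  qed
  have disj: "disjnt (h ` c A) (h ` c B)" if "A \<in> \<A>" "B \<in> \<A>" "A \<noteq> B" for A B
  proof -
    have AB: "A \<inter> B = {}" using \<A>(3) that by (simp add: pairwise_def disjnt_def)
    have "h x \<noteq> h y" if "x \<in> c A" "y \<in> c B" for x y
    proof
      assume "h x = h y"
      moreover have "x \<in> carrier G" using that(1) by (simp add: c_def)
      ultimately have "x \<in> B" using saturated[OF that(2)] by blast
      moreover have "x \<in> A" using that(1) cA by (rule rev_subsetD)
      ultimately show False using AB by blast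
    qed
    then show ?thesis unfolding disjnt_def by blast
  qed
  have "inj_on (\<lambda>A. h ` c A) \<A>"
  proof (rule inj_onI, rule ccontr)
    fix A B assume "A \<in> \<A>" "B \<in> \<A>" "h ` c A = h ` c B" "A \<noteq> B"
    with disj[of A B] have "h ` c A = {}" unfolding disjnt_def by blast
    with inf_h[OF \<open>A \<in> \<A>\<close>] show False by simp
  qed
  then have "card ((\<lambda>A. h ` c A) ` \<A>) = n" using \<A>(2) by (simp add: card_image)
  moreover have "pairwise disjnt ((\<lambda>A. h ` c A) ` \<A>)"
    using disj unfolding pairwise_def by blast
  ultimately show ?thesis
    unfolding ends_at_least_def using \<A>(1) inf_h ai_h
    by (intro exI[of _ "(\<lambda>A. h ` c A) ` \<A>"]) blast
qed

end

section \<open>Groups with fewer than three ends and their infinite subgroups\<close>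

context group
begin

lemma finite_of_disjoint_almost_invariant:
  assumes "\<not> ends_at_least G 3"
    and "almost_invariant G A" "almost_invariant G B" "almost_invariant G C"
    and "A \<inter> B = {}" "A \<inter> C = {}" "B \<inter> C = {}"
  shows "finite A \<or> finite B \<or> finite C"
proof (rule ccontr)
  assume inf: "\<not> ?thesis"
  then have "A \<noteq> B" "A \<noteq> C" "B \<noteq> C" using assms(5-7) by auto
  then have "card {A, B, C} = 3" by simp
  moreover have "pairwise disjnt {A, B, C}"
    using assms(5-7) by (auto simp: pairwise_insert disjnt_def)
  ultimately have "ends_at_least G 3"
    unfolding ends_at_least_def using inf assms(2-4) by (intro exI[of _ "{A, B, C}"]) auto
  with assms(1) show False by blast
qed

text \<open>The powers of \<open>t\<close> form a line. An infinite almost invariant set contains a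
  half-line of it, and two disjoint sets cannot contain half-lines in the same direction, which
  leaves room for two sets only.\<close>

lemma not_ends_at_least_3_of_cyclic_cover:
  assumes t: "t \<in> carrier G" and inj: "inj (\<lambda>n::int. t [^] n)"
    and E: "finite E" "E \<subseteq> carrier G"
    and cover: "\<And>x. x \<in> carrier G \<Longrightarrow> \<exists>n::int. \<exists>e\<in>E. x = t [^] n \<otimes> e"
  shows "\<not> ends_at_least G 3"
proof
  have half: "(\<exists>M. \<forall>n\<ge>M. t [^] (n::int) \<in> A) \<or> (\<exists>M. \<forall>n\<le>M. t [^] (n::int) \<in> A)"
    if A: "almost_invariant G A" "infinite A" for A
  proof -
    have AG: "A \<subseteq> carrier G" using A(1) by (rule almost_invariant_subset)
    have differ: "finite {n::int. (t [^] n \<in> A) \<noteq> (t [^] n \<otimes> g \<in> A)}" if "g \<in> carrier G" for g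
    proof -
      have "finite ({x \<in> A. x \<otimes> g \<notin> A} \<union> {x \<in> carrier G - A. x \<otimes> g \<in> A})"
        using almost_invariantD[OF A(1) that] almost_invariant_enter[OF A(1) that] by simp
      from finite_vimageI[OF this inj] show ?thesis
        by (rule rev_finite_subset) (use t in auto)
    qed
    \<comment> \<open>Otherwise each of the translates of the line by some \<open>e \<in> E\<close>
      meets \<open>A\<close> finitely often, although these finitely many translates cover the
      group.\<close>
    have inf: "infinite {n::int. t [^] n \<in> A}"
    proof
      assume fin: "finite {n::int. t [^] n \<in> A}"
      have "finite {n::int. t [^] n \<otimes> e \<in> A}" if "e \<in> E" for e
      proof (rule finite_subset[OF _ finite_UnI[OF fin differ[of e]]])
        show "e \<in> carrier G" using that E by auto
      qed auto
      then have "finite (\<Union>e\<in>E. (\<lambda>n::int. t [^] n \<otimes> e) ` {n. t [^] n \<otimes> e \<in> A})" using E by simp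
      moreover have "A \<subseteq> (\<Union>e\<in>E. (\<lambda>n::int. t [^] n \<otimes> e) ` {n. t [^] n \<otimes> e \<in> A})"
      proof
        fix x assume "x \<in> A"
        moreover from this obtain n :: int and e where "e \<in> E" "x = t [^] n \<otimes> e"
          using cover AG by blast
        ultimately show "x \<in> (\<Union>e\<in>E. (\<lambda>n::int. t [^] n \<otimes> e) ` {n. t [^] n \<otimes> e \<in> A})" by blast
      qed
      ultimately show False using A(2) finite_subset by blast
    qed
    \<comment> \<open>Going from \<open>n\<close> to \<open>n + 1\<close> is right translation by
      \<open>t\<close>. So membership in \<open>A\<close> changes only finitely often along the line
      and is constant from \<open>M\<close> upwards and from \<open>- M\<close> downwards.\<close>
    define Q where "Q = {n::int. (t [^] n \<in> A) \<noteq> (t [^] (n + 1) \<in> A)}"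
    have "finite Q" unfolding Q_def using differ[OF t] t by (simp add: int_pow_mult)
    then obtain M where M: "\<And>n. n \<in> Q \<Longrightarrow> \<bar>n\<bar> < M"
      by (metis finite_imageI Max_ge imageI order_le_less_trans zless_add1_eq order_refl)
    have up: "t [^] n \<in> A \<longleftrightarrow> t [^] M \<in> A" if "n \<ge> M" for n
      using that
    proof (induction n rule: int_ge_induct)
      case (step i)
      then have "i \<notin> Q" using M[of i] by auto
      with step show ?case by (simp add: Q_def)
    qed simp
    have down: "t [^] n \<in> A \<longleftrightarrow> t [^] (- M) \<in> A" if "n \<le> - M" for n
      using that
    proof (induction n rule: int_le_induct)
      case (step i)
      then have "i - 1 \<notin> Q" using M[of "i - 1"] by auto
      with step show ?case by (simp add: Q_def)
    qed simp
    have "\<not> {n::int. t [^] n \<in> A} \<subseteq> {- M..M}" using inf finite_subset by blast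
    then obtain n :: int where "t [^] n \<in> A" "n \<ge> M \<or> n \<le> - M" by force
    then have "t [^] M \<in> A \<or> t [^] (- M) \<in> A" using up down by blast
    then show ?thesis using up down by blast
  qed
  assume "ends_at_least G 3"
  then obtain \<A> where \<A>: "card \<A> = 3" "pairwise disjnt \<A>"
    and *: "\<And>A. A \<in> \<A> \<Longrightarrow> almost_invariant G A \<and> infinite A"
    unfolding ends_at_least_def by blast
  obtain A B C where ABC: "\<A> = {A, B, C}" "A \<noteq> B" "A \<noteq> C" "B \<noteq> C"
    using \<A>(1) by (auto simp: card_3_iff)
  define up where "up X \<longleftrightarrow> (\<exists>M. \<forall>n\<ge>M. t [^] (n::int) \<in> X)" for X
  define dn where "dn X \<longleftrightarrow> (\<exists>M. \<forall>n\<le>M. t [^] (n::int) \<in> X)" for X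
  have h: "up X \<or> dn X" if "X \<in> \<A>" for X using half[of X] *[OF that] by (simp add: up_def dn_def)
  have nup: "\<not> (up X \<and> up Y)" if "disjnt X Y" for X Y
  proof
    assume "up X \<and> up Y"
    then obtain M M' where "\<forall>n\<ge>M. t [^] (n::int) \<in> X" "\<forall>n\<ge>M'. t [^] (n::int) \<in> Y"
      by (auto simp: up_def)
    then have "t [^] (max M M') \<in> X \<inter> Y" by auto
    then show False using that by (auto simp: disjnt_def)
  qed
  have ndn: "\<not> (dn X \<and> dn Y)" if "disjnt X Y" for X Y
  proof
    assume "dn X \<and> dn Y"
    then obtain M M' where "\<forall>n\<le>M. t [^] (n::int) \<in> X" "\<forall>n\<le>M'. t [^] (n::int) \<in> Y"
      by (auto simp: dn_def)
    then have "t [^] (min M M') \<in> X \<inter> Y" by auto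
    then show False using that by (auto simp: disjnt_def)
  qed
  have "disjnt A B" "disjnt A C" "disjnt B C" using \<A>(2) ABC by (auto simp: pairwise_def)
  then show False using h[of A] h[of B] h[of C] ABC nup ndn by blast
qed


text \<open>Split an infinite set among \<open>A\<close>, \<open>B\<close> and their complements
  into two corners. With the complement of that set they form three disjoint almost invariant sets,
  so one of the two corners is finite. Doing this twice gives two opposite finite corners.\<close>

lemma same_or_opposite_translate:
  assumes few: "\<not> ends_at_least G 3"
    and A: "almost_invariant G A" "infinite A" "infinite (carrier G - A)"
    and g: "g \<in> carrier G"
  defines "B \<equiv> left_translate g A"
  shows "finite (A - B) \<and> finite (B - A) \<or> finite (A \<inter> B) \<and> finite (carrier G - A - B)"
proof -
  have AG: "A \<subseteq> carrier G" using A(1) by (rule almost_invariant_subset)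
  have BG: "B \<subseteq> carrier G" by (auto simp: B_def left_translate_def)
  have ai: "almost_invariant G A" "almost_invariant G (carrier G - A)"
      "almost_invariant G B" "almost_invariant G (carrier G - B)"
    unfolding B_def using A(1) g almost_invariant_Compl almost_invariant_left_translate by blast+
  have inf: "infinite B" "infinite (carrier G - B)"
    using A(2,3) finite_left_translate_iff[OF g AG] finite_left_translate_iff[OF g, of "carrier G - A"]
      left_translate_Compl[OF g, of A] by (auto simp: B_def)
  have Diff: "A - B = A \<inter> (carrier G - B)" "B - A = B \<inter> (carrier G - A)"
      "carrier G - A - B = (carrier G - A) \<inter> (carrier G - B)" using AG BG by auto
  have split: "finite (X \<inter> Y) \<Longrightarrow> finite (X - Y) \<Longrightarrow> finite X" for X Y :: "'a set"
    by (metis Int_Diff_Un finite_UnI)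
  have "finite (A \<inter> B) \<or> finite (A - B) \<or> finite (carrier G - A)"
    by (rule finite_of_disjoint_almost_invariant[OF few])
      (use ai AG BG in \<open>auto simp: Diff intro: almost_invariant_Int\<close>)
  then consider "finite (A \<inter> B)" | "finite (A - B)" using A by blast
  then show ?thesis
  proof cases
    case 1
    have "finite (B - A) \<or> finite (carrier G - A - B) \<or> finite A"
      by (rule finite_of_disjoint_almost_invariant[OF few])
        (use ai AG BG in \<open>auto simp: Diff intro: almost_invariant_Int\<close>)
    moreover have "infinite (B - A)" using split[of B A] 1 inf by (auto simp: Int_commute)
    ultimately show ?thesis using 1 A by blast
  next
    case 2
    have "finite (A \<inter> B) \<or> finite (B - A) \<or> finite (carrier G - B)"
      by (rule finite_of_disjoint_almost_invariant[OF few])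
        (use ai AG BG in \<open>auto simp: Diff intro: almost_invariant_Int\<close>)
    moreover have "infinite (A \<inter> B)" using split[of A B] 2 A by blast
    ultimately show ?thesis using 2 inf by blast
  qed
qed

lemma left_translate_inv:
  assumes "g \<in> carrier G" "A \<subseteq> carrier G"
  shows "left_translate (inv g) (left_translate g A) = A"
  using assms by (simp add: left_translate_mult) (auto simp: left_translate_def)

text \<open>Elements that preserve \<open>A\<close> up to a finite set have index at most two among
  all: if two elements exchange \<open>A\<close> with its complement, their quotient preserves
  \<open>A\<close>. So infinitely many exchanging elements also yield infinitely many preserving
  ones.\<close>

lemma infinitely_many_same_translate:
  assumes few: "\<not> ends_at_least G 3"
    and A: "almost_invariant G A" "infinite A" "infinite (carrier G - A)"
    and N: "subgroup N G" "infinite N"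
  shows "infinite {g \<in> N. finite (A - left_translate g A) \<and> finite (left_translate g A - A)}"
    (is "infinite {g \<in> N. ?same g}")
proof
  assume fin: "finite {g \<in> N. ?same g}"
  have NG: "N \<subseteq> carrier G" using N(1) by (rule subgroup.subset)
  have AG: "A \<subseteq> carrier G" using A(1) by (rule almost_invariant_subset)
  define O' where "O' = {g \<in> N. finite (A \<inter> left_translate g A) \<and> finite (carrier G - A - left_translate g A)}"
  have "N \<subseteq> {g \<in> N. ?same g} \<union> O'"
  proof
    fix g assume "g \<in> N"
    then show "g \<in> {g \<in> N. ?same g} \<union> O'"
      using same_or_opposite_translate[OF few A, of g] NG unfolding O'_def by blast
  qed
  then have "infinite O'" using N(2) fin by (meson finite_UnI finite_subset)
  then obtain g where g: "g \<in> O'" by (metis finite.emptyI equals0I)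
  have gG: "g \<in> carrier G" using g NG by (auto simp: O'_def)
  have "(\<lambda>h. inv g \<otimes> h) ` O' \<subseteq> {g \<in> N. ?same g}"
  proof
    fix k assume "k \<in> (\<lambda>h. inv g \<otimes> h) ` O'"
    then obtain h where h: "h \<in> O'" "k = inv g \<otimes> h" by blast
    have hG: "h \<in> carrier G" using h NG by (auto simp: O'_def)
    have kN: "k \<in> N" using h g N(1) by (simp add: O'_def subgroup.m_closed subgroup.m_inv_closed)
    let ?L = "\<lambda>g. left_translate g A"
    have LG: "?L g \<subseteq> carrier G" "?L h \<subseteq> carrier G" by (auto simp: left_translate_def)
    have "?L g - ?L h \<subseteq> (A \<inter> ?L g) \<union> (carrier G - A - ?L h)"
      "?L h - ?L g \<subseteq> (A \<inter> ?L h) \<union> (carrier G - A - ?L g)" using LG by auto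
    then have "finite (?L g - ?L h)" "finite (?L h - ?L g)"
      using g h(1) unfolding O'_def by (metis (no_types, lifting) finite_UnI finite_subset mem_Collect_eq)+
    then have "finite (left_translate (inv g) (?L g - ?L h))" "finite (left_translate (inv g) (?L h - ?L g))"
      using finite_left_translate_iff[of "inv g" "?L g - ?L h"]
        finite_left_translate_iff[of "inv g" "?L h - ?L g"] gG LG by blast+
    moreover have "left_translate (inv g) (?L g) = A" by (rule left_translate_inv[OF gG AG])
    moreover have "left_translate (inv g) (?L h) = ?L k"
      unfolding h(2) by (rule left_translate_mult) (use gG hG in auto)
    ultimately have "?same k" by (simp only: left_translate_Diff inv_closed gG simp_thms)
    with kN show "k \<in> {g \<in> N. ?same g}" by simp
  qed
  then have "finite ((\<lambda>h. inv g \<otimes> h) ` O')" using fin finite_subset by blast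
  moreover have "inj_on (\<lambda>h. inv g \<otimes> h) O'"
  proof (rule inj_onI)
    fix x y assume xy: "x \<in> O'" "y \<in> O'" "inv g \<otimes> x = inv g \<otimes> y"
    have "x \<in> carrier G" "y \<in> carrier G" using xy(1,2) NG unfolding O'_def by blast+
    then show "x = y" using xy(3) gG by simp
  qed
  ultimately show False using \<open>infinite O'\<close> finite_imageD by blast
qed

text \<open>If \<open>g \<otimes> c\<close> is in \<open>A\<close> and \<open>g \<otimes> d\<close>
  is not, then \<open>g \<otimes> c\<close> leaves \<open>A\<close> along
  \<open>inv c \<otimes> d\<close>.\<close>

lemma finitely_many_splitting:
  assumes A: "almost_invariant G A" and C: "finite C" "C \<subseteq> carrier G"
  shows "finite {g \<in> carrier G. \<exists>c\<in>C. \<exists>d\<in>C. g \<otimes> c \<in> A \<and> g \<otimes> d \<notin> A}"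
proof -
  have "finite {g \<in> carrier G. g \<otimes> c \<in> A \<and> g \<otimes> d \<notin> A}" if "c \<in> C" "d \<in> C" for c d
  proof (rule finite_right_translate_vimage)
    have cd: "c \<in> carrier G" "d \<in> carrier G" using that C by auto
    then show "finite {x \<in> A. x \<otimes> (inv c \<otimes> d) \<notin> A}" using A almost_invariantD by simp
    show "c \<in> carrier G" by fact
    fix x assume x: "x \<in> {g \<in> carrier G. g \<otimes> c \<in> A \<and> g \<otimes> d \<notin> A}"
    have "c \<otimes> (inv c \<otimes> d) = d" using cd by (simp add: m_assoc[symmetric])
    then have "x \<otimes> c \<otimes> (inv c \<otimes> d) = x \<otimes> d" using x cd by (simp add: m_assoc)
    then show "x \<in> carrier G \<and> x \<otimes> c \<in> {x \<in> A. x \<otimes> (inv c \<otimes> d) \<notin> A}" using x by simp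
  qed
  then have "finite (\<Union>c\<in>C. \<Union>d\<in>C. {g \<in> carrier G. g \<otimes> c \<in> A \<and> g \<otimes> d \<notin> A})"
    using C(1) by (intro finite_UN_I)
  then show ?thesis by (rule rev_finite_subset) blast
qed

text \<open>
  An element \<open>t\<close> that moves a finite set \<open>C\<close> containing both ends of every edge of the coboundary
  of \<open>A\<close> off the coboundary, in such a way that also \<open>inv t\<close> does, makes \<open>A\<close> and its translate
  nested.
\<close>

lemma exists_shifting_element:
  assumes fg: "finitely_generated G" and few: "\<not> ends_at_least G 3"
    and A: "almost_invariant G A" "infinite A" "infinite (carrier G - A)"
    and N: "subgroup N G" "infinite N"
  obtains t where "t \<in> N" "left_translate t A \<subset> A" "finite (A - left_translate t A)"
proof -
  have NG: "N \<subseteq> carrier G" using N(1) by (rule subgroup.subset)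
  have AG: "A \<subseteq> carrier G" using A(1) by (rule almost_invariant_subset)
  obtain S where S: "finite S" "S \<subseteq> carrier G" "generate G S = carrier G"
    using fg by (auto simp: finitely_generated_def finite_generating_set_def)
  define Q where "Q s = {x \<in> A. x \<otimes> s \<notin> A} \<union> {x \<in> carrier G - A. x \<otimes> s \<in> A}" for s
  define C where "C = (\<Union>s\<in>S. Q s \<union> (\<lambda>x. x \<otimes> s) ` Q s)"
  have "finite (Q s)" if "s \<in> S" for s
    unfolding Q_def using that S almost_invariantD[OF A(1)] almost_invariant_enter[OF A(1)] by blast
  then have C: "finite C" "C \<subseteq> carrier G" using S AG by (auto simp: C_def Q_def)
  have edge: "x \<in> C \<and> x \<otimes> s \<in> C" if "x \<in> carrier G" "s \<in> S" "(x \<in> A) \<noteq> (x \<otimes> s \<in> A)" for x s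
    using that by (auto simp: C_def Q_def)
  define Exc where "Exc = {g \<in> carrier G. \<exists>c\<in>C. \<exists>d\<in>C. g \<otimes> c \<in> A \<and> g \<otimes> d \<notin> A}"
  have "finite Exc" unfolding Exc_def by (rule finitely_many_splitting[OF A(1) C])
  moreover have "infinite {g \<in> N. finite (A - left_translate g A) \<and> finite (left_translate g A - A)}"
    by (rule infinitely_many_same_translate[OF few A N])
  \<comment> \<open>Both \<open>g\<close> and \<open>inv g\<close> have to avoid \<open>Exc\<close>:
    the first keeps \<open>gC\<close> on one side of \<open>A\<close>, the second keeps
    \<open>C\<close> on one side of the translate \<open>B\<close>.\<close>
  moreover have "finite (Exc \<union> m_inv G ` Exc)" using \<open>finite Exc\<close> by simp
  ultimately obtain g where "g \<in> {g \<in> N. finite (A - left_translate g A) \<and> finite (left_translate g A - A)}"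
      "g \<notin> Exc \<union> m_inv G ` Exc"
    by (meson finite_subset subsetI)
  then have gN: "g \<in> N" and same: "finite (A - left_translate g A)" "finite (left_translate g A - A)"
    and gE: "g \<notin> Exc" "inv g \<notin> Exc"
    using NG by (auto simp: image_iff) (metis inv_inv subsetD)
  define B where "B = left_translate g A"
  have gG: "g \<in> carrier G" using gN NG by auto
  have BG: "B \<subseteq> carrier G" by (auto simp: B_def left_translate_def)
  define gC where "gC = (\<lambda>c. g \<otimes> c) ` C"
  have gC: "gC \<subseteq> A \<or> gC \<inter> A = {}" using gE(1) gG by (auto simp: Exc_def gC_def)
  have CB: "C \<subseteq> B \<or> C \<inter> B = {}"
    using gE(2) gG C by (auto simp: Exc_def B_def left_translate_def)
  have edgeB: "x \<in> gC \<and> x \<otimes> s \<in> gC" if "x \<in> carrier G" "s \<in> S" "(x \<in> B) \<noteq> (x \<otimes> s \<in> B)" for x s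
  proof -
    have s: "s \<in> carrier G" using that S by auto
    have "(inv g \<otimes> x \<in> A) \<noteq> (inv g \<otimes> x \<otimes> s \<in> A)"
      using that gG s by (auto simp: B_def left_translate_def m_assoc)
    then have "inv g \<otimes> x \<in> C \<and> inv g \<otimes> x \<otimes> s \<in> C" using edge that gG by blast
    moreover have "x = g \<otimes> (inv g \<otimes> x)" "x \<otimes> s = g \<otimes> (inv g \<otimes> x \<otimes> s)"
      using that gG s by (simp_all add: m_assoc[symmetric])
    ultimately show ?thesis unfolding gC_def by blast
  qed
  \<comment> \<open>An edge that crosses the boundary of \<open>A\<close> has both ends in
    \<open>C\<close> and avoids \<open>Y\<close>; one that crosses the boundary of \<open>B\<close>
    has both ends in \<open>gC\<close> and avoids \<open>X\<close>. So no edge crosses the boundary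
    of the corner.\<close>
  have trivial: "X \<inter> Y = {} \<or> X \<inter> Y = carrier G"
    if X: "X = A \<or> X = carrier G - A" "gC \<inter> X = {}" and Y: "Y = B \<or> Y = carrier G - B" "C \<inter> Y = {}" for X Y
  proof (rule invariant_set_trivial[OF _ S(2,3)])
    show "X \<inter> Y \<subseteq> carrier G" using X AG by auto
    fix x s assume xs: "x \<in> carrier G" "s \<in> S"
    have xsG: "x \<otimes> s \<in> carrier G" using xs S by auto
    show "x \<otimes> s \<in> X \<inter> Y \<longleftrightarrow> x \<in> X \<inter> Y"
    proof (cases "(x \<in> A) = (x \<otimes> s \<in> A)")
      case False
      then have "x \<notin> Y" "x \<otimes> s \<notin> Y" using edge[OF xs] Y by auto
      then show ?thesis by simp
    next
      case A: True
      show ?thesis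
      proof (cases "(x \<in> B) = (x \<otimes> s \<in> B)")
        case False
        then have "x \<notin> X" "x \<otimes> s \<notin> X" using edgeB[OF xs] X by auto
        then show ?thesis by simp
      next
        case True
        with A show ?thesis using X Y xs xsG by auto
      qed
    qed
  qed
  obtain x s where "x \<in> carrier G" "s \<in> S" "(x \<otimes> s \<in> A) \<noteq> (x \<in> A)"
    using invariant_set_trivial[OF AG S(2,3)] A(2,3) by (metis Diff_cancel finite.emptyI)
  then have CA: "C \<inter> A \<noteq> {}" "\<not> C \<subseteq> A" using edge[of x s] by auto
  have nA: "A \<noteq> {}" "A \<noteq> carrier G" using A(2,3) by auto
  have gCC: "gC \<subseteq> carrier G" using C gG by (auto simp: gC_def)
  \<comment> \<open>The first and last cases contradict that \<open>A\<close> and \<open>B\<close>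
    differ by finite sets. The second gives \<open>t = g\<close>, the third
    \<open>t = inv g\<close>; these inclusions are strict because \<open>C\<close> meets both
    \<open>A\<close> and its complement.\<close>
  consider "gC \<subseteq> A" "C \<subseteq> B" | "gC \<subseteq> A" "C \<inter> B = {}" | "gC \<inter> A = {}" "C \<subseteq> B"
    | "gC \<inter> A = {}" "C \<inter> B = {}" using gC CB by blast
  then show ?thesis
  proof cases
    case 1
    then have "(carrier G - A) \<inter> (carrier G - B) = {} \<or> (carrier G - A) \<inter> (carrier G - B) = carrier G"
      by (intro trivial) auto
    then have "carrier G - A \<subseteq> B - A" using nA AG by auto
    then show ?thesis using same(2) A(3) unfolding B_def by (meson finite_subset)
  next
    case 2
    then have "(carrier G - A) \<inter> B = {} \<or> (carrier G - A) \<inter> B = carrier G"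
      by (intro trivial) auto
    then have "B \<subseteq> A" using nA AG BG by auto
    moreover have "B \<noteq> A" using 2 CA by auto
    ultimately show ?thesis using that[OF gN] same(1) unfolding B_def by blast
  next
    case 3
    then have "A \<inter> (carrier G - B) = {} \<or> A \<inter> (carrier G - B) = carrier G"
      by (intro trivial) auto
    then have AB: "A \<subseteq> B" using nA AG BG by auto
    have ig: "inv g \<in> N" using gN N(1) by (simp add: subgroup.m_inv_closed)
    have iB: "left_translate (inv g) B = A" unfolding B_def by (rule left_translate_inv[OF gG AG])
    have sub: "left_translate (inv g) A \<subseteq> A"
      using AB iB by (auto simp: left_translate_def)
    have "left_translate (inv g) A \<noteq> A"
    proof
      assume "left_translate (inv g) A = A"
      then have "B = A"
        using left_translate_inv[of "inv g" A] gG AG unfolding B_def by simp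
      then show False using 3 CA by auto
    qed
    moreover have "finite (A - left_translate (inv g) A)"
      using finite_left_translate_iff[of "inv g" "B - A"] same(2) gG BG left_translate_Diff[of "inv g" B A] iB
      by (auto simp: B_def)
    ultimately show ?thesis using that[OF ig] sub by blast
  next
    case 4
    then have "A \<inter> B = {} \<or> A \<inter> B = carrier G" by (intro trivial) auto
    then have "A - B = A" using nA AG by auto
    then show ?thesis using same(1) A(2) by (simp add: B_def)
  qed
qed

text \<open>
  The points that no power of \<open>t\<close> moves into \<open>A\<close>, and those that every power moves into \<open>A\<close>, form
  right invariant sets, since otherwise the coboundary of \<open>A\<close> would meet an orbit of \<open>t\<close> infinitely
  often. So every orbit crosses from the complement of \<open>A\<close> into \<open>A\<close>.
\<close>

lemma shifting_element_cover:
  assumes fg: "finitely_generated G"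
    and A: "almost_invariant G A" "A \<noteq> {}" "A \<noteq> carrier G"
    and t: "t \<in> carrier G" "left_translate t A \<subset> A"
    and x: "x \<in> carrier G"
  shows "\<exists>n::int. \<exists>d\<in>A - left_translate t A. x = t [^] n \<otimes> d"
proof -
  have AG: "A \<subseteq> carrier G" using A(1) by (rule almost_invariant_subset)
  obtain S where S: "finite S" "S \<subseteq> carrier G" "generate G S = carrier G"
    using fg by (auto simp: finitely_generated_def finite_generating_set_def)
  have tA: "t \<otimes> y \<in> left_translate t A" if "y \<in> A" for y
    using that t AG by (auto simp: left_translate_eq)
  have mono1: "t [^] (n + 1) \<otimes> y \<in> A" if "t [^] n \<otimes> y \<in> A" "y \<in> carrier G" for y and n :: int
  proof -
    have "t [^] (1 + n) \<otimes> y = t \<otimes> (t [^] n \<otimes> y)"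
      using t that by (simp only: int_pow_mult int_pow_1 int_pow_closed m_assoc)
    then show ?thesis using tA[OF that(1)] t by (auto simp: add.commute)
  qed
  have mono: "t [^] n \<otimes> y \<in> A" if "m \<le> n" "t [^] m \<otimes> y \<in> A" "y \<in> carrier G" for y and m n :: int
    using that(1)
  proof (induction n rule: int_ge_induct)
    case (step i)
    then show ?case using mono1 that by simp
  qed (rule that)
  \<comment> \<open>If a positive power of \<open>t\<close> were trivial, it would bring a point of
    \<open>A\<close> outside \<open>left_translate t A\<close> back to itself by way of
    \<open>left_translate t A\<close>.\<close>
  have pow: "t [^] (k::int) \<noteq> \<one>" if "k \<ge> 1" for k
  proof
    assume "t [^] k = \<one>"
    obtain d where d: "d \<in> A" "d \<notin> left_translate t A" using t(2) by blast
    have dG: "d \<in> carrier G" using d AG by auto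
    have "t [^] (k - 1) \<otimes> d \<in> A" by (rule mono[of 0]) (use that d dG t in auto)
    from tA[OF this] have "t \<otimes> (t [^] (k - 1) \<otimes> d) \<in> left_translate t A" .
    moreover have "t \<otimes> (t [^] (k - 1) \<otimes> d) = t [^] (1 + (k - 1)) \<otimes> d"
      using t dG by (simp only: int_pow_mult int_pow_1 int_pow_closed m_assoc)
    ultimately show False using \<open>t [^] k = \<one>\<close> d dG by simp
  qed
  have inj: "inj (\<lambda>n::int. t [^] n)"
  proof (rule injI)
    fix m n :: int assume eq: "t [^] m = t [^] n"
    have "t [^] (m - n) = \<one>" "t [^] (n - m) = \<one>" using t eq by (simp_all add: int_pow_diff)
    then show "m = n" using pow[of "m - n"] pow[of "n - m"] by linarith
  qed
  have injx: "inj (\<lambda>n::int. t [^] n \<otimes> y)" if "y \<in> carrier G" for y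
    using inj t that by (auto simp: inj_def)
  have cross: "finite {n::int. (t [^] n \<otimes> y \<in> A) \<noteq> (t [^] n \<otimes> (y \<otimes> s) \<in> A)}"
    if y: "y \<in> carrier G" and s: "s \<in> S" for y s
  proof -
    have sG: "s \<in> carrier G" using s S by auto
    have "finite ({z \<in> A. z \<otimes> s \<notin> A} \<union> {z \<in> carrier G - A. z \<otimes> s \<in> A})"
      using almost_invariantD[OF A(1) sG] almost_invariant_enter[OF A(1) sG] by simp
    from finite_vimageI[OF this injx[OF y]] show ?thesis
      by (rule rev_finite_subset) (use t y sG in \<open>auto simp: m_assoc\<close>)
  qed
  have ray: "False" if "finite {n::int. P n}" "(\<forall>n\<ge>n0. P n) \<or> (\<forall>n\<le>n0. P n)" for P and n0 :: int
  proof -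
    have "{n0..} \<subseteq> {n. P n} \<or> {..n0} \<subseteq> {n. P n}" using that(2) by auto
    then show False using that(1) infinite_Ici[of n0] infinite_Iic[of n0] finite_subset by blast
  qed
  define I where "I = {y \<in> carrier G. \<forall>n::int. t [^] n \<otimes> y \<in> A}"
  define J where "J = {y \<in> carrier G. \<forall>n::int. t [^] n \<otimes> y \<notin> A}"
  have I: "I = {} \<or> I = carrier G"
  proof (rule invariant_set_trivial[OF _ S(2,3)])
    fix y s assume ys: "y \<in> carrier G" "s \<in> S"
    have ysG: "y \<otimes> s \<in> carrier G" using ys S by auto
    have "(\<forall>n::int. t [^] n \<otimes> y \<in> A) \<longleftrightarrow> (\<forall>n::int. t [^] n \<otimes> (y \<otimes> s) \<in> A)"
    proof (rule ccontr)
      assume "\<not> ?thesis"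
      then obtain n0 :: int where "(\<forall>n::int. t [^] n \<otimes> y \<in> A) \<and> t [^] n0 \<otimes> (y \<otimes> s) \<notin> A \<or>
         (\<forall>n::int. t [^] n \<otimes> (y \<otimes> s) \<in> A) \<and> t [^] n0 \<otimes> y \<notin> A" by blast
      \<comment> \<open>The exponents that move a point into \<open>A\<close> are closed upwards, so
        a single disagreement spreads to a half-line of exponents, against
        \<open>cross\<close>.\<close>
      then have "\<forall>n\<le>n0. (t [^] n \<otimes> y \<in> A) \<noteq> (t [^] n \<otimes> (y \<otimes> s) \<in> A)"
        using mono[OF _ _ ys(1)] mono[OF _ _ ysG] by blast
      then show False using ray[OF cross[OF ys], of n0] by blast
    qed
    then show "y \<otimes> s \<in> I \<longleftrightarrow> y \<in> I" using ys ysG by (simp add: I_def)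
  qed (auto simp: I_def)
  have J: "J = {} \<or> J = carrier G"
  proof (rule invariant_set_trivial[OF _ S(2,3)])
    fix y s assume ys: "y \<in> carrier G" "s \<in> S"
    have ysG: "y \<otimes> s \<in> carrier G" using ys S by auto
    have "(\<forall>n::int. t [^] n \<otimes> y \<notin> A) \<longleftrightarrow> (\<forall>n::int. t [^] n \<otimes> (y \<otimes> s) \<notin> A)"
    proof (rule ccontr)
      assume "\<not> ?thesis"
      then obtain n0 :: int where "(\<forall>n::int. t [^] n \<otimes> y \<notin> A) \<and> t [^] n0 \<otimes> (y \<otimes> s) \<in> A \<or>
         (\<forall>n::int. t [^] n \<otimes> (y \<otimes> s) \<notin> A) \<and> t [^] n0 \<otimes> y \<in> A" by blast
      then have "\<forall>n\<ge>n0. (t [^] n \<otimes> y \<in> A) \<noteq> (t [^] n \<otimes> (y \<otimes> s) \<in> A)"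
        using mono[OF _ _ ys(1)] mono[OF _ _ ysG] by blast
      then show False using ray[OF cross[OF ys], of n0] by blast
    qed
    then show "y \<otimes> s \<in> J \<longleftrightarrow> y \<in> J" using ys ysG by (simp add: J_def)
  qed (auto simp: J_def)
  have "I \<subseteq> A"
  proof
    fix y assume "y \<in> I"
    then have "t [^] (0::int) \<otimes> y \<in> A" "y \<in> carrier G" unfolding I_def by blast+
    then show "y \<in> A" by simp
  qed
  then have "I = {}" using I A AG by auto
  have "J \<inter> A = {}"
  proof (rule ccontr)
    assume "J \<inter> A \<noteq> {}"
    then obtain y where "t [^] (0::int) \<otimes> y \<notin> A" "y \<in> A" unfolding J_def by blast
    then show False using AG by (simp add: subset_iff)
  qed
  then have "J = {}" using J A AG by auto
  obtain m n :: int where mn: "t [^] m \<otimes> x \<notin> A" "t [^] n \<otimes> x \<in> A"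
    using \<open>I = {}\<close> \<open>J = {}\<close> x unfolding I_def J_def by blast
  have "\<exists>k::int. t [^] k \<otimes> x \<notin> A \<and> t [^] (k + 1) \<otimes> x \<in> A"
  proof (rule ccontr)
    assume contra: "\<not> ?thesis"
    have "t [^] j \<otimes> x \<notin> A" if "m \<le> j" for j
      using that
    proof (induction j rule: int_ge_induct)
      case (step i)
      then show ?case using contra by blast
    qed (rule mn)
    then have "\<not> m \<le> n" using mn by blast
    then show False using mono[of n m x] mn x by simp
  qed
  then obtain k :: int where k: "t [^] k \<otimes> x \<notin> A" "t [^] (k + 1) \<otimes> x \<in> A" by blast
  \<comment> \<open>The orbit enters \<open>A\<close> between the exponents \<open>k\<close> and
    \<open>k + 1\<close>. The entry point \<open>d\<close> lies in \<open>A\<close>, its predecessor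
    \<open>inv t \<otimes> d\<close> does not.\<close>
  define d where "d = t [^] (k + 1) \<otimes> x"
  have "t [^] (k + 1) = t \<otimes> t [^] k" using t int_pow_mult[of t 1 k] by (simp add: add.commute)
  then have "inv t \<otimes> d = t [^] k \<otimes> x"
    unfolding d_def using t x by (simp add: m_assoc[symmetric])
  then have "inv t \<otimes> d \<notin> A" using k by simp
  then have "d \<in> A - left_translate t A" using k by (auto simp: left_translate_def d_def)
  moreover have "x = t [^] (- (k + 1)) \<otimes> d"
  proof -
    have "t [^] (- (k + 1)) \<otimes> t [^] (k + 1) = \<one>"
      using t int_pow_mult[of t "- (k + 1)" "k + 1"] by simp
    then show ?thesis unfolding d_def using t x
      by (metis int_pow_closed l_one m_assoc)
  qed
  ultimately show ?thesis by blast
qed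

text \<open>The shifting element \<open>t\<close> is taken from \<open>N\<close>, so its powers stay
  in \<open>N\<close> and the finite set \<open>A - left_translate t A\<close> meets every right
  coset of \<open>N\<close>.\<close>

theorem two_ended_infinite_subgroup_cover:
  assumes fg: "finitely_generated G" and two: "two_ended G"
    and N: "subgroup N G" "infinite N"
  obtains D where "finite D" "D \<subseteq> carrier G" "\<And>x. x \<in> carrier G \<Longrightarrow> \<exists>n\<in>N. \<exists>d\<in>D. x = n \<otimes> d"
proof -
  have ends: "ends_at_least G 2" "\<not> ends_at_least G 3"
    using two two_ended_iff[OF group_axioms fg] by auto
  then obtain \<A> where \<A>: "card \<A> = 2" "pairwise disjnt \<A>"
    and *: "\<And>A. A \<in> \<A> \<Longrightarrow> almost_invariant G A \<and> infinite A"
    unfolding ends_at_least_def by blast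
  obtain A B where AB: "\<A> = {A, B}" "A \<noteq> B" using \<A>(1) by (auto simp: card_2_iff)
  have "A \<inter> B = {}" using \<A>(2) AB by (auto simp: pairwise_def disjnt_def)
  \<comment> \<open>The second set \<open>B\<close> serves to make the complement of
    \<open>A\<close> infinite.\<close>
  then have "B \<subseteq> carrier G - A" using *[of B] AB(1) almost_invariant_subset[of B] by auto
  then have "finite (carrier G - A) \<Longrightarrow> finite B" by (rule finite_subset)
  then have A: "almost_invariant G A" "infinite A" "infinite (carrier G - A)"
    using *[of A] *[of B] AB(1) by blast+
  have AG: "A \<subseteq> carrier G" using A(1) by (rule almost_invariant_subset)
  obtain t where t: "t \<in> N" "left_translate t A \<subset> A" "finite (A - left_translate t A)"
    using exists_shifting_element[OF fg ends(2) A N] by blast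
  have nA: "A \<noteq> {}" "A \<noteq> carrier G" using A(2,3) by auto
  have tG: "t \<in> carrier G" using t(1) subgroup.subset[OF N(1)] by auto
  show ?thesis
  proof (rule that[OF t(3)])
    show "A - left_translate t A \<subseteq> carrier G" using AG by auto
    fix x assume "x \<in> carrier G"
    then obtain n :: int and d where nd: "d \<in> A - left_translate t A" "x = t [^] n \<otimes> d"
      using shifting_element_cover[OF fg A(1) nA tG t(2)] by blast
    moreover have "t [^] n \<in> N" using subgroup_int_pow_closed[OF N(1) t(1)] .
    ultimately show "\<exists>n\<in>N. \<exists>d\<in>A - left_translate t A. x = n \<otimes> d" by blast
  qed
qed

text \<open>By pigeonhole over \<open>D\<close>, two different powers of \<open>p\<close> lie in the
  same right coset of \<open>N\<close>; their quotient is a power in \<open>N\<close>.\<close>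

corollary two_ended_infinite_subgroup_pow:
  assumes fg: "finitely_generated G" and two: "two_ended G"
    and N: "subgroup N G" "infinite N" and p: "p \<in> carrier G"
  obtains k :: nat where "k > 0" "p [^] k \<in> N"
proof -
  obtain D where D: "finite D" "D \<subseteq> carrier G" "\<And>x. x \<in> carrier G \<Longrightarrow> \<exists>n\<in>N. \<exists>d\<in>D. x = n \<otimes> d"
    by (rule two_ended_infinite_subgroup_cover[OF fg two N]) blast
  have "\<exists>d. d \<in> D \<and> (\<exists>n\<in>N. p [^] i = n \<otimes> d)" for i :: nat using D(3)[of "p [^] i"] p by auto
  then obtain d where d: "\<And>i::nat. d i \<in> D \<and> (\<exists>n\<in>N. p [^] i = n \<otimes> d i)" by metis
  have "finite (range d)" using d D(1) by (meson finite_subset image_subsetI)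
  then have "\<not> inj d" using finite_imageD infinite_UNIV_nat by blast
  then obtain i j where ij: "i < j" "d i = d j" by (metis injI linorder_neqE_nat)
  obtain m n where mn: "m \<in> N" "n \<in> N" "p [^] i = m \<otimes> d i" "p [^] j = n \<otimes> d i"
    using d[of i] d[of j] ij(2) by auto
  have G: "m \<in> carrier G" "n \<in> carrier G" "d i \<in> carrier G"
    using mn subgroup.subset[OF N(1)] d D(2) by blast+
  have "p [^] (j - i) = p [^] j \<otimes> inv (p [^] i)"
    using nat_pow_mult[OF p, of "j - i" i] ij(1) p by (simp add: inv_solve_right)
  also have "\<dots> = n \<otimes> inv m" using G by (simp add: mn inv_mult_group m_assoc[symmetric]) (simp add: m_assoc)
  finally have "p [^] (j - i) \<in> N"
    using mn N(1) by (simp add: subgroup.m_closed subgroup.m_inv_closed)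
  then show ?thesis using that[of "j - i"] ij(1) by simp
qed

end

section \<open>Graph products\<close>

lemma commute_of_commutator_one:
  assumes "group H" "x \<in> carrier H" "y \<in> carrier H"
  shows "commutator H x y = \<one>\<^bsub>H\<^esub> \<longleftrightarrow> x \<otimes>\<^bsub>H\<^esub> y = y \<otimes>\<^bsub>H\<^esub> x"
proof -
  interpret H: group H by fact
  have "commutator H x y = x \<otimes>\<^bsub>H\<^esub> y \<otimes>\<^bsub>H\<^esub> inv\<^bsub>H\<^esub> (y \<otimes>\<^bsub>H\<^esub> x)"
    using assms by (simp add: commutator_def H.inv_mult_group H.m_assoc)
  then show ?thesis
    using assms by (metis H.inv_solve_right' H.l_one H.m_closed H.one_closed)
qed

lemma hom_commutator:
  assumes "group_hom H K h" "x \<in> carrier H" "y \<in> carrier H"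
  shows "h (commutator H x y) = commutator K (h x) (h y)"
proof -
  interpret group_hom H K h by fact
  show ?thesis using assms(2,3) by (simp add: commutator_def)
qed

locale graph_of_groups =
  fixes \<Gamma> :: "'v sgraph" and G :: "'v \<Rightarrow> ('a, 'b) monoid_scheme"
  assumes simplicial: "simplicial_graph \<Gamma>"
    and groups: "\<And>v. v \<in> verts \<Gamma> \<Longrightarrow> group (G v)"
begin

abbreviation V where "V \<equiv> verts \<Gamma>"
abbreviation F where "F \<equiv> free_product V G"
abbreviation P where "P \<equiv> graph_product \<Gamma> G"

lemma edge_verts: "{u, w} \<in> edges \<Gamma> \<Longrightarrow> u \<in> V \<and> w \<in> V \<and> u \<noteq> w"
  using simplicial unfolding simplicial_graph_def by (metis card_2_iff doubleton_eq_iff insert_subset)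

sublocale F: group F
  by (rule group_free_product) (rule groups)

sublocale P: group P
  by (rule group_graph_product[OF simplicial groups])

lemma incl_closed: "v \<in> V \<Longrightarrow> g \<in> carrier (G v) \<Longrightarrow> fp_incl V G v g \<in> carrier F"
  by (rule fp_incl_closed[of V G, OF groups])

lemma class_mult:
  "xs \<in> fp_words V G \<Longrightarrow> ys \<in> fp_words V G \<Longrightarrow>
    fp_rel V G `` {xs} \<otimes>\<^bsub>F\<^esub> fp_rel V G `` {ys} = fp_rel V G `` {xs @ ys}"
  by (rule free_product_mult[of V G, OF groups])

lemma hom_incl: "v \<in> V \<Longrightarrow> fp_incl V G v \<in> hom (G v) F"
proof (rule homI)
  fix g h assume v: "v \<in> V" and gh: "g \<in> carrier (G v)" "h \<in> carrier (G v)"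
  have "fp_incl V G v g \<otimes>\<^bsub>F\<^esub> fp_incl V G v h = fp_rel V G `` {[(v, g), (v, h)]}"
    unfolding fp_incl_def using v gh
    by (subst class_mult) (auto simp: fp_words_def)
  also have "\<dots> = fp_incl V G v (g \<otimes>\<^bsub>G v\<^esub> h)"
    unfolding fp_incl_def by (intro equiv_class_eq[OF equiv_fp_rel[OF groups]] fp_mult v gh)
  finally show "fp_incl V G v (g \<otimes>\<^bsub>G v\<^esub> h) = fp_incl V G v g \<otimes>\<^bsub>F\<^esub> fp_incl V G v h" by simp
qed (rule incl_closed)

definition M where "M = normal_closure F (graph_product_relators \<Gamma> G)"

lemma relators_subset: "graph_product_relators \<Gamma> G \<subseteq> carrier F"
proof -
  have "commutator F (fp_incl V G u g) (fp_incl V G w h) \<in> carrier F"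
    if "{u, w} \<in> edges \<Gamma>" "g \<in> carrier (G u)" "h \<in> carrier (G w)" for u w g h
  proof -
    have "u \<in> V" "w \<in> V" using edge_verts that(1) by auto
    then have "fp_incl V G u g \<in> carrier F" "fp_incl V G w h \<in> carrier F"
      using that incl_closed by auto
    then show ?thesis by (simp add: commutator_def)
  qed
  then show ?thesis unfolding graph_product_relators_def by blast
qed

lemma M_normal: "M \<lhd> F"
  unfolding M_def by (rule normal_normal_closure[OF F.group_axioms relators_subset])

lemma P_eq: "P = F Mod M"
  by (simp add: graph_product_def M_def)

lemma hom_quotient: "(\<lambda>x. M #>\<^bsub>F\<^esub> x) \<in> hom F P"
  unfolding P_eq by (rule normal.r_coset_hom_Mod[OF M_normal])

definition \<iota> where "\<iota> v g = M #>\<^bsub>F\<^esub> fp_incl V G v g"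

lemma hom_\<iota>: "v \<in> V \<Longrightarrow> \<iota> v \<in> hom (G v) P"
proof -
  have "\<iota> v = (\<lambda>x. M #>\<^bsub>F\<^esub> x) \<circ> fp_incl V G v" by (simp add: fun_eq_iff \<iota>_def)
  then show "v \<in> V \<Longrightarrow> \<iota> v \<in> hom (G v) P" using hom_compose[OF hom_incl hom_quotient] by simp
qed

lemma \<iota>_hom: "v \<in> V \<Longrightarrow> group_hom (G v) P (\<iota> v)"
  by (simp add: group_hom_def group_hom_axioms_def groups hom_\<iota>)

lemma \<iota>_closed: "v \<in> V \<Longrightarrow> g \<in> carrier (G v) \<Longrightarrow> \<iota> v g \<in> carrier P"
  using hom_\<iota> by (auto simp: hom_def)

lemma \<iota>_mult: "v \<in> V \<Longrightarrow> g \<in> carrier (G v) \<Longrightarrow> h \<in> carrier (G v) \<Longrightarrow>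
    \<iota> v (g \<otimes>\<^bsub>G v\<^esub> h) = \<iota> v g \<otimes>\<^bsub>P\<^esub> \<iota> v h"
  using hom_\<iota> by (auto simp: hom_def)

lemma \<iota>_one: "v \<in> V \<Longrightarrow> \<iota> v \<one>\<^bsub>G v\<^esub> = \<one>\<^bsub>P\<^esub>"
  using group_hom.hom_one[OF \<iota>_hom] by simp

lemma \<iota>_inv: "v \<in> V \<Longrightarrow> g \<in> carrier (G v) \<Longrightarrow> \<iota> v (inv\<^bsub>G v\<^esub> g) = inv\<^bsub>P\<^esub> \<iota> v g"
  using group_hom.hom_inv[OF \<iota>_hom] by simp

lemma \<iota>_commute:
  assumes e: "{u, w} \<in> edges \<Gamma>" and g: "g \<in> carrier (G u)" and h: "h \<in> carrier (G w)"
  shows "\<iota> u g \<otimes>\<^bsub>P\<^esub> \<iota> w h = \<iota> w h \<otimes>\<^bsub>P\<^esub> \<iota> u g"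
proof -
  have uw: "u \<in> V" "w \<in> V" using edge_verts[OF e] by auto
  let ?c = "commutator F (fp_incl V G u g) (fp_incl V G w h)"
  have "?c \<in> graph_product_relators \<Gamma> G"
    unfolding graph_product_relators_def using e g h by blast
  then have "?c \<in> M" unfolding M_def normal_closure_def by blast
  then have "M #>\<^bsub>F\<^esub> ?c = \<one>\<^bsub>P\<^esub>"
    using F.coset_join2[of ?c M] normal_imp_subgroup[OF M_normal] relators_subset
      \<open>?c \<in> graph_product_relators \<Gamma> G\<close> by (auto simp: P_eq)
  moreover have "group_hom F P (\<lambda>x. M #>\<^bsub>F\<^esub> x)"
    by (simp add: group_hom_def group_hom_axioms_def hom_quotient)
  ultimately have "commutator P (\<iota> u g) (\<iota> w h) = \<one>\<^bsub>P\<^esub>"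
    unfolding \<iota>_def using hom_commutator incl_closed uw g h by metis
  then show ?thesis
    using commute_of_commutator_one[OF P.group_axioms \<iota>_closed[OF uw(1) g] \<iota>_closed[OF uw(2) h]]
    by simp
qed

lemma generate_\<iota>: "generate P (\<Union>v\<in>V. \<iota> v ` carrier (G v)) = carrier P"
proof
  let ?S = "\<Union>v\<in>V. \<iota> v ` carrier (G v)"
  have S: "?S \<subseteq> carrier P" using \<iota>_closed by blast
  show "generate P ?S \<subseteq> carrier P" by (rule P.generate_incl[OF S])
  have gen: "subgroup (generate P ?S) P" by (rule P.generate_is_subgroup[OF S])
  have word: "M #>\<^bsub>F\<^esub> (fp_rel V G `` {xs}) \<in> generate P ?S" if "xs \<in> fp_words V G" for xs
    using that
  proof (induction xs)
    case Nil
    have "fp_rel V G `` {[]} = \<one>\<^bsub>F\<^esub>" by (simp add: free_product_def)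
    then show ?case
      using hom_one[OF hom_quotient F.group_axioms P.group_axioms] by (simp add: generate.one)
  next
    case (Cons x xs)
    obtain v g where x: "x = (v, g)" by fastforce
    with Cons.prems have vg: "v \<in> V" "g \<in> carrier (G v)" and xs: "xs \<in> fp_words V G"
      by (auto simp: fp_words_def)
    have cl: "fp_rel V G `` {xs} \<in> carrier F"
      using xs by (simp add: free_product_def quotientI)
    have "fp_rel V G `` {x # xs} = fp_incl V G v g \<otimes>\<^bsub>F\<^esub> fp_rel V G `` {xs}"
      unfolding fp_incl_def using vg xs x
      by (subst class_mult) (auto simp: fp_words_def)
    then have "M #>\<^bsub>F\<^esub> (fp_rel V G `` {x # xs}) = \<iota> v g \<otimes>\<^bsub>P\<^esub> (M #>\<^bsub>F\<^esub> (fp_rel V G `` {xs}))"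
      unfolding \<iota>_def using hom_mult[OF hom_quotient incl_closed cl] vg by simp
    moreover have "\<iota> v g \<in> generate P ?S" using vg by (intro generate.incl) blast
    ultimately show ?case using Cons.IH[OF xs] subgroup.m_closed[OF gen] by simp
  qed
  show "carrier P \<subseteq> generate P ?S"
  proof
    fix x assume "x \<in> carrier P"
    then obtain y where y: "y \<in> carrier F" "x = M #>\<^bsub>F\<^esub> y" by (auto simp: P_eq carrier_FactGroup)
    then obtain xs where "xs \<in> fp_words V G" "y = fp_rel V G `` {xs}"
      by (auto simp: free_product_def quotient_def)
    with word y show "x \<in> generate P ?S" by simp
  qed
qed

text \<open>There is no case for inverses, since the inverse of a letter from a vertex group is
  again such a letter.\<close>

lemma P_induct [consumes 1, case_names one step]:
  assumes "x \<in> carrier P"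
    and one: "Q \<one>\<^bsub>P\<^esub>"
    and step: "\<And>v g x. v \<in> V \<Longrightarrow> g \<in> carrier (G v) \<Longrightarrow> x \<in> carrier P \<Longrightarrow> Q x \<Longrightarrow> Q (\<iota> v g \<otimes>\<^bsub>P\<^esub> x)"
  shows "Q x"
proof -
  let ?S = "\<Union>v\<in>V. \<iota> v ` carrier (G v)"
  have S: "?S \<subseteq> carrier P" using \<iota>_closed by blast
  \<comment> \<open>The induction over \<open>generate\<close> multiplies arbitrary elements, so the
    claim is that left multiplication by \<open>x\<close> preserves \<open>Q\<close>; this
    composes.\<close>
  have "\<forall>y\<in>carrier P. Q y \<longrightarrow> Q (x \<otimes>\<^bsub>P\<^esub> y)" if "x \<in> generate P ?S" for x
    using that
  proof induction
    case (incl h)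
    then show ?case using step by blast
  next
    case (inv h)
    then obtain v g where vg: "v \<in> V" "g \<in> carrier (G v)" "h = \<iota> v g" by blast
    interpret Gv: group "G v" by (rule groups) (rule vg)
    have "inv\<^bsub>P\<^esub> h = \<iota> v (inv\<^bsub>G v\<^esub> g)" using \<iota>_inv vg by simp
    then show ?case using step[OF vg(1), of "inv\<^bsub>G v\<^esub> g"] vg(2) by simp
  next
    case (eng h1 h2)
    then have "h1 \<in> carrier P" "h2 \<in> carrier P" using generate_\<iota> by auto
    then show ?case using eng.IH by (simp add: P.m_assoc)
  qed simp
  then have "\<forall>y\<in>carrier P. Q y \<longrightarrow> Q (x \<otimes>\<^bsub>P\<^esub> y)" using assms(1) unfolding generate_\<iota> .
  then have "Q (x \<otimes>\<^bsub>P\<^esub> \<one>\<^bsub>P\<^esub>)" using one P.one_closed by blast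
  then show ?thesis using assms(1) by simp
qed

text \<open>The source of the projections, the action on alternating words and the reflections of
  the integers.\<close>

lemma P_universal:
  assumes "group H" and f: "\<And>v. v \<in> V \<Longrightarrow> f v \<in> hom (G v) H"
    and comm: "\<And>u w g h. {u, w} \<in> edges \<Gamma> \<Longrightarrow> g \<in> carrier (G u) \<Longrightarrow> h \<in> carrier (G w) \<Longrightarrow>
      f u g \<otimes>\<^bsub>H\<^esub> f w h = f w h \<otimes>\<^bsub>H\<^esub> f u g"
  obtains \<psi> where "\<psi> \<in> hom P H" "\<And>v g. v \<in> V \<Longrightarrow> g \<in> carrier (G v) \<Longrightarrow> \<psi> (\<iota> v g) = f v g"
proof -
  interpret H: group H by fact
  \<comment> \<open>The start value \<open>r\<close> is kept variable: invariance under
    \<open>fp_rel\<close> for every \<open>r\<close> survives concatenation on either side.\<close>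
  define ev where "ev = foldr (\<lambda>(v, g) r. f v g \<otimes>\<^bsub>H\<^esub> r)"
  have fH: "f v g \<in> carrier H" if "v \<in> V" "g \<in> carrier (G v)" for v g
    using f[OF that(1)] that(2) by (auto simp: hom_def)
  have ev_closed: "ev xs r \<in> carrier H" if "xs \<in> fp_words V G" "r \<in> carrier H" for xs r
    using that by (induction xs) (auto simp: ev_def fp_words_def fH)
  have ev_rel: "\<forall>r\<in>carrier H. ev xs r = ev ys r" if "(xs, ys) \<in> fp_rel V G" for xs ys
    using that
  proof induction
    case (fp_append xs xs' ys ys')
    then show ?case
      using fp_rel_words[OF groups fp_append.hyps(2)] ev_closed by (auto simp: ev_def)
  next
    case (fp_one v)
    then show ?case using hom_one[OF f[OF fp_one] groups[OF fp_one] H.group_axioms] by (simp add: ev_def)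
  next
    case (fp_mult v g h)
    then show ?case using hom_mult[OF f[OF fp_mult(1)]] fH by (simp add: ev_def H.m_assoc)
  qed (auto simp: ev_def)
  have ev_app: "ev (xs @ ys) \<one>\<^bsub>H\<^esub> = ev xs \<one>\<^bsub>H\<^esub> \<otimes>\<^bsub>H\<^esub> ev ys \<one>\<^bsub>H\<^esub>"
    if "xs \<in> fp_words V G" "ys \<in> fp_words V G" for xs ys
    using that(1)
  proof (induction xs)
    case Nil
    then show ?case using ev_closed[OF that(2)] by (simp add: ev_def)
  next
    case (Cons x xs)
    obtain v g where x: "x = (v, g)" by fastforce
    with Cons.prems have vg: "v \<in> V" "g \<in> carrier (G v)" and xs: "xs \<in> fp_words V G"
      by (auto simp: fp_words_def)
    have "ev (x # zs) \<one>\<^bsub>H\<^esub> = f v g \<otimes>\<^bsub>H\<^esub> ev zs \<one>\<^bsub>H\<^esub>" for zs by (simp add: ev_def x)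
    then show ?case
      using Cons.IH[OF xs] fH[OF vg] ev_closed[OF xs] ev_closed[OF that(2)] by (simp add: H.m_assoc)
  qed
  define \<phi> where "\<phi> X = ev (SOME xs. xs \<in> X) \<one>\<^bsub>H\<^esub>" for X
  have \<phi>: "\<phi> (fp_rel V G `` {xs}) = ev xs \<one>\<^bsub>H\<^esub>" if "xs \<in> fp_words V G" for xs
  proof -
    have "xs \<in> fp_rel V G `` {xs}" using that by (simp add: fp_refl)
    then have "(SOME ys. ys \<in> fp_rel V G `` {xs}) \<in> fp_rel V G `` {xs}" by (rule someI)
    then show ?thesis using ev_rel unfolding \<phi>_def by force
  qed
  have carF: "\<exists>xs\<in>fp_words V G. X = fp_rel V G `` {xs}" if "X \<in> carrier F" for X
    using that by (auto simp: free_product_def quotient_def)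
  have hom: "\<phi> \<in> hom F H"
  proof (rule homI)
    fix X assume "X \<in> carrier F"
    then show "\<phi> X \<in> carrier H" using carF \<phi> ev_closed by (metis H.one_closed)
  next
    fix X Y assume "X \<in> carrier F" "Y \<in> carrier F"
    then obtain xs ys where xs: "xs \<in> fp_words V G" "X = fp_rel V G `` {xs}"
      and ys: "ys \<in> fp_words V G" "Y = fp_rel V G `` {ys}" using carF by metis
    have app: "xs @ ys \<in> fp_words V G" using xs ys by (auto simp: fp_words_def)
    show "\<phi> (X \<otimes>\<^bsub>F\<^esub> Y) = \<phi> X \<otimes>\<^bsub>H\<^esub> \<phi> Y"
      unfolding xs(2) ys(2) class_mult[OF xs(1) ys(1)] \<phi>[OF xs(1)] \<phi>[OF ys(1)] \<phi>[OF app]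
      by (rule ev_app[OF xs(1) ys(1)])
  qed
  then interpret \<phi>: group_hom F H \<phi>
    by (simp add: group_hom_def group_hom_axioms_def H.group_axioms F.group_axioms)
  have \<phi>_incl: "\<phi> (fp_incl V G v g) = f v g" if "v \<in> V" "g \<in> carrier (G v)" for v g
  proof -
    have "[(v, g)] \<in> fp_words V G" using that by (simp add: fp_words_def)
    then show ?thesis using fH[OF that] by (simp add: fp_incl_def \<phi> ev_def)
  qed
  have "graph_product_relators \<Gamma> G \<subseteq> kernel F H \<phi>"
  proof
    fix c assume "c \<in> graph_product_relators \<Gamma> G"
    then obtain u w g h where e: "{u, w} \<in> edges \<Gamma>" "g \<in> carrier (G u)" "h \<in> carrier (G w)"
      and c: "c = commutator F (fp_incl V G u g) (fp_incl V G w h)"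
      unfolding graph_product_relators_def by blast
    have "c \<in> carrier F" using \<open>c \<in> graph_product_relators \<Gamma> G\<close> relators_subset by (rule rev_subsetD)
    have uw: "u \<in> V" "w \<in> V" using edge_verts[OF e(1)] by auto
    have "\<phi> c = commutator H (f u g) (f w h)"
      unfolding c using uw e incl_closed
      by (simp add: hom_commutator[OF \<phi>.group_hom_axioms] \<phi>_incl)
    also have "\<dots> = \<one>\<^bsub>H\<^esub>"
      using commute_of_commutator_one[OF H.group_axioms fH[OF uw(1) e(2)] fH[OF uw(2) e(3)]] comm[OF e]
      by simp
    finally show "c \<in> kernel F H \<phi>" using \<open>c \<in> carrier F\<close> by (simp add: kernel_def)
  qed
  then have MK: "M \<subseteq> kernel F H \<phi>"
    unfolding M_def normal_closure_def using \<phi>.normal_kernel by blast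
  have eq: "\<phi> x = \<phi> y"
    if x: "x \<in> carrier F" and y: "y \<in> carrier F" and xy: "M #>\<^bsub>F\<^esub> x = M #>\<^bsub>F\<^esub> y" for x y
  proof -
    have "x \<in> M #>\<^bsub>F\<^esub> x"
      using F.rcos_self[OF x] normal_imp_subgroup[OF M_normal] by simp
    then have "x \<in> M #>\<^bsub>F\<^esub> y" unfolding xy .
    then obtain m where "m \<in> M" "x = m \<otimes>\<^bsub>F\<^esub> y" by (auto simp: r_coset_def)
    moreover from this have "m \<in> carrier F" "\<phi> m = \<one>\<^bsub>H\<^esub>" using MK by (auto simp: kernel_def)
    ultimately show ?thesis using y by simp
  qed
  obtain \<psi> where
    \<psi>: "\<psi> \<in> hom (F Mod M) H" "\<And>x. x \<in> carrier F \<Longrightarrow> \<psi> (M #>\<^bsub>F\<^esub> x) = \<phi> x"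
    using FactGroup_universal[OF hom M_normal eq] by blast
  show ?thesis
  proof (rule that)
    show "\<psi> \<in> hom P H" using \<psi>(1) by (simp add: P_eq)
    show "\<psi> (\<iota> v g) = f v g" if "v \<in> V" "g \<in> carrier (G v)" for v g
      using \<psi>(2)[OF incl_closed] that by (simp add: \<iota>_def \<phi>_incl)
  qed
qed

text \<open>Sending the other vertex groups to the unit respects the relations because the ends of
  an edge are distinct. Being a retraction, it shows that \<open>\<iota> v\<close> is
  injective.\<close>

lemma projection:
  assumes v: "v \<in> V"
  obtains \<pi> where "group_hom P (G v) \<pi>" "\<And>g. g \<in> carrier (G v) \<Longrightarrow> \<pi> (\<iota> v g) = g"
    "\<And>w g. w \<in> V \<Longrightarrow> w \<noteq> v \<Longrightarrow> g \<in> carrier (G w) \<Longrightarrow> \<pi> (\<iota> w g) = \<one>\<^bsub>G v\<^esub>"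
proof -
  interpret Gv: group "G v" by (rule groups[OF v])
  obtain \<pi> where \<pi>: "\<pi> \<in> hom P (G v)"
    "\<And>w g. w \<in> V \<Longrightarrow> g \<in> carrier (G w) \<Longrightarrow> \<pi> (\<iota> w g) = (if w = v then g else \<one>\<^bsub>G v\<^esub>)"
  proof (rule P_universal[OF Gv.group_axioms, of "\<lambda>w g. if w = v then g else \<one>\<^bsub>G v\<^esub>"])
    show "(\<lambda>g. if w = v then g else \<one>\<^bsub>G v\<^esub>) \<in> hom (G w) (G v)" for w
      by (cases "w = v") (auto simp: hom_def)
    fix u w g h
    assume "{u, w} \<in> edges \<Gamma>" "g \<in> carrier (G u)" "h \<in> carrier (G w)"
    then show "(if u = v then g else \<one>\<^bsub>G v\<^esub>) \<otimes>\<^bsub>G v\<^esub> (if w = v then h else \<one>\<^bsub>G v\<^esub>) =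
        (if w = v then h else \<one>\<^bsub>G v\<^esub>) \<otimes>\<^bsub>G v\<^esub> (if u = v then g else \<one>\<^bsub>G v\<^esub>)"
      using edge_verts[of u w] by auto
  qed blast
  show ?thesis
    by (rule that[of \<pi>]) (use \<pi> v in \<open>auto simp: group_hom_def group_hom_axioms_def Gv.group_axioms\<close>)
qed

lemma inj_\<iota>: "v \<in> V \<Longrightarrow> inj_on (\<iota> v) (carrier (G v))"
  by (rule projection, assumption) (metis inj_onI)

end

subsection \<open>Action on alternating words\<close>

definition bij_group :: "('x \<Rightarrow> 'x) monoid" where
  "bij_group = \<lparr>carrier = {f. bij f}, monoid.mult = (\<circ>), one = id\<rparr>"

lemma group_bij_group: "group bij_group"
proof (rule groupI)
  fix f :: "'x \<Rightarrow> 'x" assume "f \<in> carrier bij_group"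
  then have "bij f" by (simp add: bij_group_def)
  then show "\<exists>g\<in>carrier bij_group. g \<otimes>\<^bsub>bij_group\<^esub> f = \<one>\<^bsub>bij_group\<^esub>"
    unfolding bij_group_def
    by (intro bexI[of _ "inv_into UNIV f"]) (auto simp: bij_is_inj bij_imp_bij_inv)
qed (auto simp: bij_group_def bij_comp)

text \<open>Bijectivity comes for free, as \<open>f (inv g)\<close> is a two-sided inverse of
  \<open>f g\<close>.\<close>

lemma (in group) hom_bij_groupI:
  assumes "f \<one> = id" and mult: "\<And>g h. g \<in> carrier G \<Longrightarrow> h \<in> carrier G \<Longrightarrow> f (g \<otimes> h) = f g \<circ> f h"
  shows "f \<in> hom G bij_group"
proof (rule homI)
  fix g assume g: "g \<in> carrier G"
  then have "f g \<circ> f (inv g) = id" "f (inv g) \<circ> f g = id"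
    using mult[of g "inv g"] mult[of "inv g" g] assms(1) by auto
  then show "f g \<in> carrier bij_group" by (auto simp: bij_group_def intro: o_bij)
qed (simp add: mult bij_group_def)

context graph_of_groups
begin

text \<open>
  Alternating words in the vertex groups of \<open>U\<close> are the normal forms of their free product. A vertex
  group acts by multiplication on the first letter, where a word not starting with a letter from
  this group is thought of as having the unit in front.
\<close>

primrec alternating :: "'v set \<Rightarrow> ('v \<times> 'a) list \<Rightarrow> bool" where
  "alternating U [] \<longleftrightarrow> True"
| "alternating U (x # w) \<longleftrightarrow> fst x \<in> U \<and> snd x \<in> carrier (G (fst x)) \<and> snd x \<noteq> \<one>\<^bsub>G (fst x)\<^esub> \<and>
     (w = [] \<or> fst (hd w) \<noteq> fst x) \<and> alternating U w"

definition head :: "'v \<Rightarrow> ('v \<times> 'a) list \<Rightarrow> 'a" where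
  "head v w = (if w \<noteq> [] \<and> fst (hd w) = v then snd (hd w) else \<one>\<^bsub>G v\<^esub>)"

definition rest :: "'v \<Rightarrow> ('v \<times> 'a) list \<Rightarrow> ('v \<times> 'a) list" where
  "rest v w = (if w \<noteq> [] \<and> fst (hd w) = v then tl w else w)"

definition put :: "'v \<Rightarrow> 'a \<Rightarrow> ('v \<times> 'a) list \<Rightarrow> ('v \<times> 'a) list" where
  "put v g w = (if g = \<one>\<^bsub>G v\<^esub> then w else (v, g) # w)"

text \<open>Lists that are not alternating are fixed, which makes this a permutation of the whole
  list type.\<close>

definition act :: "'v set \<Rightarrow> 'v \<Rightarrow> 'a \<Rightarrow> ('v \<times> 'a) list \<Rightarrow> ('v \<times> 'a) list" where
  "act U v g w = (if alternating U w then put v (g \<otimes>\<^bsub>G v\<^esub> head v w) (rest v w) else w)"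

lemma head_closed: "v \<in> V \<Longrightarrow> alternating U w \<Longrightarrow> head v w \<in> carrier (G v)"
  using group.is_monoid[OF groups, of v] by (cases w) (auto simp: head_def)

lemma rest_alternating:
  "alternating U w \<Longrightarrow> alternating U (rest v w) \<and> (rest v w = [] \<or> fst (hd (rest v w)) \<noteq> v)"
  by (cases w) (auto simp: rest_def)

lemma put_alternating:
  assumes "v \<in> U" "g \<in> carrier (G v)" "alternating U w" "w = [] \<or> fst (hd w) \<noteq> v"
  shows "alternating U (put v g w)" "head v (put v g w) = g" "rest v (put v g w) = w"
  using assms by (auto simp: put_def head_def rest_def)

lemma put_head_rest: "alternating U w \<Longrightarrow> put v (head v w) (rest v w) = w"
  by (cases w) (auto simp: put_def head_def rest_def)

text \<open>A word corresponds to its head at \<open>v\<close> together with the rest, and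
  \<open>put\<close> inverts this decomposition. On the head the action is left multiplication in
  \<open>G v\<close>.\<close>

lemma act_hom:
  assumes "v \<in> U" "v \<in> V"
  shows "act U v \<in> hom (G v) bij_group"
proof -
  interpret group "G v" by (rule groups) fact
  show ?thesis
  proof (rule hom_bij_groupI)
    show "act U v \<one>\<^bsub>G v\<^esub> = id"
      using put_head_rest head_closed[OF assms(2)] by (auto simp: act_def fun_eq_iff)
    fix g h assume gh: "g \<in> carrier (G v)" "h \<in> carrier (G v)"
    have "act U v (g \<otimes>\<^bsub>G v\<^esub> h) w = act U v g (act U v h w)" for w
    proof (cases "alternating U w")
      case True
      have "h \<otimes>\<^bsub>G v\<^esub> head v w \<in> carrier (G v)" using head_closed[OF assms(2) True] gh by simp
      with True rest_alternating[OF True, of v] show ?thesis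
        using gh head_closed[OF assms(2) True]
        by (simp add: act_def put_alternating[OF assms(1)] m_assoc)
    qed (simp add: act_def)
    then show "act U v (g \<otimes>\<^bsub>G v\<^esub> h) = act U v g \<circ> act U v h" by (simp add: fun_eq_iff)
  qed
qed

text \<open>Two vertices of \<open>U\<close> are never adjacent, so in each commutation relation at
  least one of the two factors acts as the identity.\<close>

lemma alternating_action:
  assumes U: "U \<subseteq> V" "\<And>u w. u \<in> U \<Longrightarrow> w \<in> U \<Longrightarrow> {u, w} \<notin> edges \<Gamma>"
  shows "\<exists>\<rho>. group_hom P bij_group \<rho> \<and>
    (\<forall>v\<in>U. \<forall>g\<in>carrier (G v). \<rho> (\<iota> v g) = act U v g) \<and>
    (\<forall>v\<in>V - U. \<forall>g\<in>carrier (G v). \<rho> (\<iota> v g) = id)"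
proof -
  obtain \<rho> where \<rho>: "\<rho> \<in> hom P (bij_group :: (('v \<times> 'a) list \<Rightarrow> _) monoid)"
    "\<And>v g. v \<in> V \<Longrightarrow> g \<in> carrier (G v) \<Longrightarrow> \<rho> (\<iota> v g) = (if v \<in> U then act U v g else id)"
  proof (rule P_universal[OF group_bij_group, of "\<lambda>v g. if v \<in> U then act U v g else id"])
    fix v assume v: "v \<in> V"
    interpret Gv: group "G v" by (rule groups[OF v])
    show "(\<lambda>g. if v \<in> U then act U v g else id) \<in> hom (G v) bij_group"
      using act_hom[of v U] v Gv.hom_bij_groupI[of "\<lambda>_. id"] by (cases "v \<in> U") auto
  next
    fix u w g h assume "{u, w} \<in> edges \<Gamma>"
    then have "u \<notin> U \<or> w \<notin> U" using U(2) by blast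
    then show "(if u \<in> U then act U u g else id) \<otimes>\<^bsub>bij_group\<^esub> (if w \<in> U then act U w h else id) =
       (if w \<in> U then act U w h else id) \<otimes>\<^bsub>bij_group\<^esub> (if u \<in> U then act U u g else id)"
      by (auto simp: bij_group_def)
  qed blast
  show ?thesis
    by (rule exI[of _ \<rho>])
      (use \<rho> U(1) in \<open>auto simp: group_hom_def group_hom_axioms_def group_bij_group\<close>)
qed

text \<open>Each factor prepends two letters to a word that is empty or starts with a letter from
  \<open>G a\<close>, and nothing cancels. The first letter is recorded because it later tells
  \<open>x\<close> from other elements of \<open>G a\<close>.\<close>

lemma alternating_power:
  assumes \<rho>: "group_hom P bij_group \<rho>"
    "\<And>v g. v \<in> U \<Longrightarrow> g \<in> carrier (G v) \<Longrightarrow> \<rho> (\<iota> v g) = act U v g"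
    and U: "U \<subseteq> V" and ab: "a \<in> U" "b \<in> U" "a \<noteq> b"
    and x: "x \<in> carrier (G a)" "x \<noteq> \<one>\<^bsub>G a\<^esub>" and y: "y \<in> carrier (G b)" "y \<noteq> \<one>\<^bsub>G b\<^esub>"
    and n: "n > 0"
  shows "\<exists>w. \<rho> ((\<iota> a x \<otimes>\<^bsub>P\<^esub> \<iota> b y) [^]\<^bsub>P\<^esub> (n::nat)) [] = (a, x) # w"
proof -
  interpret \<rho>: group_hom P bij_group \<rho> by fact
  interpret Ga: group "G a" using groups ab U by auto
  interpret Gb: group "G b" using groups ab U by auto
  let ?u = "\<iota> a x \<otimes>\<^bsub>P\<^esub> \<iota> b y"
  have cl: "\<iota> a x \<in> carrier P" "\<iota> b y \<in> carrier P" using \<iota>_closed U ab x y by auto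
  have comp: "\<rho> (p \<otimes>\<^bsub>P\<^esub> q) w = \<rho> p (\<rho> q w)" if "p \<in> carrier P" "q \<in> carrier P" for p q w
    using \<rho>.hom_mult[OF that] by (simp add: bij_group_def)
  have step: "\<rho> ?u w = (a, x) # (b, y) # w" if "alternating U w" "w = [] \<or> fst (hd w) = a" for w
  proof -
    have "\<rho> ?u w = act U a x (act U b y w)" using comp[OF cl, of w] \<rho>(2) x y ab by simp
    then show ?thesis using that x y ab by (auto simp: act_def put_def head_def rest_def)
  qed
  have "\<exists>w. \<rho> (?u [^]\<^bsub>P\<^esub> Suc n) [] = (a, x) # w \<and> alternating U ((a, x) # w)" for n
  proof (induction n)
    case 0
    then show ?case using step[of "[]"] x y ab cl by simp
  next
    case (Suc n)
    then obtain w where w: "\<rho> (?u [^]\<^bsub>P\<^esub> Suc n) [] = (a, x) # w" "alternating U ((a, x) # w)" by blast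
    have "\<rho> (?u [^]\<^bsub>P\<^esub> Suc (Suc n)) [] = \<rho> ?u (\<rho> (?u [^]\<^bsub>P\<^esub> Suc n) [])"
      using P.nat_pow_Suc2[of ?u "Suc n"] cl comp[of ?u "?u [^]\<^bsub>P\<^esub> Suc n"] by simp
    also have "\<dots> = (a, x) # (b, y) # (a, x) # w" using step w by simp
    finally show ?case using w(2) x y ab by simp
  qed
  then show ?thesis using n by (metis Suc_pred)
qed

end

section \<open>Commuting sets of generators, cyclic subgroups and finite generation\<close>

context group
begin

lemma commute_generate:
  assumes x: "x \<in> carrier G" and S: "S \<subseteq> carrier G"
    and comm: "\<And>s. s \<in> S \<Longrightarrow> x \<otimes> s = s \<otimes> x" and y: "y \<in> generate G S"
  shows "x \<otimes> y = y \<otimes> x"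
  using y
proof induction
  case (inv s)
  then have s: "s \<in> carrier G" using S by auto
  have "inv s \<otimes> x = inv s \<otimes> (x \<otimes> s) \<otimes> inv s" using s x by (simp add: m_assoc)
  also have "\<dots> = inv s \<otimes> (s \<otimes> x) \<otimes> inv s" using comm[OF inv] by simp
  also have "\<dots> = x \<otimes> inv s" using s x by (simp add: m_assoc[symmetric])
  finally show ?case by simp
next
  case (eng h1 h2)
  then have h: "h1 \<in> carrier G" "h2 \<in> carrier G" using S generate_in_carrier by auto
  have "x \<otimes> (h1 \<otimes> h2) = h1 \<otimes> x \<otimes> h2" using eng.IH(1) x h by (simp add: m_assoc[symmetric])
  also have "\<dots> = h1 \<otimes> h2 \<otimes> x" using eng.IH(2) x h by (simp add: m_assoc)
  finally show ?case .
qed (use x comm in auto)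

text \<open>Commuting passes from the generators to the generated subgroups, so the two kinds of
  factors can be sorted.\<close>

lemma generate_Un_commuting:
  assumes S: "S \<subseteq> carrier G" and T: "T \<subseteq> carrier G"
    and comm: "\<And>s t. s \<in> S \<Longrightarrow> t \<in> T \<Longrightarrow> s \<otimes> t = t \<otimes> s"
    and x: "x \<in> generate G (S \<union> T)"
  shows "\<exists>y\<in>generate G S. \<exists>z\<in>generate G T. x = y \<otimes> z"
proof -
  have cS: "y \<in> carrier G" if "y \<in> generate G S" for y using generate_in_carrier[OF S that] .
  have cT: "z \<in> carrier G" if "z \<in> generate G T" for z using generate_in_carrier[OF T that] .
  have c: "y \<otimes> z = z \<otimes> y" if y: "y \<in> generate G S" and z: "z \<in> generate G T" for y z
  proof (rule commute_generate[OF cS[OF y] T _ z])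
    fix t assume t: "t \<in> T"
    have "t \<otimes> y = y \<otimes> t" by (rule commute_generate[OF _ S _ y]) (use t T comm[OF _ t] in auto)
    then show "y \<otimes> t = t \<otimes> y" by simp
  qed
  have gS: "subgroup (generate G S) G" and gT: "subgroup (generate G T) G"
    by (rule generate_is_subgroup[OF S], rule generate_is_subgroup[OF T])
  show ?thesis
    using x
  proof induction
    case one
    show ?case by (intro bexI[OF _ generate.one]) simp
  next
    case (incl h)
    then have "h \<in> carrier G" using S T by blast
    then have "h = h \<otimes> \<one>" "h = \<one> \<otimes> h" by simp_all
    then show ?case using incl generate.one[of G] generate.incl[of h _ G] by blast
  next
    case (inv h)
    then have "h \<in> carrier G" using S T by blast
    then have "inv h = inv h \<otimes> \<one>" "inv h = \<one> \<otimes> inv h" by simp_all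
    then show ?case using inv generate.one[of G] generate.inv[of h _ G] by blast
  next
    case (eng h1 h2)
    then obtain y1 z1 y2 z2 where
      1: "y1 \<in> generate G S" "z1 \<in> generate G T" "h1 = y1 \<otimes> z1" and
      2: "y2 \<in> generate G S" "z2 \<in> generate G T" "h2 = y2 \<otimes> z2" by blast
    have "h1 \<otimes> h2 = y1 \<otimes> (z1 \<otimes> y2) \<otimes> z2"
      using 1 2 cS cT by (simp add: m_assoc)
    also have "\<dots> = y1 \<otimes> (y2 \<otimes> z1) \<otimes> z2" by (simp only: c[OF 2(1) 1(2)])
    also have "\<dots> = (y1 \<otimes> y2) \<otimes> (z1 \<otimes> z2)"
      using 1 2 cS cT by (simp add: m_assoc)
    finally show ?case
      by (intro bexI[OF _ generate.eng[OF 1(1) 2(1)]] bexI[OF _ generate.eng[OF 1(2) 2(2)]])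
  qed
qed

lemma infinite_range_int_pow:
  assumes u: "u \<in> carrier G" and "\<And>n::nat. n > 0 \<Longrightarrow> u [^] n \<noteq> \<one>"
  shows "inj (\<lambda>k::int. u [^] k)" "infinite (range (\<lambda>k::int. u [^] k))"
proof -
  have pow: "u [^] k \<noteq> \<one>" if "k > 0" for k :: int
    using assms(2)[of "nat k"] that int_pow_int[of G u "nat k"] by simp
  show "inj (\<lambda>k::int. u [^] k)"
  proof (rule injI)
    fix m n :: int assume eq: "u [^] m = u [^] n"
    have "u [^] (m - n) = \<one>" "u [^] (n - m) = \<one>" using u eq by (simp_all add: int_pow_diff)
    then show "m = n" using pow[of "m - n"] pow[of "n - m"] by linarith
  qed
  then show "infinite (range (\<lambda>k::int. u [^] k))"
    using finite_imageD infinite_UNIV_int by blast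
qed

lemma subgroup_range_int_pow: "u \<in> carrier G \<Longrightarrow> subgroup (range (\<lambda>k::int. u [^] k)) G"
  using generate_is_subgroup[of "{u}"] generate_pow[of u] by (simp add: full_SetCompr_eq)

end

lemma not_two_ended_finite:
  assumes "group G" "finitely_generated G" "finite (carrier G)"
  shows "\<not> two_ended G"
proof
  assume "two_ended G"
  then obtain \<A> where "card \<A> = 2" "\<And>A. A \<in> \<A> \<Longrightarrow> infinite A \<and> almost_invariant G A"
    using two_ended_iff[OF assms(1,2)] unfolding ends_at_least_def by blast
  then obtain A where "infinite A" "A \<subseteq> carrier G"
    unfolding almost_invariant_def by (metis card.empty ex_in_conv zero_neq_numeral)
  then show False using assms(3) finite_subset by blast
qed

lemma two_ended_finite_kernel:
  assumes "group_hom G H h" and fg: "finitely_generated G" "finitely_generated H"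
    and "finite (kernel G H h)" "h ` carrier G = carrier H"
  shows "two_ended G \<longleftrightarrow> two_ended H"
proof -
  interpret group_hom G H h by fact
  show ?thesis
    using two_ended_iff[OF G.group_axioms fg(1)] two_ended_iff[OF H.group_axioms fg(2)]
      ends_at_least_vimage[OF assms(4,5)] ends_at_least_image[OF assms(4,5)] by blast
qed

context graph_of_groups
begin

lemma finitely_generated_P:
  assumes "finite V" and "\<And>v. v \<in> V \<Longrightarrow> finitely_generated (G v)"
  shows "finitely_generated P"
proof -
  obtain S where S: "\<And>v. v \<in> V \<Longrightarrow> finite (S v) \<and> S v \<subseteq> carrier (G v) \<and> generate (G v) (S v) = carrier (G v)"
    using assms(2) unfolding finitely_generated_def finite_generating_set_def by metis
  define T where "T = (\<Union>v\<in>V. \<iota> v ` S v)"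
  have T: "T \<subseteq> carrier P" unfolding T_def using S \<iota>_closed by blast
  have "\<iota> v ` carrier (G v) \<subseteq> generate P T" if v: "v \<in> V" for v
  proof -
    have "generate P (\<iota> v ` S v) = \<iota> v ` carrier (G v)"
      using group_hom.generate_img[OF \<iota>_hom[OF v]] S[OF v] by simp
    moreover have "generate P (\<iota> v ` S v) \<subseteq> generate P T"
      by (rule P.mono_generate) (use v in \<open>auto simp: T_def\<close>)
    ultimately show ?thesis by simp
  qed
  then have "carrier P \<subseteq> generate P T"
    unfolding generate_\<iota>[symmetric]
    by (intro P.generate_subgroup_incl P.generate_is_subgroup T) blast
  then have "generate P T = carrier P" using P.generate_incl[OF T] by auto
  moreover have "finite T" unfolding T_def using assms(1) S by blast
  ultimately show ?thesis
    unfolding finitely_generated_def finite_generating_set_def using T by blast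
qed

definition gens_of :: "'v set \<Rightarrow> ('v \<times> 'a) list set set set" where
  "gens_of W = (\<Union>v\<in>W. \<iota> v ` carrier (G v))"

lemma gens_of_subset: "W \<subseteq> V \<Longrightarrow> gens_of W \<subseteq> carrier P"
  unfolding gens_of_def using \<iota>_closed by blast

lemma gens_of_commute:
  assumes "\<And>u w. u \<in> U \<Longrightarrow> w \<in> W \<Longrightarrow> {u, w} \<in> edges \<Gamma>" "s \<in> gens_of U" "t \<in> gens_of W"
  shows "s \<otimes>\<^bsub>P\<^esub> t = t \<otimes>\<^bsub>P\<^esub> s"
  using assms(2,3) \<iota>_commute[OF assms(1)] unfolding gens_of_def by blast

lemma generate_gens_of_singleton:
  assumes "v \<in> V"
  shows "generate P (gens_of {v}) = \<iota> v ` carrier (G v)"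
proof -
  interpret group_hom "G v" P "\<iota> v" by (rule \<iota>_hom[OF assms])
  have "generate (G v) (carrier (G v)) = carrier (G v)"
    by (rule subset_antisym[OF G.generate_incl[OF subset_refl]]) (rule subsetI, rule generate.incl)
  then show ?thesis
    using generate_img[OF subset_refl] by (simp add: gens_of_def)
qed

lemma finite_generate_gens_of:
  assumes "finite W" "W \<subseteq> V" and "\<And>w. w \<in> W \<Longrightarrow> finite (carrier (G w))"
    and "\<And>u w. u \<in> W \<Longrightarrow> w \<in> W \<Longrightarrow> u \<noteq> w \<Longrightarrow> {u, w} \<in> edges \<Gamma>"
  shows "finite (generate P (gens_of W))"
  using assms
proof (induction W)
  case empty
  then show ?case using P.generate_empty by (simp add: gens_of_def)
next
  case (insert v W)
  let ?A = "\<iota> v ` carrier (G v)" and ?B = "generate P (gens_of W)"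
  have "gens_of (insert v W) = gens_of {v} \<union> gens_of W" by (auto simp: gens_of_def)
  moreover have "s \<otimes>\<^bsub>P\<^esub> t = t \<otimes>\<^bsub>P\<^esub> s" if "s \<in> gens_of {v}" "t \<in> gens_of W" for s t
    by (rule gens_of_commute[OF _ that]) (use insert.prems(3) insert.hyps(2) in auto)
  moreover have "gens_of {v} \<subseteq> carrier P" "gens_of W \<subseteq> carrier P"
    using insert.prems(1) by (simp_all add: gens_of_subset)
  moreover have "generate P (gens_of {v}) = ?A"
    by (rule generate_gens_of_singleton) (use insert.prems(1) in simp)
  ultimately have "\<exists>y\<in>?A. \<exists>z\<in>?B. x = y \<otimes>\<^bsub>P\<^esub> z" if "x \<in> generate P (gens_of (insert v W))" for x
    using P.generate_Un_commuting[of "gens_of {v}" "gens_of W" x] that by metis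
  then have "generate P (gens_of (insert v W)) \<subseteq> (\<lambda>(y, z). y \<otimes>\<^bsub>P\<^esub> z) ` (?A \<times> ?B)" by force
  moreover have "finite (?A \<times> ?B)" using insert by auto
  ultimately show ?case using finite_surj by blast
qed

lemma P_decompose:
  assumes W: "W \<subseteq> V" "\<And>u w. u \<in> W \<Longrightarrow> w \<in> V - W \<Longrightarrow> {u, w} \<in> edges \<Gamma>" and x: "x \<in> carrier P"
  shows "\<exists>y\<in>generate P (gens_of W). \<exists>z\<in>generate P (gens_of (V - W)). x = y \<otimes>\<^bsub>P\<^esub> z"
proof (rule P.generate_Un_commuting)
  have "gens_of W \<union> gens_of (V - W) = (\<Union>v\<in>V. \<iota> v ` carrier (G v))"
    using W(1) by (auto simp: gens_of_def)
  then show "x \<in> generate P (gens_of W \<union> gens_of (V - W))" using x generate_\<iota> by simp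
  show "s \<otimes>\<^bsub>P\<^esub> t = t \<otimes>\<^bsub>P\<^esub> s" if "s \<in> gens_of W" "t \<in> gens_of (V - W)" for s t
    by (rule gens_of_commute[OF W(2) that])
qed (use W(1) in \<open>simp_all add: gens_of_subset\<close>)

subsection \<open>Complete graphs\<close>

text \<open>The kernel of the projection to \<open>G v\<close> is the subgroup generated by the
  other vertex groups. It is finite, because these are finite and commute pairwise.\<close>

lemma two_ended_complete_iff_vertex:
  assumes fin: "finite V" and fg: "\<And>v. v \<in> V \<Longrightarrow> finitely_generated (G v)"
    and complete: "\<And>u w. u \<in> V \<Longrightarrow> w \<in> V \<Longrightarrow> u \<noteq> w \<Longrightarrow> {u, w} \<in> edges \<Gamma>"
    and v: "v \<in> V" and finG: "\<And>w. w \<in> V - {v} \<Longrightarrow> finite (carrier (G w))"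
  shows "two_ended P \<longleftrightarrow> two_ended (G v)"
proof -
  obtain \<pi> where \<pi>: "group_hom P (G v) \<pi>" "\<And>g. g \<in> carrier (G v) \<Longrightarrow> \<pi> (\<iota> v g) = g"
    "\<And>w g. w \<in> V \<Longrightarrow> w \<noteq> v \<Longrightarrow> g \<in> carrier (G w) \<Longrightarrow> \<pi> (\<iota> w g) = \<one>\<^bsub>G v\<^esub>"
    using projection[OF v] by metis
  interpret \<pi>: group_hom P "G v" \<pi> by fact
  let ?N = "generate P (gens_of (V - {v}))"
  have "gens_of (V - {v}) \<subseteq> kernel P (G v) \<pi>"
    using \<pi>(3) \<iota>_closed by (auto simp: gens_of_def kernel_def)
  then have N: "?N \<subseteq> kernel P (G v) \<pi>"
    by (rule P.generate_subgroup_incl[OF _ \<pi>.subgroup_kernel])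
  have "kernel P (G v) \<pi> \<subseteq> ?N"
  proof
    fix x assume "x \<in> kernel P (G v) \<pi>"
    then have x: "x \<in> carrier P" "\<pi> x = \<one>\<^bsub>G v\<^esub>" by (auto simp: kernel_def)
    have "V - (V - {v}) = {v}" using v by auto
    then obtain y z where y: "y \<in> ?N" and z: "z \<in> generate P (gens_of {v})" and xyz: "x = y \<otimes>\<^bsub>P\<^esub> z"
      using P_decompose[of "V - {v}" x] complete x(1) v by auto
    obtain g where g: "g \<in> carrier (G v)" "z = \<iota> v g"
      using z generate_gens_of_singleton[OF v] by auto
    have "y \<in> carrier P" "\<pi> y = \<one>\<^bsub>G v\<^esub>" using y N by (auto simp: kernel_def)
    then have "g = \<one>\<^bsub>G v\<^esub>" using x(2) xyz g \<pi>(2) \<iota>_closed[OF v] by simp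
    then show "x \<in> ?N" using y xyz g \<iota>_one[OF v] \<open>y \<in> carrier P\<close> by simp
  qed
  moreover have "finite ?N" by (rule finite_generate_gens_of) (use fin finG complete in auto)
  ultimately have "finite (kernel P (G v) \<pi>)" using finite_subset by blast
  moreover have "\<pi> ` carrier P = carrier (G v)"
    using \<pi>(2) \<iota>_closed[OF v] by (auto simp: image_iff) metis
  ultimately show ?thesis
    by (intro two_ended_finite_kernel[OF \<pi>(1)] finitely_generated_P fin fg v)
qed

text \<open>Some \<open>G v\<close> is infinite, as otherwise \<open>P\<close> would be finite. Its
  image has a finite set \<open>D\<close> of coset representatives, and the projection to any other
  \<open>G w\<close> kills this image, so \<open>D\<close> already maps onto
  \<open>G w\<close>.\<close>

lemma two_ended_complete:
  assumes fin: "finite V" and fg: "\<And>v. v \<in> V \<Longrightarrow> finitely_generated (G v)"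
    and complete: "\<And>u w. u \<in> V \<Longrightarrow> w \<in> V \<Longrightarrow> u \<noteq> w \<Longrightarrow> {u, w} \<in> edges \<Gamma>"
    and two: "two_ended P"
  obtains v where "v \<in> V" "\<And>w. w \<in> V - {v} \<Longrightarrow> finite (carrier (G w))"
proof -
  have fgP: "finitely_generated P" by (rule finitely_generated_P[OF fin fg])
  have "\<exists>v\<in>V. infinite (carrier (G v))"
  proof (rule ccontr)
    assume "\<not> ?thesis"
    then have "finite (generate P (gens_of V))"
      by (intro finite_generate_gens_of) (use fin complete in auto)
    then have "finite (carrier P)" using generate_\<iota> by (simp add: gens_of_def)
    then show False using not_two_ended_finite[OF P.group_axioms fgP] two by simp
  qed
  then obtain v where v: "v \<in> V" "infinite (carrier (G v))" by blast
  let ?N = "\<iota> v ` carrier (G v)"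
  have "subgroup ?N P" by (rule group_hom.img_is_subgroup[OF \<iota>_hom[OF v(1)]])
  moreover have "infinite ?N" using v finite_imageD inj_\<iota> by blast
  ultimately obtain D where D: "finite D" "D \<subseteq> carrier P"
    "\<And>x. x \<in> carrier P \<Longrightarrow> \<exists>n\<in>?N. \<exists>d\<in>D. x = n \<otimes>\<^bsub>P\<^esub> d"
    using P.two_ended_infinite_subgroup_cover[OF fgP two] by metis
  have "finite (carrier (G w))" if w: "w \<in> V - {v}" for w
  proof -
    have wV: "w \<in> V" "v \<noteq> w" using w by auto
    obtain \<pi> where \<pi>: "group_hom P (G w) \<pi>" "\<And>g. g \<in> carrier (G w) \<Longrightarrow> \<pi> (\<iota> w g) = g"
      "\<And>u g. u \<in> V \<Longrightarrow> u \<noteq> w \<Longrightarrow> g \<in> carrier (G u) \<Longrightarrow> \<pi> (\<iota> u g) = \<one>\<^bsub>G w\<^esub>"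
      using projection[OF wV(1)] by metis
    interpret \<pi>: group_hom P "G w" \<pi> by fact
    have "carrier (G w) \<subseteq> \<pi> ` D"
    proof
      fix g assume g: "g \<in> carrier (G w)"
      obtain n d where nd: "n \<in> ?N" "d \<in> D" "\<iota> w g = n \<otimes>\<^bsub>P\<^esub> d" 
        using D(3)[OF \<iota>_closed[OF wV(1) g]] by blast
      then have "n \<in> carrier P" "\<pi> n = \<one>\<^bsub>G w\<^esub>" "d \<in> carrier P"
        using \<pi>(3)[OF v(1) wV(2)] \<iota>_closed[OF v(1)] D(2) by auto
      then have "g = \<pi> d" using \<pi>(2)[OF g] nd(3) by simp
      then show "g \<in> \<pi> ` D" using nd(2) by blast
    qed
    then show ?thesis using D(1) finite_surj by blast
  qed
  with v(1) that show ?thesis by blast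
qed


subsection \<open>Non-adjacent vertices\<close>

text \<open>
  If \<open>P\<close> is two-ended, an infinite subgroup contains a power of the product of two syllables from
  non-adjacent vertex groups, which acts non-trivially on alternating words.
\<close>

lemma nonadjacent_infinite_order:
  assumes ab: "a \<in> V" "b \<in> V" "a \<noteq> b" "{a, b} \<notin> edges \<Gamma>"
    and x: "x \<in> carrier (G a)" "x \<noteq> \<one>\<^bsub>G a\<^esub>" and y: "y \<in> carrier (G b)" "y \<noteq> \<one>\<^bsub>G b\<^esub>"
    and n: "n > 0"
  shows "(\<iota> a x \<otimes>\<^bsub>P\<^esub> \<iota> b y) [^]\<^bsub>P\<^esub> (n::nat) \<noteq> \<one>\<^bsub>P\<^esub>"
proof -
  have U: "{a, b} \<subseteq> V" "\<And>u w. u \<in> {a, b} \<Longrightarrow> w \<in> {a, b} \<Longrightarrow> {u, w} \<notin> edges \<Gamma>"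
    using ab edge_verts by (auto simp: insert_commute)
  obtain \<rho> where \<rho>: "group_hom P bij_group \<rho>"
    "\<And>v g. v \<in> {a, b} \<Longrightarrow> g \<in> carrier (G v) \<Longrightarrow> \<rho> (\<iota> v g) = act {a, b} v g"
    using alternating_action[OF U] by blast
  interpret \<rho>: group_hom P bij_group \<rho> by fact
  have "\<rho> \<one>\<^bsub>P\<^esub> [] = []" using \<rho>.hom_one by (simp add: bij_group_def)
  then show ?thesis
    using alternating_power[OF \<rho> U(1) _ _ ab(3) x y n] by auto
qed

text \<open>Some positive power of \<open>?s\<close> equals some \<open>?u [^] l\<close>. Applied to
  the empty word, the former starts with \<open>(a, x')\<close>. The latter starts with
  \<open>(a, x)\<close> for positive \<open>l\<close>, is empty for \<open>l = 0\<close>, and starts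
  with a letter from \<open>G b\<close> for negative \<open>l\<close>.\<close>

lemma nonadjacent_unique_nontrivial:
  assumes fgP: "finitely_generated P" and two: "two_ended P"
    and ab: "a \<in> V" "b \<in> V" "a \<noteq> b" "{a, b} \<notin> edges \<Gamma>"
    and x: "x \<in> carrier (G a)" "x \<noteq> \<one>\<^bsub>G a\<^esub>" and x': "x' \<in> carrier (G a)" "x' \<noteq> \<one>\<^bsub>G a\<^esub>"
    and y: "y \<in> carrier (G b)" "y \<noteq> \<one>\<^bsub>G b\<^esub>"
  shows "x' = x"
proof -
  have U: "{a, b} \<subseteq> V" "\<And>u w. u \<in> {a, b} \<Longrightarrow> w \<in> {a, b} \<Longrightarrow> {u, w} \<notin> edges \<Gamma>"
    using ab edge_verts by (auto simp: insert_commute)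
  obtain \<rho> where \<rho>: "group_hom P bij_group \<rho>"
    "\<And>v g. v \<in> {a, b} \<Longrightarrow> g \<in> carrier (G v) \<Longrightarrow> \<rho> (\<iota> v g) = act {a, b} v g"
    using alternating_action[OF U] by blast
  interpret \<rho>: group_hom P bij_group \<rho> by fact
  interpret Ga: group "G a" by (rule groups[OF ab(1)])
  interpret Gb: group "G b" by (rule groups[OF ab(2)])
  let ?u = "\<iota> a x \<otimes>\<^bsub>P\<^esub> \<iota> b y" and ?s = "\<iota> a x' \<otimes>\<^bsub>P\<^esub> \<iota> b y"
  have cl: "\<iota> a x \<in> carrier P" "\<iota> a x' \<in> carrier P" "\<iota> b y \<in> carrier P"
    using \<iota>_closed ab x x' y by auto
  have u: "?u \<in> carrier P" and s: "?s \<in> carrier P" using cl by auto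
  have "infinite (range (\<lambda>k::int. ?u [^]\<^bsub>P\<^esub> k))"
    by (rule P.infinite_range_int_pow(2)[OF u nonadjacent_infinite_order[OF ab x y]])
  then obtain k :: nat where k: "k > 0" "?s [^]\<^bsub>P\<^esub> k \<in> range (\<lambda>k::int. ?u [^]\<^bsub>P\<^esub> k)"
    using P.two_ended_infinite_subgroup_pow[OF fgP two P.subgroup_range_int_pow[OF u] _ s] by blast
  then obtain l :: int where l: "?s [^]\<^bsub>P\<^esub> k = ?u [^]\<^bsub>P\<^esub> l" by blast
  obtain w where w: "\<rho> (?s [^]\<^bsub>P\<^esub> k) [] = (a, x') # w"
    using alternating_power[OF \<rho> U(1) _ _ ab(3) x' y k(1)] by auto
  consider "l > 0" | "l = 0" | "l < 0" by linarith
  then show ?thesis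
  proof cases
    case 1
    then have "\<exists>w. \<rho> (?u [^]\<^bsub>P\<^esub> nat l) [] = (a, x) # w"
      by (intro alternating_power[OF \<rho> U(1) _ _ ab(3) x y]) auto
    moreover have "?u [^]\<^bsub>P\<^esub> nat l = ?u [^]\<^bsub>P\<^esub> l" using 1 int_pow_int[of P ?u "nat l"] by simp
    ultimately show ?thesis using w l by auto
  next
    case 2
    then show ?thesis using w l \<rho>.hom_one by (simp add: bij_group_def)
  next
    case 3
    \<comment> \<open>A negative power of \<open>?u\<close> is a positive power of its inverse,
      which is again a product of two syllables with \<open>a\<close> and \<open>b\<close>
      exchanged.\<close>
    have "inv\<^bsub>P\<^esub> ?u = \<iota> b (inv\<^bsub>G b\<^esub> y) \<otimes>\<^bsub>P\<^esub> \<iota> a (inv\<^bsub>G a\<^esub> x)"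
      using \<iota>_inv ab x y cl by (simp add: P.inv_mult_group)
    moreover have "?u [^]\<^bsub>P\<^esub> l = (inv\<^bsub>P\<^esub> ?u) [^]\<^bsub>P\<^esub> nat (- l)"
      unfolding P.nat_pow_inv[OF u] using 3 by (simp only: int_pow_def2 if_True)
    moreover have "\<exists>w. \<rho> ((\<iota> b (inv\<^bsub>G b\<^esub> y) \<otimes>\<^bsub>P\<^esub> \<iota> a (inv\<^bsub>G a\<^esub> x)) [^]\<^bsub>P\<^esub> nat (- l)) [] = (b, inv\<^bsub>G b\<^esub> y) # w"
      using alternating_power[OF \<rho> U(1), of b a "inv\<^bsub>G b\<^esub> y" "inv\<^bsub>G a\<^esub> x" "nat (- l)"] ab(3) x y 3
      by simp
    ultimately have "\<exists>w. \<rho> (?u [^]\<^bsub>P\<^esub> l) [] = (b, inv\<^bsub>G b\<^esub> y) # w" by (simp only:)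
    then show ?thesis using w l ab(3) by auto
  qed
qed

lemma finite_subgroup_acting_trivially:
  assumes fgP: "finitely_generated P" and two: "two_ended P"
    and ab: "a \<in> V" "b \<in> V" "a \<noteq> b"
    and x: "x \<in> carrier (G a)" "x \<noteq> \<one>\<^bsub>G a\<^esub>" and y: "y \<in> carrier (G b)" "y \<noteq> \<one>\<^bsub>G b\<^esub>"
    and \<rho>: "group_hom P bij_group \<rho>"
      "\<And>v g. v \<in> {a, b} \<Longrightarrow> g \<in> carrier (G v) \<Longrightarrow> \<rho> (\<iota> v g) = act {a, b} v g"
    and N: "subgroup N P" "\<And>n. n \<in> N \<Longrightarrow> \<rho> n = id"
  shows "finite N"
proof (rule ccontr)
  assume inf: "infinite N"
  let ?u = "\<iota> a x \<otimes>\<^bsub>P\<^esub> \<iota> b y"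
  have u: "?u \<in> carrier P" using \<iota>_closed ab x y by auto
  obtain k :: nat where "k > 0" "?u [^]\<^bsub>P\<^esub> k \<in> N"
    by (rule P.two_ended_infinite_subgroup_pow[OF fgP two N(1) inf u]) blast
  then show False
    using alternating_power[OF \<rho> _ _ _ ab(3) x y \<open>k > 0\<close>] N(2)[of "?u [^]\<^bsub>P\<^esub> k"] ab by auto
qed

text \<open>If a conclusion failed, the kernel of the action would contain an infinite subgroup: the
  image of \<open>G c\<close>, the cyclic group of the square of \<open>\<iota> a x\<close> times
  \<open>\<iota> c z\<close>, or that of \<open>\<iota> c z\<close> times
  \<open>\<iota> d r\<close>.\<close>

lemma two_ended_nonadjacent:
  assumes fgP: "finitely_generated P" and two: "two_ended P"
    and nontriv: "\<And>v. v \<in> V \<Longrightarrow> \<exists>g\<in>carrier (G v). g \<noteq> \<one>\<^bsub>G v\<^esub>"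
    and ab: "a \<in> V" "b \<in> V" "a \<noteq> b" "{a, b} \<notin> edges \<Gamma>"
    and c: "c \<in> V - {a, b}"
  shows "finite (carrier (G c))" "{a, c} \<in> edges \<Gamma>"
    "\<And>d. d \<in> V - {a, b} \<Longrightarrow> d \<noteq> c \<Longrightarrow> {c, d} \<in> edges \<Gamma>"
proof -
  have cV: "c \<in> V" "c \<noteq> a" "c \<noteq> b" using c by auto
  obtain x y z where x: "x \<in> carrier (G a)" "x \<noteq> \<one>\<^bsub>G a\<^esub>" and y: "y \<in> carrier (G b)" "y \<noteq> \<one>\<^bsub>G b\<^esub>"
    and z: "z \<in> carrier (G c)" "z \<noteq> \<one>\<^bsub>G c\<^esub>" using nontriv ab cV by meson
  interpret Ga: group "G a" by (rule groups[OF ab(1)])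
  have U: "{a, b} \<subseteq> V" "\<And>u w. u \<in> {a, b} \<Longrightarrow> w \<in> {a, b} \<Longrightarrow> {u, w} \<notin> edges \<Gamma>"
    using ab edge_verts by (auto simp: insert_commute)
  obtain \<rho> where \<rho>: "group_hom P bij_group \<rho>"
    "\<And>v g. v \<in> {a, b} \<Longrightarrow> g \<in> carrier (G v) \<Longrightarrow> \<rho> (\<iota> v g) = act {a, b} v g"
    "\<And>v g. v \<in> V - {a, b} \<Longrightarrow> g \<in> carrier (G v) \<Longrightarrow> \<rho> (\<iota> v g) = id"
    using alternating_action[OF U] by blast
  interpret \<rho>: group_hom P bij_group \<rho> by fact
  have fin: "finite N" if "subgroup N P" "\<And>n. n \<in> N \<Longrightarrow> \<rho> n = id" for N
    by (rule finite_subgroup_acting_trivially[OF fgP two ab(1-3) x y \<rho>(1,2) that])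
  \<comment> \<open>With an element, its whole cyclic group acts trivially, and is therefore
    finite.\<close>
  have torsion: "\<exists>n::nat. n > 0 \<and> p [^]\<^bsub>P\<^esub> n = \<one>\<^bsub>P\<^esub>" if p: "p \<in> carrier P" "\<rho> p = id" for p
  proof (rule ccontr)
    assume contra: "\<not> ?thesis"
    have "finite (range (\<lambda>k::int. p [^]\<^bsub>P\<^esub> k))"
    proof (rule fin[OF P.subgroup_range_int_pow[OF p(1)]])
      fix q assume "q \<in> range (\<lambda>k::int. p [^]\<^bsub>P\<^esub> k)"
      then obtain k :: int where "q = p [^]\<^bsub>P\<^esub> k" by blast
      moreover have "\<rho> p = \<one>\<^bsub>bij_group\<^esub>" using p(2) by (simp add: bij_group_def)
      ultimately have "\<rho> q = \<one>\<^bsub>bij_group\<^esub>" using \<rho>.hom_int_pow[OF p(1), of k] by simp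
      then show "\<rho> q = id" by (simp add: bij_group_def)
    qed
    then show False using P.infinite_range_int_pow(2)[OF p(1)] contra by blast
  qed
  have comp: "\<rho> (p \<otimes>\<^bsub>P\<^esub> q) = \<rho> p \<circ> \<rho> q" if "p \<in> carrier P" "q \<in> carrier P" for p q
    using \<rho>.hom_mult[OF that] by (simp add: bij_group_def)
  show "finite (carrier (G c))"
  proof -
    have "finite (\<iota> c ` carrier (G c))"
      by (rule fin[OF group_hom.img_is_subgroup[OF \<iota>_hom[OF cV(1)]]]) (use \<rho>(3)[OF c] in auto)
    then show ?thesis using finite_imageD inj_\<iota>[OF cV(1)] by blast
  qed
  show "{a, c} \<in> edges \<Gamma>"
  proof (rule ccontr)
    assume ac: "{a, c} \<notin> edges \<Gamma>"
    let ?s = "\<iota> a x \<otimes>\<^bsub>P\<^esub> \<iota> c z"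
    have cl: "\<iota> a x \<in> carrier P" "\<iota> c z \<in> carrier P" using \<iota>_closed ab cV x z by auto
    \<comment> \<open>The square of \<open>x\<close> differs from \<open>x\<close>, and
      \<open>x\<close> is the only non-trivial element of \<open>G a\<close>.\<close>
    have xx: "x \<otimes>\<^bsub>G a\<^esub> x = \<one>\<^bsub>G a\<^esub>"
    proof (rule ccontr)
      assume "x \<otimes>\<^bsub>G a\<^esub> x \<noteq> \<one>\<^bsub>G a\<^esub>"
      then have "x \<otimes>\<^bsub>G a\<^esub> x = x"
        using nonadjacent_unique_nontrivial[OF fgP two ab x _ _ y, of "x \<otimes>\<^bsub>G a\<^esub> x"] x by simp
      then show False using x by simp
    qed
    have "\<rho> (\<iota> a x) \<circ> \<rho> (\<iota> a x) = \<rho> (\<iota> a (x \<otimes>\<^bsub>G a\<^esub> x))"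
      using comp[OF cl(1) cl(1)] \<iota>_mult[OF ab(1) x(1) x(1)] by simp
    also have "\<dots> = id" unfolding xx using \<iota>_one[OF ab(1)] \<rho>.hom_one by (simp add: bij_group_def)
    finally have aa: "\<rho> (\<iota> a x) \<circ> \<rho> (\<iota> a x) = id" .
    have s: "?s \<in> carrier P" using cl by simp
    \<comment> \<open>The product \<open>?s\<close> acts like the involution \<open>x\<close>, so
      only its square lies in the kernel.\<close>
    have "\<rho> ?s = \<rho> (\<iota> a x)" unfolding comp[OF cl] \<rho>(3)[OF c z(1)] by simp
    then have "\<rho> (?s \<otimes>\<^bsub>P\<^esub> ?s) = id" unfolding comp[OF s s] using aa by simp
    then obtain n :: nat where n: "n > 0" "(?s \<otimes>\<^bsub>P\<^esub> ?s) [^]\<^bsub>P\<^esub> n = \<one>\<^bsub>P\<^esub>"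
      using torsion[of "?s \<otimes>\<^bsub>P\<^esub> ?s"] s by auto
    have "?s \<otimes>\<^bsub>P\<^esub> ?s = ?s [^]\<^bsub>P\<^esub> (2::nat)" using s by (simp add: numeral_2_eq_2)
    then have "(?s \<otimes>\<^bsub>P\<^esub> ?s) [^]\<^bsub>P\<^esub> n = ?s [^]\<^bsub>P\<^esub> (2 * n)"
      by (simp only: P.nat_pow_pow[OF s])
    then show False
      using nonadjacent_infinite_order[OF ab(1) cV(1) _ ac x z, of "2 * n"] n cV by simp
  qed
  show "{c, d} \<in> edges \<Gamma>" if d: "d \<in> V - {a, b}" "d \<noteq> c" for d
  proof (rule ccontr)
    assume cd: "{c, d} \<notin> edges \<Gamma>"
    have dV: "d \<in> V" using d by simp
    obtain r where r: "r \<in> carrier (G d)" "r \<noteq> \<one>\<^bsub>G d\<^esub>" using nontriv[OF dV] by blast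
    let ?s = "\<iota> c z \<otimes>\<^bsub>P\<^esub> \<iota> d r"
    have cl: "\<iota> c z \<in> carrier P" "\<iota> d r \<in> carrier P" using \<iota>_closed dV cV z r by auto
    have "\<rho> ?s = id" unfolding comp[OF cl] \<rho>(3)[OF c z(1)] \<rho>(3)[OF d(1) r(1)] by simp
    then obtain n :: nat where "n > 0" "?s [^]\<^bsub>P\<^esub> n = \<one>\<^bsub>P\<^esub>"
      using torsion[of ?s] cl by auto
    then show False
      using nonadjacent_infinite_order[OF cV(1) dV _ cd z r, of n] d(2) by simp
  qed
qed

end

lemma (in group) is_iso_integer_mod_group_2_iff:
  "G \<cong> integer_mod_group 2 \<longleftrightarrow> (\<exists>x. x \<noteq> \<one> \<and> carrier G = {\<one>, x})"
proof
  assume iso: "G \<cong> integer_mod_group 2"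
  have "carrier (integer_mod_group 2) = {0, 1}" by (auto simp: carrier_integer_mod_group)
  then have "card (carrier G) = 2" using iso_same_card[OF iso] by simp
  then obtain u w where "carrier G = {u, w}" "u \<noteq> w"
    by (auto simp: card_2_iff)
  then have "carrier G = {\<one>, w} \<and> w \<noteq> \<one> \<or> carrier G = {\<one>, u} \<and> u \<noteq> \<one>"
    using one_closed by (auto simp: insert_commute)
  then show "\<exists>x. x \<noteq> \<one> \<and> carrier G = {\<one>, x}" by blast
next
  assume "\<exists>x. x \<noteq> \<one> \<and> carrier G = {\<one>, x}"
  then obtain x where x: "x \<noteq> \<one>" "carrier G = {\<one>, x}" by blast
  have "x \<otimes> x \<in> {\<one>, x}" "x \<otimes> x \<noteq> x" using x m_closed[of x x] by auto
  then have xx: "x \<otimes> x = \<one>" by blast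
  have c2: "carrier (integer_mod_group 2) = {0, 1}" by (auto simp: carrier_integer_mod_group)
  have "(\<lambda>g. if g = \<one> then 0 else 1) \<in> iso G (integer_mod_group 2)"
    unfolding iso_def bij_betw_def hom_def using x xx c2 by (auto simp: inj_on_def)
  then show "G \<cong> integer_mod_group 2" by (auto simp: is_iso_def)
qed

context graph_of_groups
begin

subsection \<open>The infinite dihedral case\<close>

context
  fixes a b :: 'v and x y :: 'a
  assumes finV: "finite V"
    and ab: "a \<in> V" "b \<in> V" "a \<noteq> b" "{a, b} \<notin> edges \<Gamma>"
    and Ga: "carrier (G a) = {\<one>\<^bsub>G a\<^esub>, x}" "x \<noteq> \<one>\<^bsub>G a\<^esub>"
    and Gb: "carrier (G b) = {\<one>\<^bsub>G b\<^esub>, y}" "y \<noteq> \<one>\<^bsub>G b\<^esub>"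
    and cone: "\<And>c d. c \<in> V - {a, b} \<Longrightarrow> d \<in> V \<Longrightarrow> c \<noteq> d \<Longrightarrow> {c, d} \<in> edges \<Gamma>"
    and fin: "\<And>c. c \<in> V - {a, b} \<Longrightarrow> finite (carrier (G c))"
begin

abbreviation \<alpha> where "\<alpha> \<equiv> \<iota> a x"
abbreviation \<beta> where "\<beta> \<equiv> \<iota> b y"
abbreviation t where "t \<equiv> \<alpha> \<otimes>\<^bsub>P\<^esub> \<beta>"
abbreviation N where "N \<equiv> generate P (gens_of (V - {a, b}))"

lemma involution:
  assumes "v \<in> V" "carrier (G v) = {\<one>\<^bsub>G v\<^esub>, z}" "z \<noteq> \<one>\<^bsub>G v\<^esub>"
  shows "z \<otimes>\<^bsub>G v\<^esub> z = \<one>\<^bsub>G v\<^esub>"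
proof -
  interpret group "G v" by (rule groups[OF assms(1)])
  have "z \<otimes>\<^bsub>G v\<^esub> z \<in> {\<one>\<^bsub>G v\<^esub>, z}" "z \<otimes>\<^bsub>G v\<^esub> z \<noteq> z"
    using assms m_closed[of z z] by auto
  then show ?thesis by blast
qed

lemma \<alpha>\<beta>_closed: "\<alpha> \<in> carrier P" "\<beta> \<in> carrier P" "t \<in> carrier P"
  using \<iota>_closed[OF ab(1), of x] \<iota>_closed[OF ab(2), of y] Ga Gb by simp_all

lemma \<alpha>\<beta>_square: "\<alpha> \<otimes>\<^bsub>P\<^esub> \<alpha> = \<one>\<^bsub>P\<^esub>" "\<beta> \<otimes>\<^bsub>P\<^esub> \<beta> = \<one>\<^bsub>P\<^esub>"
  using \<iota>_mult[OF ab(1), of x x] \<iota>_one[OF ab(1)] involution[OF ab(1) Ga] Ga(1)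
    \<iota>_mult[OF ab(2), of y y] \<iota>_one[OF ab(2)] involution[OF ab(2) Gb] Gb(1) by simp_all

text \<open>Conjugation by \<open>\<alpha>\<close> swaps the order of the two involutions in
  \<open>t\<close>, that is, it inverts \<open>t\<close>; being a homomorphism, it inverts every
  power.\<close>

lemma \<alpha>_t_pow: "\<alpha> \<otimes>\<^bsub>P\<^esub> t [^]\<^bsub>P\<^esub> n = t [^]\<^bsub>P\<^esub> (- n) \<otimes>\<^bsub>P\<^esub> \<alpha>" for n :: int
proof -
  note cl = \<alpha>\<beta>_closed
  have cancel: "\<alpha> \<otimes>\<^bsub>P\<^esub> (\<alpha> \<otimes>\<^bsub>P\<^esub> p) = p" if "p \<in> carrier P" for p
    using P.m_assoc[OF cl(1) cl(1) that] \<alpha>\<beta>_square(1) that by simp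
  have "(\<lambda>p. \<alpha> \<otimes>\<^bsub>P\<^esub> p \<otimes>\<^bsub>P\<^esub> \<alpha>) \<in> hom P P"
    by (rule homI) (use cl cancel in \<open>simp_all add: P.m_assoc\<close>)
  then interpret conj: group_hom P P "\<lambda>p. \<alpha> \<otimes>\<^bsub>P\<^esub> p \<otimes>\<^bsub>P\<^esub> \<alpha>"
    by (simp add: group_hom_def group_hom_axioms_def P.group_axioms)
  have inv: "inv\<^bsub>P\<^esub> \<alpha> = \<alpha>" "inv\<^bsub>P\<^esub> \<beta> = \<beta>"
    using P.inv_equality \<alpha>\<beta>_square cl by auto
  have "\<alpha> \<otimes>\<^bsub>P\<^esub> t \<otimes>\<^bsub>P\<^esub> \<alpha> = inv\<^bsub>P\<^esub> t"
    using cl cancel[OF cl(2)] by (simp add: P.inv_mult_group inv)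
  then have "\<alpha> \<otimes>\<^bsub>P\<^esub> t [^]\<^bsub>P\<^esub> n \<otimes>\<^bsub>P\<^esub> \<alpha> = t [^]\<^bsub>P\<^esub> (- n)"
    using conj.hom_int_pow[OF cl(3), of n] P.int_pow_inv[OF cl(3), of n] P.int_pow_neg[OF cl(3), of n]
    by simp
  then have "\<alpha> \<otimes>\<^bsub>P\<^esub> t [^]\<^bsub>P\<^esub> n \<otimes>\<^bsub>P\<^esub> \<alpha> \<otimes>\<^bsub>P\<^esub> \<alpha> = t [^]\<^bsub>P\<^esub> (- n) \<otimes>\<^bsub>P\<^esub> \<alpha>" by simp
  then show ?thesis using cl \<alpha>\<beta>_square(1) by (simp add: P.m_assoc)
qed

text \<open>In the group generated by \<open>\<alpha>\<close> and \<open>\<beta>\<close>, every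
  element is a power of \<open>t\<close>, possibly times \<open>\<alpha>\<close>, and
  \<open>N\<close> commutes with this group. The products in question contain the unit and are
  stable under left multiplication by letters.\<close>

lemma dihedral_cover:
  assumes "p \<in> carrier P"
  shows "\<exists>n::int. \<exists>e\<in>N \<union> (\<lambda>n. \<alpha> \<otimes>\<^bsub>P\<^esub> n) ` N. p = t [^]\<^bsub>P\<^esub> n \<otimes>\<^bsub>P\<^esub> e"
proof -
  note cl = \<alpha>\<beta>_closed
  define E where "E = N \<union> (\<lambda>n. \<alpha> \<otimes>\<^bsub>P\<^esub> n) ` N"
  define Q where "Q p \<longleftrightarrow> (\<exists>n::int. \<exists>e\<in>E. p = t [^]\<^bsub>P\<^esub> n \<otimes>\<^bsub>P\<^esub> e)" for p
  have QI: "Q (t [^]\<^bsub>P\<^esub> n \<otimes>\<^bsub>P\<^esub> e)" if "e \<in> E" for n :: int and e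
    unfolding Q_def using that by blast
  have gens: "gens_of (V - {a, b}) \<subseteq> carrier P" by (rule gens_of_subset) auto
  have NP: "m \<in> carrier P" if "m \<in> N" for m using P.generate_in_carrier[OF gens that] .
  have EP: "e \<in> carrier P" if "e \<in> E" for e
    using that unfolding E_def by (elim UnE imageE) (simp_all add: NP cl(1))
  have tn: "t [^]\<^bsub>P\<^esub> n \<in> carrier P" for n :: int by (rule P.int_pow_closed[OF cl(3)])
  have \<alpha>\<alpha>: "\<alpha> \<otimes>\<^bsub>P\<^esub> (\<alpha> \<otimes>\<^bsub>P\<^esub> p) = p" if "p \<in> carrier P" for p
    using P.m_assoc[OF cl(1) cl(1) that] \<alpha>\<beta>_square(1) that by simp
  have \<alpha>E: "\<alpha> \<otimes>\<^bsub>P\<^esub> e \<in> E" if eE: "e \<in> E" for e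
  proof (cases "e \<in> N")
    case False
    then obtain m where m: "m \<in> N" "e = \<alpha> \<otimes>\<^bsub>P\<^esub> m" using eE by (auto simp: E_def)
    then show ?thesis using \<alpha>\<alpha>[OF NP[OF m(1)]] by (simp add: E_def)
  qed (simp add: E_def)
  have Q\<alpha>: "Q (\<alpha> \<otimes>\<^bsub>P\<^esub> p)" if Qp: "Q p" for p
  proof -
    obtain n :: int and e where e: "e \<in> E" "p = t [^]\<^bsub>P\<^esub> n \<otimes>\<^bsub>P\<^esub> e"
      using Qp unfolding Q_def by blast
    have "\<alpha> \<otimes>\<^bsub>P\<^esub> p = \<alpha> \<otimes>\<^bsub>P\<^esub> t [^]\<^bsub>P\<^esub> n \<otimes>\<^bsub>P\<^esub> e"
      unfolding e(2) by (rule P.m_assoc[OF cl(1) tn EP[OF e(1)], symmetric])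
    also have "\<dots> = t [^]\<^bsub>P\<^esub> (- n) \<otimes>\<^bsub>P\<^esub> (\<alpha> \<otimes>\<^bsub>P\<^esub> e)"
      unfolding \<alpha>_t_pow by (rule P.m_assoc[OF tn cl(1) EP[OF e(1)]])
    finally show ?thesis using QI[OF \<alpha>E[OF e(1)]] by simp
  qed
  have Qt: "Q (t \<otimes>\<^bsub>P\<^esub> p)" if Qp: "Q p" for p
  proof -
    obtain n :: int and e where e: "e \<in> E" "p = t [^]\<^bsub>P\<^esub> n \<otimes>\<^bsub>P\<^esub> e"
      using Qp unfolding Q_def by blast
    have "t \<otimes>\<^bsub>P\<^esub> p = t [^]\<^bsub>P\<^esub> (1::int) \<otimes>\<^bsub>P\<^esub> t [^]\<^bsub>P\<^esub> n \<otimes>\<^bsub>P\<^esub> e"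
      unfolding e(2) P.int_pow_1[OF cl(3)] by (rule P.m_assoc[OF cl(3) tn EP[OF e(1)], symmetric])
    then show ?thesis using QI[OF e(1), of "1 + n"] by (simp only: P.int_pow_mult[OF cl(3)])
  qed
  have Qc: "Q (c \<otimes>\<^bsub>P\<^esub> p)"
    if c: "c \<in> N" "c \<otimes>\<^bsub>P\<^esub> \<alpha> = \<alpha> \<otimes>\<^bsub>P\<^esub> c" "c \<otimes>\<^bsub>P\<^esub> \<beta> = \<beta> \<otimes>\<^bsub>P\<^esub> c" and "Q p" for c p
  proof -
    obtain n :: int and e where e: "e \<in> E" "p = t [^]\<^bsub>P\<^esub> n \<otimes>\<^bsub>P\<^esub> e"
      using \<open>Q p\<close> unfolding Q_def by blast
    note cP = NP[OF c(1)]
    have "t [^]\<^bsub>P\<^esub> n \<in> generate P {\<alpha>, \<beta>}"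
      by (intro P.subgroup_int_pow_closed P.generate_is_subgroup)
        (use cl in \<open>auto intro: generate.eng generate.incl\<close>)
    then have ctn: "c \<otimes>\<^bsub>P\<^esub> t [^]\<^bsub>P\<^esub> n = t [^]\<^bsub>P\<^esub> n \<otimes>\<^bsub>P\<^esub> c"
      by (rule P.commute_generate[OF cP, rotated 2]) (use cl c in auto)
    have "c \<otimes>\<^bsub>P\<^esub> e \<in> E"
    proof (cases "e \<in> N")
      case True
      then show ?thesis using generate.eng[OF c(1) True] by (simp add: E_def)
    next
      case False
      then obtain m where m: "m \<in> N" "e = \<alpha> \<otimes>\<^bsub>P\<^esub> m" using e(1) by (auto simp: E_def)
      have "c \<otimes>\<^bsub>P\<^esub> e = \<alpha> \<otimes>\<^bsub>P\<^esub> (c \<otimes>\<^bsub>P\<^esub> m)"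
        unfolding m(2) P.m_assoc[OF cP cl(1) NP[OF m(1)], symmetric] c(2)
        by (rule P.m_assoc[OF cl(1) cP NP[OF m(1)]])
      then show ?thesis using generate.eng[OF c(1) m(1)] by (simp add: E_def)
    qed
    moreover have "c \<otimes>\<^bsub>P\<^esub> p = t [^]\<^bsub>P\<^esub> n \<otimes>\<^bsub>P\<^esub> (c \<otimes>\<^bsub>P\<^esub> e)"
      unfolding e(2) P.m_assoc[OF cP tn EP[OF e(1)], symmetric] ctn
      by (rule P.m_assoc[OF tn cP EP[OF e(1)]])
    ultimately show ?thesis using QI by simp
  qed
  have "Q p"
    using assms
  proof (induction rule: P_induct)
    case one
    have "\<one>\<^bsub>P\<^esub> \<in> E" unfolding E_def using generate.one by (rule UnI1)
    from QI[OF this, of 0] show ?case by simp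
  next
    case (step v g p)
    have one: "\<one>\<^bsub>P\<^esub> \<otimes>\<^bsub>P\<^esub> p = p" using step.hyps by simp
    consider "v = a" | "v = b" | "v \<in> V - {a, b}" using step.hyps by blast
    then show ?case
    proof cases
      case 1
      then have "g = \<one>\<^bsub>G a\<^esub> \<or> g = x" using step.hyps Ga by auto
      then show ?thesis using 1 step.IH Q\<alpha>[OF step.IH] \<iota>_one[OF ab(1)] one by auto
    next
      case 2
      then have g: "g = \<one>\<^bsub>G b\<^esub> \<or> g = y" using step.hyps Gb by auto
      \<comment> \<open>\<open>\<beta>\<close> is \<open>\<alpha>\<close> times \<open>t\<close>, so
        its case follows from the steps for \<open>t\<close> and \<open>\<alpha>\<close>.\<close>
      have "\<alpha> \<otimes>\<^bsub>P\<^esub> (t \<otimes>\<^bsub>P\<^esub> p) = \<beta> \<otimes>\<^bsub>P\<^esub> p"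
        using P.m_assoc[OF cl(1,2) step.hyps(3)] \<alpha>\<alpha>[of "\<beta> \<otimes>\<^bsub>P\<^esub> p"] cl step.hyps(3) by simp
      then have "Q (\<beta> \<otimes>\<^bsub>P\<^esub> p)" using Q\<alpha>[OF Qt[OF step.IH]] by simp
      then show ?thesis using 2 g step.IH \<iota>_one[OF ab(2)] one by auto
    next
      case 3
      show ?thesis
      proof (rule Qc[OF _ _ _ step.IH])
        show "\<iota> v g \<in> N" by (rule generate.incl) (use 3 step.hyps in \<open>auto simp: gens_of_def\<close>)
        show "\<iota> v g \<otimes>\<^bsub>P\<^esub> \<alpha> = \<alpha> \<otimes>\<^bsub>P\<^esub> \<iota> v g"
          by (rule \<iota>_commute) (use 3 cone[of v a] ab step.hyps Ga in auto)
        show "\<iota> v g \<otimes>\<^bsub>P\<^esub> \<beta> = \<beta> \<otimes>\<^bsub>P\<^esub> \<iota> v g"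
          by (rule \<iota>_commute) (use 3 cone[of v b] ab step.hyps Gb in auto)
      qed
    qed
  qed
  then show ?thesis unfolding Q_def E_def .
qed

text \<open>The reflections at 0 and 1/2 generate the standard model of the infinite dihedral group.
  The affine form with slope 1 or -1 records that \<open>P\<close> acts by isometries.\<close>

lemma reflection_action:
  "\<exists>\<psi>. group_hom P bij_group \<psi> \<and> \<psi> \<alpha> = (\<lambda>i::int. - i) \<and> \<psi> \<beta> = (\<lambda>i::int. 1 - i) \<and>
    (\<forall>p\<in>carrier P. \<exists>s m. (s = 1 \<or> s = - 1) \<and> \<psi> p = (\<lambda>i. s * i + m))"
proof -
  define r :: "'v \<Rightarrow> int \<Rightarrow> int" where "r v = (if v = a then (\<lambda>i. - i) else if v = b then (\<lambda>i. 1 - i) else id)" for v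
  define f where "f v g = (if g = \<one>\<^bsub>G v\<^esub> then id else r v)" for v and g :: 'a
  have rr: "r v \<circ> r v = id" for v by (auto simp: r_def fun_eq_iff)
  have hom: "f v \<in> hom (G v) bij_group" if v: "v \<in> V" for v
  proof -
    interpret Gv: group "G v" by (rule groups[OF v])
    show ?thesis
    proof (rule Gv.hom_bij_groupI)
      show "f v \<one>\<^bsub>G v\<^esub> = id" by (simp add: f_def)
      fix g h assume gh: "g \<in> carrier (G v)" "h \<in> carrier (G v)"
      have "g \<otimes>\<^bsub>G v\<^esub> h = \<one>\<^bsub>G v\<^esub>"
        if ngh: "g \<noteq> \<one>\<^bsub>G v\<^esub>" "h \<noteq> \<one>\<^bsub>G v\<^esub>" and v: "v = a \<or> v = b"
        using v
      proof
        assume v: "v = a"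
        then have "g = x" "h = x" using ngh gh Ga(1) by blast+
        then show ?thesis using involution[OF ab(1) Ga] unfolding v by simp
      next
        assume v: "v = b"
        then have "g = y" "h = y" using ngh gh Gb(1) by blast+
        then show ?thesis using involution[OF ab(2) Gb] unfolding v by simp
      qed
      moreover have "r v = id" if "\<not> (v = a \<or> v = b)" using that by (simp add: r_def)
      ultimately show "f v (g \<otimes>\<^bsub>G v\<^esub> h) = f v g \<circ> f v h"
        using gh rr[of v] by (cases "g = \<one>\<^bsub>G v\<^esub>"; cases "h = \<one>\<^bsub>G v\<^esub>"; cases "v = a \<or> v = b") (simp_all add: f_def)
    qed
  qed
  obtain \<psi> where \<psi>: "\<psi> \<in> hom P bij_group"
    "\<And>v g. v \<in> V \<Longrightarrow> g \<in> carrier (G v) \<Longrightarrow> \<psi> (\<iota> v g) = f v g"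
  proof (rule P_universal[OF group_bij_group hom])
    fix u w g h assume "{u, w} \<in> edges \<Gamma>"
    \<comment> \<open>\<open>{a, b}\<close> is not an edge, so every edge has an end whose vertex
      group acts trivially.\<close>
    then have "f u g = id \<or> f w h = id"
      using ab(4) edge_verts[of u w] by (auto simp: f_def r_def insert_commute)
    then show "f u g \<otimes>\<^bsub>bij_group\<^esub> f w h = f w h \<otimes>\<^bsub>bij_group\<^esub> f u g" by (auto simp: bij_group_def)
  qed auto
  then interpret \<psi>: group_hom P bij_group \<psi>
    by (simp add: group_hom_def group_hom_axioms_def P.group_axioms group_bij_group)
  show ?thesis
  proof (rule exI[of _ \<psi>], intro conjI ballI)
    show "group_hom P bij_group \<psi>" by (rule \<psi>.group_hom_axioms)
    show "\<psi> \<alpha> = (\<lambda>i::int. - i)" using \<psi>(2)[OF ab(1), of x] Ga by (simp add: f_def r_def)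
    show "\<psi> \<beta> = (\<lambda>i::int. 1 - i)" using \<psi>(2)[OF ab(2), of y] Gb ab(3) by (simp add: f_def r_def)
    fix p assume "p \<in> carrier P"
    then show "\<exists>s m. (s = 1 \<or> s = - 1) \<and> \<psi> p = (\<lambda>i. s * i + m)"
    proof (induction rule: P_induct)
      case one
      show ?case using \<psi>.hom_one by (intro exI[of _ 1] exI[of _ 0]) (auto simp: bij_group_def fun_eq_iff)
    next
      case (step v g p)
      then obtain s m where sm: "s = 1 \<or> s = - 1" "\<psi> p = (\<lambda>i. s * i + m)" by blast
      have "\<exists>s' m'. (s' = 1 \<or> s' = - 1) \<and> f v g = (\<lambda>i. s' * i + m')"
      proof -
        have "f v g = (\<lambda>i. 1 * i + 0) \<or> f v g = (\<lambda>i. (- 1) * i + 0) \<or> f v g = (\<lambda>i. (- 1) * i + 1)"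
          by (auto simp: f_def r_def fun_eq_iff)
        then show ?thesis by blast
      qed
      then obtain s' m' where sm': "s' = 1 \<or> s' = - 1" "f v g = (\<lambda>i. s' * i + m')" by blast
      have "\<psi> (\<iota> v g \<otimes>\<^bsub>P\<^esub> p) = f v g \<circ> \<psi> p"
        using \<psi>.hom_mult[OF \<iota>_closed[OF step.hyps(1,2)] step.hyps(3)] \<psi>(2)[OF step.hyps(1,2)]
        by (simp add: bij_group_def)
      also have "\<dots> = (\<lambda>i. (s' * s) * i + (s' * m + m'))"
        unfolding sm(2) sm'(2) by (simp add: fun_eq_iff algebra_simps)
      finally show ?case using sm(1) sm'(1) by (intro exI conjI) auto
    qed
  qed
qed

text \<open>The cover by powers of the translation \<open>t\<close> excludes three ends. Two ends
  are found by cutting the group according to the sign of the image of 0.\<close>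

lemma two_ended_dihedral:
  assumes fg: "finitely_generated P"
  shows "two_ended P"
proof -
  note cl = \<alpha>\<beta>_closed
  obtain \<psi> where \<psi>: "group_hom P bij_group \<psi>"
    "\<psi> \<alpha> = (\<lambda>i::int. - i)" "\<psi> \<beta> = (\<lambda>i::int. 1 - i)"
    "\<forall>p\<in>carrier P. \<exists>s m. (s = 1 \<or> s = - 1) \<and> \<psi> p = (\<lambda>i. s * i + m)"
    using reflection_action by blast
  interpret \<psi>: group_hom P bij_group \<psi> by fact
  have comp: "\<psi> (p \<otimes>\<^bsub>P\<^esub> q) = \<psi> p \<circ> \<psi> q" if "p \<in> carrier P" "q \<in> carrier P" for p q
    using \<psi>.hom_mult[OF that] by (simp add: bij_group_def)
  have \<psi>t: "\<psi> t = (\<lambda>i. i - 1)" unfolding comp[OF cl(1,2)] \<psi>(2,3) by (simp add: fun_eq_iff)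
  have \<psi>tn: "\<psi> (t [^]\<^bsub>P\<^esub> n) i = i - n" for n i :: int
  proof (induction n arbitrary: i rule: int_induct[where k = 0])
    case base
    then show ?case using \<psi>.hom_one by (simp add: bij_group_def)
  next
    case (step1 n)
    have "\<psi> (t [^]\<^bsub>P\<^esub> (n + 1)) = \<psi> (t [^]\<^bsub>P\<^esub> n) \<circ> \<psi> t"
      unfolding P.int_pow_mult[OF cl(3)] P.int_pow_1[OF cl(3)]
      by (rule comp[OF P.int_pow_closed[OF cl(3)] cl(3)])
    then show ?case using step1.IH by (simp add: \<psi>t)
  next
    case (step2 n)
    have "t [^]\<^bsub>P\<^esub> n = t [^]\<^bsub>P\<^esub> (n - 1) \<otimes>\<^bsub>P\<^esub> t"
      using P.int_pow_mult[OF cl(3), of "n - 1" 1] P.int_pow_1[OF cl(3)] by simp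
    then have "\<psi> (t [^]\<^bsub>P\<^esub> n) = \<psi> (t [^]\<^bsub>P\<^esub> (n - 1) \<otimes>\<^bsub>P\<^esub> t)" by (rule arg_cong)
    also have "\<dots> = \<psi> (t [^]\<^bsub>P\<^esub> (n - 1)) \<circ> \<psi> t" by (rule comp[OF P.int_pow_closed[OF cl(3)] cl(3)])
    finally have "\<psi> (t [^]\<^bsub>P\<^esub> n) = \<psi> (t [^]\<^bsub>P\<^esub> (n - 1)) \<circ> \<psi> t" .
    then have "\<psi> (t [^]\<^bsub>P\<^esub> (n - 1)) i = \<psi> (t [^]\<^bsub>P\<^esub> n) (i + 1)" by (simp add: \<psi>t)
    then show ?case using step2.IH by simp
  qed
  have inj: "inj (\<lambda>n::int. t [^]\<^bsub>P\<^esub> n)"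
  proof (rule injI)
    fix m n :: int assume "t [^]\<^bsub>P\<^esub> m = t [^]\<^bsub>P\<^esub> n"
    then have "\<psi> (t [^]\<^bsub>P\<^esub> m) 0 = \<psi> (t [^]\<^bsub>P\<^esub> n) 0" by (rule arg_cong)
    then show "m = n" unfolding \<psi>tn by simp
  qed
  define E where "E = N \<union> (\<lambda>n. \<alpha> \<otimes>\<^bsub>P\<^esub> n) ` N"
  have "finite N" by (rule finite_generate_gens_of) (use finV fin cone in auto)
  then have finE: "finite E" by (simp add: E_def)
  have gens: "gens_of (V - {a, b}) \<subseteq> carrier P" by (rule gens_of_subset) auto
  then have EP: "E \<subseteq> carrier P" 
    unfolding E_def using P.generate_in_carrier[OF gens] cl(1) by (intro Un_least image_subsetI subsetI P.m_closed)
  have cover: "\<exists>n::int. \<exists>e\<in>E. p = t [^]\<^bsub>P\<^esub> n \<otimes>\<^bsub>P\<^esub> e" if "p \<in> carrier P" for p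
    unfolding E_def by (rule dihedral_cover[OF that])
  have "\<not> ends_at_least P 3"
    by (rule P.not_ends_at_least_3_of_cyclic_cover[OF cl(3) inj finE EP cover])
  moreover have "ends_at_least P 2"
  proof -
    define A where "A = {p \<in> carrier P. \<psi> p 0 \<ge> 0}"
    \<comment> \<open>If \<open>p\<close> is \<open>t [^] n\<close> times \<open>e\<close>, then
      \<open>\<psi> p 0\<close> is \<open>\<psi> e 0 - n\<close>. So \<open>p\<close> is determined
      by \<open>e\<close>, which ranges over a finite set, and by the image of 0.\<close>
    have fibre: "finite {p \<in> carrier P. \<psi> p 0 \<in> B}" if "finite B" for B
    proof (rule finite_subset)
      show "{p \<in> carrier P. \<psi> p 0 \<in> B} \<subseteq> (\<Union>e\<in>E. (\<lambda>k. t [^]\<^bsub>P\<^esub> (\<psi> e 0 - k) \<otimes>\<^bsub>P\<^esub> e) ` B)"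
      proof
        fix p assume p: "p \<in> {p \<in> carrier P. \<psi> p 0 \<in> B}"
        then obtain n :: int and e where e: "e \<in> E" "p = t [^]\<^bsub>P\<^esub> n \<otimes>\<^bsub>P\<^esub> e" using cover by blast
        have "e \<in> carrier P" using e(1) EP by blast
        then have "\<psi> p 0 = \<psi> e 0 - n"
          unfolding e(2) comp[OF P.int_pow_closed[OF cl(3)] \<open>e \<in> carrier P\<close>] by (simp add: \<psi>tn)
        then have "p = t [^]\<^bsub>P\<^esub> (\<psi> e 0 - \<psi> p 0) \<otimes>\<^bsub>P\<^esub> e" using e(2) by simp
        then show "p \<in> (\<Union>e\<in>E. (\<lambda>k. t [^]\<^bsub>P\<^esub> (\<psi> e 0 - k) \<otimes>\<^bsub>P\<^esub> e) ` B)" using p e(1) by blast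
      qed
      show "finite (\<Union>e\<in>E. (\<lambda>k. t [^]\<^bsub>P\<^esub> (\<psi> e 0 - k) \<otimes>\<^bsub>P\<^esub> e) ` B)" using finE that by simp
    qed
    have A: "almost_invariant P A"
      unfolding almost_invariant_def
    proof (intro conjI ballI)
      show "A \<subseteq> carrier P" by (auto simp: A_def)
      fix g assume g: "g \<in> carrier P"
      \<comment> \<open>As \<open>\<psi> p\<close> is an isometry, right multiplication of
        \<open>p\<close> by \<open>g\<close> moves the image of 0 by exactly
        \<open>\<bar>\<psi> g 0\<bar>\<close>. Leaving \<open>A\<close> is possible only within this
        distance of the cut.\<close>
      have "{p \<in> A. p \<otimes>\<^bsub>P\<^esub> g \<notin> A} \<subseteq> {p \<in> carrier P. \<psi> p 0 \<in> {0..\<bar>\<psi> g 0\<bar>}}"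
      proof
        fix p assume "p \<in> {p \<in> A. p \<otimes>\<^bsub>P\<^esub> g \<notin> A}"
        then have p: "p \<in> carrier P" "\<psi> p 0 \<ge> 0" "\<not> \<psi> (p \<otimes>\<^bsub>P\<^esub> g) 0 \<ge> 0" using g by (auto simp: A_def)
        obtain s m where sm: "s = 1 \<or> s = - 1" "\<psi> p = (\<lambda>i. s * i + m)" using \<psi>(4) p(1) by blast
        have "\<psi> (p \<otimes>\<^bsub>P\<^esub> g) 0 = s * \<psi> g 0 + m" unfolding comp[OF p(1) g] sm(2) by simp
        then have "\<psi> p 0 \<in> {0..\<bar>\<psi> g 0\<bar>}" using p(2,3) sm by auto
        then show "p \<in> {p \<in> carrier P. \<psi> p 0 \<in> {0..\<bar>\<psi> g 0\<bar>}}" using p(1) by simp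
      qed
      then show "finite {p \<in> A. p \<otimes>\<^bsub>P\<^esub> g \<notin> A}" using fibre[of "{0..\<bar>\<psi> g 0\<bar>}"] finite_subset by blast
    qed
    \<comment> \<open>\<open>t\<close> translates by -1, so it is the non-positive powers that lie
      in \<open>A\<close>.\<close>
    have "(\<lambda>n. t [^]\<^bsub>P\<^esub> n) ` {..0::int} \<subseteq> A" using cl by (auto simp: A_def \<psi>tn)
    moreover have "(\<lambda>n. t [^]\<^bsub>P\<^esub> n) ` {1::int..} \<subseteq> carrier P - A" using cl by (auto simp: A_def \<psi>tn)
    moreover have "infinite ((\<lambda>n. t [^]\<^bsub>P\<^esub> n) ` {..0::int})" "infinite ((\<lambda>n. t [^]\<^bsub>P\<^esub> n) ` {1::int..})"
      using inj infinite_Iic[of "0::int"] infinite_Ici[of "1::int"]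
      by (simp_all add: finite_image_iff inj_on_subset[OF inj subset_UNIV])
    ultimately have inf: "infinite A" "infinite (carrier P - A)" using finite_subset by blast+
    then have "A \<noteq> {}" by auto
    then have "card {A, carrier P - A} = 2" "pairwise disjnt {A, carrier P - A}"
      by (auto simp: card_2_iff pairwise_insert disjnt_def)
    then show ?thesis
      unfolding ends_at_least_def using inf A P.almost_invariant_Compl[OF A]
      by (intro exI[of _ "{A, carrier P - A}"]) auto
  qed
  ultimately show ?thesis using two_ended_iff[OF P.group_axioms fg] by blast
qed

end

end

section \<open>The characterization of two-ended graph products\<close>

theorem propositionB:
  fixes \<Gamma> \<Gamma>\<^sub>1 \<Gamma>\<^sub>2 :: "'v sgraph"
    and G :: "'v \<Rightarrow> ('a, 'b) monoid_scheme"
  assumes "simplicial_graph \<Gamma>" and "finite_graph \<Gamma>"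
    and "\<And>v. v \<in> verts \<Gamma> \<Longrightarrow> group (G v)"
    and "\<And>v. v \<in> verts \<Gamma> \<Longrightarrow> \<not> trivial_group (G v)"
    and "\<And>v. v \<in> verts \<Gamma> \<Longrightarrow> finitely_generated (G v)"
    and "\<Gamma>\<^sub>1 = full_subgraph \<Gamma> (cone_vertices \<Gamma>)"
    and "\<Gamma>\<^sub>2 = full_subgraph \<Gamma> (verts \<Gamma> - cone_vertices \<Gamma>)"
  shows "two_ended (graph_product \<Gamma> G) \<longleftrightarrow>
    (complete_graph \<Gamma> \<and>
       (\<exists>v\<in>verts \<Gamma>. {w \<in> verts \<Gamma>. two_ended (G w)} = {v} \<and>
          (\<forall>w\<in>verts \<Gamma> - {v}. finite (carrier (G w))))) \<or>
    (complete_graph \<Gamma>\<^sub>1 \<and> (\<forall>v\<in>verts \<Gamma>\<^sub>1. finite (carrier (G v))) \<and>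
       (\<exists>a b. a \<noteq> b \<and> \<Gamma>\<^sub>2 = \<lparr>verts = {a, b}, edges = {}\<rparr> \<and>
          G a \<cong> integer_mod_group 2 \<and> G b \<cong> integer_mod_group 2))"

proof -
  interpret graph_of_groups \<Gamma> G
    by (rule graph_of_groups.intro) (rule assms)+
  have finV: "finite V" using assms(2) by (simp add: finite_graph_def)
  have fgP: "finitely_generated P" by (rule finitely_generated_P[OF finV assms(5)])
  have nontriv: "\<exists>g\<in>carrier (G v). g \<noteq> \<one>\<^bsub>G v\<^esub>" if v: "v \<in> V" for v
  proof (rule ccontr)
    interpret group "G v" by (rule groups[OF v])
    assume "\<not> ?thesis"
    then have "carrier (G v) = {\<one>\<^bsub>G v\<^esub>}" by auto
    then show False using assms(4)[OF v] group_axioms by (simp add: trivial_group_def)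
  qed
  have \<Gamma>1: "verts \<Gamma>\<^sub>1 = cone_vertices \<Gamma>"
    by (auto simp: assms(6) full_subgraph_def cone_vertices_def)
  show ?thesis (is "_ \<longleftrightarrow> ?complete \<or> ?dihedral")
  proof
    assume two: "two_ended P"
    show "?complete \<or> ?dihedral"
    proof (cases "complete_graph \<Gamma>")
      case True
      then have complete: "\<And>u w. u \<in> V \<Longrightarrow> w \<in> V \<Longrightarrow> u \<noteq> w \<Longrightarrow> {u, w} \<in> edges \<Gamma>"
        by (simp add: complete_graph_def)
      obtain v where v: "v \<in> V" "\<And>w. w \<in> V - {v} \<Longrightarrow> finite (carrier (G w))"
        using two_ended_complete[OF finV assms(5) complete two] by metis
      have "two_ended (G v)"
        using two_ended_complete_iff_vertex[OF finV assms(5) complete v] two by blast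
      \<comment> \<open>All other vertex groups are finite, and finite groups are not two-ended;
        this gives uniqueness.\<close>
      moreover have "\<not> two_ended (G w)" if "w \<in> V - {v}" for w
        using not_two_ended_finite[OF groups assms(5) v(2)] that by auto
      ultimately have "{w \<in> V. two_ended (G w)} = {v}" using v(1) by auto
      then have ?complete using True v by blast
      then show ?thesis ..
    next
      case False
      then obtain a b where ab: "a \<in> V" "b \<in> V" "a \<noteq> b" "{a, b} \<notin> edges \<Gamma>"
        unfolding complete_graph_def by blast
      then have ba: "b \<in> V" "a \<in> V" "b \<noteq> a" "{b, a} \<notin> edges \<Gamma>" by (auto simp: insert_commute)
      \<comment> \<open>\<open>two_ended_nonadjacent\<close> gives adjacency to the first vertex of
        the pair only; adjacency to \<open>b\<close> comes from exchanging \<open>a\<close> and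
        \<open>b\<close>.\<close>
      have others: "finite (carrier (G c))" "{a, c} \<in> edges \<Gamma>" "{b, c} \<in> edges \<Gamma>"
          "\<And>d. d \<in> V - {a, b} \<Longrightarrow> d \<noteq> c \<Longrightarrow> {c, d} \<in> edges \<Gamma>" if c: "c \<in> V - {a, b}" for c
        using two_ended_nonadjacent[OF fgP two nontriv ab c]
          two_ended_nonadjacent(2)[OF fgP two nontriv ba, of c] c by auto
      have cone: "cone_vertices \<Gamma> = V - {a, b}"
      proof (intro subset_antisym subsetI)
        fix c assume "c \<in> cone_vertices \<Gamma>"
        then show "c \<in> V - {a, b}" using ab ba by (auto simp: cone_vertices_def)
      next
        fix c assume c: "c \<in> V - {a, b}"
        have "{c, d} \<in> edges \<Gamma>" if d: "d \<in> V" "d \<noteq> c" for d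
          using others(2,3)[OF c] others(4)[OF c, of d] d by (cases "d = a \<or> d = b") (auto simp: insert_commute)
        then show "c \<in> cone_vertices \<Gamma>" using c by (simp add: cone_vertices_def)
      qed
      have "edges \<Gamma>\<^sub>2 = {}"
      proof (rule ccontr)
        assume "edges \<Gamma>\<^sub>2 \<noteq> {}"
        then obtain e where e: "e \<in> edges \<Gamma>" "e \<subseteq> {a, b}"
          using ab by (auto simp: assms(7) full_subgraph_def cone)
        then obtain u w where "e = {u, w}" "u \<noteq> w"
          using assms(1) by (auto simp: simplicial_graph_def card_2_iff)
        then have "e = {a, b}" using e(2) by auto
        then show False using e(1) ab(4) by simp
      qed
      moreover have "verts \<Gamma>\<^sub>2 = {a, b}" using ab by (auto simp: assms(7) full_subgraph_def cone)
      ultimately have \<Gamma>2: "\<Gamma>\<^sub>2 = \<lparr>verts = {a, b}, edges = {}\<rparr>" by simp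
      \<comment> \<open>Stated for an ordered pair in order to serve both \<open>a\<close> and
        \<open>b\<close>; only the first vertex group is determined each time.\<close>
      have Z2: "G u \<cong> integer_mod_group 2"
        if uw: "u \<in> V" "w \<in> V" "u \<noteq> w" "{u, w} \<notin> edges \<Gamma>" for u w
      proof -
        obtain x y where x: "x \<in> carrier (G u)" "x \<noteq> \<one>\<^bsub>G u\<^esub>"
          and y: "y \<in> carrier (G w)" "y \<noteq> \<one>\<^bsub>G w\<^esub>"
          using nontriv uw by meson
        interpret Gu: group "G u" by (rule groups[OF uw(1)])
        have "carrier (G u) = {\<one>\<^bsub>G u\<^esub>, x}"
        proof (intro subset_antisym subsetI)
          fix g assume "g \<in> carrier (G u)"
          then show "g \<in> {\<one>\<^bsub>G u\<^esub>, x}"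
            using nonadjacent_unique_nontrivial[OF fgP two uw x _ _ y, of g] by blast
        qed (use x(1) in auto)
        then show ?thesis unfolding Gu.is_iso_integer_mod_group_2_iff using x(2) by blast
      qed
      have "complete_graph \<Gamma>\<^sub>1"
        by (auto simp: complete_graph_def assms(6) full_subgraph_def cone_vertices_def)
      moreover have "\<forall>v\<in>verts \<Gamma>\<^sub>1. finite (carrier (G v))" using others(1) \<Gamma>1 cone by simp
      ultimately have ?dihedral using ab(3) \<Gamma>2 Z2[OF ab] Z2[OF ba] by blast
      then show ?thesis ..
    qed
  next
    assume "?complete \<or> ?dihedral"
    then show "two_ended P"
    proof
      assume ?complete
      then obtain v where v: "v \<in> V" "{w \<in> V. two_ended (G w)} = {v}"
          "\<And>w. w \<in> V - {v} \<Longrightarrow> finite (carrier (G w))"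
        and complete: "\<And>u w. u \<in> V \<Longrightarrow> w \<in> V \<Longrightarrow> u \<noteq> w \<Longrightarrow> {u, w} \<in> edges \<Gamma>"
        unfolding complete_graph_def by blast
      then show ?thesis
        using two_ended_complete_iff_vertex[OF finV assms(5) complete v(1) v(3)] by blast
    next
      assume ?dihedral
      then obtain a b where ab: "a \<noteq> b" "\<Gamma>\<^sub>2 = \<lparr>verts = {a, b}, edges = {}\<rparr>"
          "G a \<cong> integer_mod_group 2" "G b \<cong> integer_mod_group 2"
        and fin: "\<And>c. c \<in> cone_vertices \<Gamma> \<Longrightarrow> finite (carrier (G c))"
        using \<Gamma>1 by auto
      have "V - cone_vertices \<Gamma> = {a, b}"
        using arg_cong[OF ab(2), of verts] by (auto simp: assms(7) full_subgraph_def)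
      then have V: "a \<in> V" "b \<in> V" "V - {a, b} = cone_vertices \<Gamma>"
        by (auto simp: cone_vertices_def)
      \<comment> \<open>\<open>\<Gamma>\<^sub>2\<close> is a full subgraph that contains both
        vertices, so an edge between them would also be an edge of
        \<open>\<Gamma>\<^sub>2\<close>.\<close>
      have nadj: "{a, b} \<notin> edges \<Gamma>"
        using arg_cong[OF ab(2), of edges] \<open>V - cone_vertices \<Gamma> = {a, b}\<close>
        by (auto simp: assms(7) full_subgraph_def)
      obtain x where x: "carrier (G a) = {\<one>\<^bsub>G a\<^esub>, x}" "x \<noteq> \<one>\<^bsub>G a\<^esub>"
        using ab(3) group.is_iso_integer_mod_group_2_iff[OF groups[OF V(1)]] by blast
      obtain y where y: "carrier (G b) = {\<one>\<^bsub>G b\<^esub>, y}" "y \<noteq> \<one>\<^bsub>G b\<^esub>"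
        using ab(4) group.is_iso_integer_mod_group_2_iff[OF groups[OF V(2)]] by blast
      show ?thesis
      proof (rule two_ended_dihedral[OF finV V(1,2) ab(1) nadj x y _ _ fgP])
        show "{c, d} \<in> edges \<Gamma>" if "c \<in> V - {a, b}" "d \<in> V" "c \<noteq> d" for c d
          using that unfolding V(3) cone_vertices_def by auto
        show "finite (carrier (G c))" if "c \<in> V - {a, b}" for c
          using that fin unfolding V(3) by blast
      qed
    qed
  qed
qed

end
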